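(* Let $(\boldsymbol{\rho_0},\boldsymbol{\rho_1},\boldsymbol{\gamma_0},\boldsymbol{\gamma_1})$ be fixed admissible data on the network $\mathcal G$. Then, as $\kappa\to+\infty$, $$\mathcal W_\kappa^2(\boldsymbol{\rho_0},\boldsymbol{\rho_1},\boldsymbol{\gamma_0},\boldsymbol{\gamma_1})\longrightarrow\begin{cases}\mathcal W_{\mathcal E}^2(\boldsymbol{\rho_0},\boldsymbol{\rho_1})&\text{if }\boldsymbol{\gamma_0}=\boldsymbol{\gamma_1},\\+\infty&\text{otherwise.}\end{cases}$$ Moreover, for each $\kappa$ let $\boldsymbol\mu^\kappa=(\boldsymbol\rho^\kappa,\boldsymbol F^\kappa,\boldsymbol\gamma^\kappa,\boldsymbol f^\kappa)$ be any $\mathcal W_\kappa^2$-geodesic for these data. If $\boldsymbol{\gamma_0}=\boldsymbol{\gamma_1}$ and $\|\rho^j_0\|=\|\rho^j_1\|$ for all $j\in\{1,\dots,m\}$, then, up to a subsequence as $\kappa\to+\infty$, $(\boldsymbol\rho^\kappa,\boldsymbol F^\kappa)$ converges narrowly (as measures on $[0,1]\times\overline{E^j}$, $j=1,\dots,m$) to some $(\boldsymbol\rho,\boldsymbol F)$ which is a $\mathcal W_{\mathcal E}^2(\boldsymbol{\rho_0},\boldsymbol{\rho_1})$-geodesic, and $\|f^{i,\kappa}\|\to0$ for all $i\in\{1,\dots,n\}$.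
   Context: Network. $\mathcal G=(\mathcal V,\mathcal E)$ is a finite connected planar network with vertices $V^1,\dots,V^n\in\mathbb R^2$ and edges $E^1,\dots,E^m$, each edge being identified with a bounded open interval and oriented from its starting vertex $\alpha(E^j)$ to its end vertex $\omega(E^j)$; $\overline{E^j}$ is the closed edge and $x$ the coordinate along the orientation. $Z(V^i)$ is the set of indices $j$ with $\alpha(E^j)=V^i$ or $\omega(E^j)=V^i$. For $j\in Z(V^i)$, $\nu_{i,j}$ is the outward normal of $E^j$ at $V^i$ ($-1$ at the starting vertex, $+1$ at the end vertex). $\Omega_{\mathcal G}=\bigcup_i V^i\cup\bigcup_j E^j$, $Q_{\mathcal G}=[0,1]\times\Omega_{\mathcal G}$, $Q_{\overline{E^j}}=[0,1]\times\overline{E^j}$. $C^1(Q_{\mathcal G})$ is the set of continuous functions on $Q_{\mathcal G}$ whose restriction to each $Q_{\overline{E^j}}$ is $C^1$. Admissible data. $\boldsymbol{\rho_l}=(\rho_l^1,\dots,\rho_l^m)$ with $\rho_l^j\in\mathcal M_+(E^j)$ (finite non-negative Borel measures, extended by zero to $\overline{E^j}$), $\boldsymbol{\gamma_l}=(\gamma_l^1,\dots,\gamma_l^n)\in[0,\infty)^n$ (the number $\gamma_l^i$ standing for the measure $\gamma_l^i\delta_{V^i}$), $l\in\{0,1\}$, with total mass $\sum_j\rho_l^j(E^j)+\sum_i\gamma_l^i=1$ for $l=0,1$. $\|\cdot\|$ denotes the total mass (total variation) of a measure. Continuity equation. $\mathcal{CE}(\boldsymbol{\rho_0},\boldsymbol{\rho_1},\boldsymbol{\gamma_0},\boldsymbol{\gamma_1})$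 is the set of $\boldsymbol\mu=(\boldsymbol\rho,\boldsymbol F,\boldsymbol\gamma,\boldsymbol f)$, where $\rho^j,F^j$ are finite signed Borel measures on $Q_{\overline{E^j}}$, $\gamma^i=\gamma^i_t\,dt$ with $t\mapsto\gamma^i_t$ integrable on $[0,1]$, and $f^i$ is a finite signed Borel measure on $[0,1]$, such that for all $\varphi\in C^1(Q_{\mathcal G})$ $$\sum_{j=1}^m\iint_{Q_{\overline{E^j}}}\big(\partial_t\varphi\,d\rho^j+\partial_x\varphi\,dF^j\big)-\sum_{i=1}^n\int_{[0,1]}\varphi(t,V^i)\,df^i(t)=\sum_{j=1}^m\Big[\int_{\overline{E^j}}\varphi(1,\cdot)\,d\rho_1^j-\int_{\overline{E^j}}\varphi(0,\cdot)\,d\rho_0^j\Big]\quad( * )$$ and for all $\varphi^1,\dots,\varphi^n\in C^1([0,1])$ $$\sum_{i=1}^n\int_0^1\partial_t\varphi^i\,\gamma^i_t\,dt=-\sum_{i=1}^n\int_{[0,1]}\varphi^i\,df^i+\sum_{i=1}^n\big[\varphi^i(1)\gamma_1^i-\varphi^i(0)\gamma_0^i\big].$$ (Formally: $\partial_t\rho^j+\partial_xF^j=0$ on $E^j$, $\partial_t\gamma^i=f^i=\sum_{j\in Z(V^i)}F^j(V^i)\nu_{i,j}$.) Action. $A(a,b)=|b|^2/(2a)$ if $a>0$, $A(0,0)=0$, $A=+\infty$ otherwise. For $\kappa>0$, $$\mathcal A(\boldsymbol\mu)=\sum_{j=1}^m\iint_{Q_{\overline{E^j}}}A\Big(\tfrac{d\rho^j}{d\theta^j},\tfrac{dF^j}{d\theta^j}\Big)d\theta^j+\kappa^2\sum_{i=1}^n\int_0^1A(\gamma^i_t,f^i_t)\,dt,$$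 where $\theta^j$ is any non-negative Borel measure with $|\rho^j|,|F^j|\ll\theta^j$, and the $i$-th vertex term is $+\infty$ if $f^i$ is not of the form $f^i_t\,dt$. Set $\mathcal W_\kappa^2(\boldsymbol{\rho_0},\boldsymbol{\rho_1},\boldsymbol{\gamma_0},\boldsymbol{\gamma_1})=\inf\{\mathcal A(\boldsymbol\mu):\boldsymbol\mu\in\mathcal{CE}(\boldsymbol{\rho_0},\boldsymbol{\rho_1},\boldsymbol{\gamma_0},\boldsymbol{\gamma_1})\}$. A $\mathcal W_\kappa^2$-geodesic is a minimiser of this problem. Edge Wasserstein metric with Kirchhoff coupling. If $\sum_j\|\rho_0^j\|=\sum_j\|\rho_1^j\|$, then $\mathcal W_{\mathcal E}^2(\boldsymbol{\rho_0},\boldsymbol{\rho_1})$ is the minimum of $\sum_{j=1}^m\iint_{Q_{\overline{E^j}}}A\big(\tfrac{d\rho^j}{d\theta^j},\tfrac{dF^j}{d\theta^j}\big)d\theta^j$ over all $(\boldsymbol\rho,\boldsymbol F)$ joining $\boldsymbol{\rho_0}$ to $\boldsymbol{\rho_1}$ and solving $\partial_t\rho^j+\partial_xF^j=0$ in $E^j$ with Kirchhoff's law $\sum_{j\in Z(V^i)}F^j\cdot\nu_{i,j}=0$ at each vertex $V^i$, in the weak sense that $( * )$ holds with all $f^i=0$. A $\mathcal W_{\mathcal E}^2$-geodesic is a minimiser of this problem. *)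

theory Defs
  imports "HOL-Analysis.Analysis"
begin

section \<open>Finite signed measures\<close>

text \<open>
  A finite signed measure on a measurable space \<open>M\<close> (only \<open>space M\<close> and \<open>sets M\<close> matter) is a
  real-valued countably additive set function; its values outside \<open>sets M\<close> are irrelevant.
\<close>

definition signed_measure :: "'a measure \<Rightarrow> ('a set \<Rightarrow> real) \<Rightarrow> bool" where
  "signed_measure M \<mu> \<longleftrightarrow>
     \<mu> {} = 0 \<and>
     (\<forall>A :: nat \<Rightarrow> 'a set. range A \<subseteq> sets M \<longrightarrow> disjoint_family A \<longrightarrow>
        (\<lambda>k. \<mu> (A k)) sums \<mu> (\<Union>k. A k))"

text \<open>
  Jordan decomposition. Note that \<^term>\<open>ennreal\<close> sends negative numbers to \<open>0\<close>, which does not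
  affect the supremum because of \<open>B = {}\<close>.
\<close>

definition pos_part :: "'a measure \<Rightarrow> ('a set \<Rightarrow> real) \<Rightarrow> 'a measure" where
  "pos_part M \<mu> = measure_of (space M) (sets M)
     (\<lambda>A. SUP B\<in>{B \<in> sets M. B \<subseteq> A}. ennreal (\<mu> B))"

definition neg_part :: "'a measure \<Rightarrow> ('a set \<Rightarrow> real) \<Rightarrow> 'a measure" where
  "neg_part M \<mu> = pos_part M (\<lambda>A. - \<mu> A)"

definition variation :: "'a measure \<Rightarrow> ('a set \<Rightarrow> real) \<Rightarrow> 'a measure" where
  "variation M \<mu> = measure_of (space M) (sets M)
     (\<lambda>A. emeasure (pos_part M \<mu>) A + emeasure (neg_part M \<mu>) A)"

definition total_mass :: "'a measure \<Rightarrow> ('a set \<Rightarrow> real) \<Rightarrow> real" where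
  "total_mass M \<mu> = measure (variation M \<mu>) (space M)"

definition signed_integral :: "'a measure \<Rightarrow> ('a set \<Rightarrow> real) \<Rightarrow> ('a \<Rightarrow> real) \<Rightarrow> real" where
  "signed_integral M \<mu> g = integral\<^sup>L (pos_part M \<mu>) g - integral\<^sup>L (neg_part M \<mu>) g"

definition has_signed_density :: "'a measure \<Rightarrow> ('a set \<Rightarrow> real) \<Rightarrow> ('a \<Rightarrow> real) \<Rightarrow> bool" where
  "has_signed_density \<theta> \<mu> g \<longleftrightarrow>
     integrable \<theta> g \<and> (\<forall>B\<in>sets \<theta>. \<mu> B = set_lebesgue_integral \<theta> B g)"

text \<open>The density \<open>d\<mu>/d\<theta>\<close> (unique up to \<open>\<theta>\<close>-null sets), when there is one.\<close>

definition signed_deriv :: "'a measure \<Rightarrow> ('a set \<Rightarrow> real) \<Rightarrow> 'a \<Rightarrow> real" where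
  "signed_deriv \<theta> \<mu> = (SOME g. has_signed_density \<theta> \<mu> g)"

definition narrowly_converges ::
  "'a::topological_space set \<Rightarrow> (nat \<Rightarrow> 'a set \<Rightarrow> real) \<Rightarrow> ('a set \<Rightarrow> real) \<Rightarrow> bool" where
  "narrowly_converges S \<mu>s \<mu> \<longleftrightarrow>
     (\<forall>\<psi>. continuous_on S \<psi> \<longrightarrow> bounded (\<psi> ` S) \<longrightarrow>
        (\<lambda>k. signed_integral (restrict_space borel S) (\<mu>s k) \<psi>)
          \<longlonglongrightarrow> signed_integral (restrict_space borel S) \<mu> \<psi>)"


section \<open>Planar networks\<close>

text \<open>
  Vertices and edges are indexed by finite types. The edge \<open>j\<close>, oriented from \<open>src j\<close> to
  \<open>tgt j\<close>, is identified with the open interval from \<open>0\<close> to \<open>len j\<close> through the curve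
  \<open>crv j\<close>, and its closure with the closed interval. Measures on edges live on these
  intervals.
\<close>

record ('v, 'e) network =
  vtx :: "'v \<Rightarrow> real ^ 2"
  src :: "'e \<Rightarrow> 'v"
  tgt :: "'e \<Rightarrow> 'v"
  len :: "'e \<Rightarrow> real"
  crv :: "'e \<Rightarrow> real \<Rightarrow> real ^ 2"

abbreviation open_edge :: "('v, 'e) network \<Rightarrow> 'e \<Rightarrow> real set" where
  "open_edge G j \<equiv> {0<..<len G j}"

abbreviation closed_edge :: "('v, 'e) network \<Rightarrow> 'e \<Rightarrow> real set" where
  "closed_edge G j \<equiv> {0..len G j}"

definition planar_network :: "('v::finite, 'e::finite) network \<Rightarrow> bool" where
  "planar_network G \<longleftrightarrow>
     inj (vtx G) \<and>
     (\<forall>j. len G j > 0 \<and> continuous_on (closed_edge G j) (crv G j) \<and>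
          crv G j 0 = vtx G (src G j) \<and> crv G j (len G j) = vtx G (tgt G j) \<and>
          inj_on (crv G j) (open_edge G j) \<and>
          crv G j ` open_edge G j \<inter> range (vtx G) = {}) \<and>
     (\<forall>j k. j \<noteq> k \<longrightarrow> crv G j ` open_edge G j \<inter> crv G k ` open_edge G k = {}) \<and>
     (\<forall>u v. (u, v) \<in> ((\<Union>j. {(src G j, tgt G j), (tgt G j, src G j)}))\<^sup>*)"

definition Omega :: "('v, 'e) network \<Rightarrow> (real ^ 2) set" where
  "Omega G = range (vtx G) \<union> (\<Union>j. crv G j ` open_edge G j)"

definition Q_edge :: "('v, 'e) network \<Rightarrow> 'e \<Rightarrow> (real \<times> real) set" where
  "Q_edge G j = {0..1} \<times> closed_edge G j"

abbreviation borel_Q :: "('v, 'e) network \<Rightarrow> 'e \<Rightarrow> (real \<times> real) measure" where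
  "borel_Q G j \<equiv> restrict_space borel (Q_edge G j)"

abbreviation borel_I :: "real measure" where
  "borel_I \<equiv> restrict_space borel {0..1}"

abbreviation lborel_I :: "real measure" where
  "lborel_I \<equiv> restrict_space lborel {0..1}"


section \<open>Test functions\<close>

text \<open>Derivatives are one-sided at the boundary.\<close>

definition C1_unit :: "(real \<Rightarrow> real) \<Rightarrow> bool" where
  "C1_unit \<eta> \<longleftrightarrow>
     (\<forall>t\<in>{0..1}. \<eta> differentiable (at t within {0..1})) \<and>
     continuous_on {0..1} (\<lambda>t. vector_derivative \<eta> (at t within {0..1}))"

definition dt :: "(real \<times> real \<Rightarrow> real) \<Rightarrow> real \<times> real \<Rightarrow> real" where
  "dt g = (\<lambda>(t, x). vector_derivative (\<lambda>s. g (s, x)) (at t within {0..1}))"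

definition dx :: "real \<Rightarrow> (real \<times> real \<Rightarrow> real) \<Rightarrow> real \<times> real \<Rightarrow> real" where
  "dx l g = (\<lambda>(t, x). vector_derivative (\<lambda>y. g (t, y)) (at x within {0..l}))"

definition C1_rect :: "real \<Rightarrow> (real \<times> real \<Rightarrow> real) \<Rightarrow> bool" where
  "C1_rect l g \<longleftrightarrow>
     (\<forall>t\<in>{0..1}. \<forall>x\<in>{0..l}.
        (\<lambda>s. g (s, x)) differentiable (at t within {0..1}) \<and>
        (\<lambda>y. g (t, y)) differentiable (at x within {0..l})) \<and>
     continuous_on ({0..1} \<times> {0..l}) (dt g) \<and>
     continuous_on ({0..1} \<times> {0..l}) (dx l g)"

definition on_edge ::
  "('v, 'e) network \<Rightarrow> 'e \<Rightarrow> (real \<times> (real ^ 2) \<Rightarrow> real) \<Rightarrow> real \<times> real \<Rightarrow> real" where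
  "on_edge G j \<phi> = (\<lambda>(t, x). \<phi> (t, crv G j x))"

definition C1_network :: "('v, 'e) network \<Rightarrow> (real \<times> (real ^ 2) \<Rightarrow> real) \<Rightarrow> bool" where
  "C1_network G \<phi> \<longleftrightarrow>
     continuous_on ({0..1} \<times> Omega G) \<phi> \<and> (\<forall>j. C1_rect (len G j) (on_edge G j \<phi>))"


section \<open>Admissible data and the coupled continuity equation\<close>

definition admissible ::
  "('v::finite, 'e::finite) network \<Rightarrow> ('e \<Rightarrow> real measure) \<Rightarrow> ('v \<Rightarrow> real) \<Rightarrow> bool" where
  "admissible G r c \<longleftrightarrow>
     (\<forall>j. sets (r j) = sets (restrict_space borel (open_edge G j)) \<and> finite_measure (r j)) \<and>
     (\<forall>i. c i \<ge> 0) \<and>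
     (\<Sum>j\<in>UNIV. measure (r j) (open_edge G j)) + (\<Sum>i\<in>UNIV. c i) = 1"

definition extend_zero :: "('v, 'e) network \<Rightarrow> 'e \<Rightarrow> real measure \<Rightarrow> real measure" where
  "extend_zero G j r = distr r (restrict_space borel (closed_edge G j)) (\<lambda>x. x)"

definition edge_equation ::
  "('v::finite, 'e::finite) network \<Rightarrow> ('e \<Rightarrow> real measure) \<Rightarrow> ('e \<Rightarrow> real measure) \<Rightarrow>
   ('e \<Rightarrow> (real \<times> real) set \<Rightarrow> real) \<Rightarrow> ('e \<Rightarrow> (real \<times> real) set \<Rightarrow> real) \<Rightarrow>
   ('v \<Rightarrow> real set \<Rightarrow> real) \<Rightarrow> bool" where
  "edge_equation G \<rho>0 \<rho>1 \<rho> F f \<longleftrightarrow>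
     (\<forall>\<phi>. C1_network G \<phi> \<longrightarrow>
        (\<Sum>j\<in>UNIV. signed_integral (borel_Q G j) (\<rho> j) (dt (on_edge G j \<phi>))
                 + signed_integral (borel_Q G j) (F j) (dx (len G j) (on_edge G j \<phi>)))
        - (\<Sum>i\<in>UNIV. signed_integral borel_I (f i) (\<lambda>t. \<phi> (t, vtx G i)))
        = (\<Sum>j\<in>UNIV. (LINT x|extend_zero G j (\<rho>1 j). on_edge G j \<phi> (1, x))
                   - (LINT x|extend_zero G j (\<rho>0 j). on_edge G j \<phi> (0, x))))"

definition vertex_equation ::
  "('v::finite \<Rightarrow> real) \<Rightarrow> ('v \<Rightarrow> real) \<Rightarrow> ('v \<Rightarrow> real \<Rightarrow> real) \<Rightarrow> ('v \<Rightarrow> real set \<Rightarrow> real) \<Rightarrow> bool" where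
  "vertex_equation \<gamma>0 \<gamma>1 \<gamma> f \<longleftrightarrow>
     (\<forall>\<eta> :: 'v \<Rightarrow> real \<Rightarrow> real. (\<forall>i. C1_unit (\<eta> i)) \<longrightarrow>
        (\<Sum>i\<in>UNIV. LINT t|lborel_I. vector_derivative (\<eta> i) (at t within {0..1}) * \<gamma> i t)
        = - (\<Sum>i\<in>UNIV. signed_integral borel_I (f i) (\<eta> i))
          + (\<Sum>i\<in>UNIV. \<eta> i 1 * \<gamma>1 i - \<eta> i 0 * \<gamma>0 i))"

record ('v, 'e) curve =
  rho :: "'e \<Rightarrow> (real \<times> real) set \<Rightarrow> real"
  flux :: "'e \<Rightarrow> (real \<times> real) set \<Rightarrow> real"
  gam :: "'v \<Rightarrow> real \<Rightarrow> real"
  vflux :: "'v \<Rightarrow> real set \<Rightarrow> real"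

definition CE ::
  "('v::finite, 'e::finite) network \<Rightarrow> ('e \<Rightarrow> real measure) \<Rightarrow> ('e \<Rightarrow> real measure) \<Rightarrow>
   ('v \<Rightarrow> real) \<Rightarrow> ('v \<Rightarrow> real) \<Rightarrow> ('v, 'e) curve set" where
  "CE G \<rho>0 \<rho>1 \<gamma>0 \<gamma>1 = {\<mu>.
     (\<forall>j. signed_measure (borel_Q G j) (rho \<mu> j) \<and> signed_measure (borel_Q G j) (flux \<mu> j)) \<and>
     (\<forall>i. integrable lborel_I (gam \<mu> i) \<and> signed_measure borel_I (vflux \<mu> i)) \<and>
     edge_equation G \<rho>0 \<rho>1 (rho \<mu>) (flux \<mu>) (vflux \<mu>) \<and>
     vertex_equation \<gamma>0 \<gamma>1 (gam \<mu>) (vflux \<mu>)}"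


section \<open>Action and transport costs\<close>

definition A_fun :: "real \<Rightarrow> real \<Rightarrow> ennreal" where
  "A_fun a b = (if a > 0 then ennreal (\<bar>b\<bar>\<^sup>2 / (2 * a))
                else if a = 0 \<and> b = 0 then 0 else \<infinity>)"

text \<open>
  By 1-homogeneity of \<^const>\<open>A_fun\<close>, the action of an edge does not depend on the reference
  measure \<open>\<theta>\<close> dominating \<open>\<bar>\<rho>\<bar>\<close> and \<open>\<bar>F\<bar>\<close>; we use \<open>\<theta> = \<bar>\<rho>\<bar> + \<bar>F\<bar>\<close>.
\<close>

definition ref_measure ::
  "'a measure \<Rightarrow> ('a set \<Rightarrow> real) \<Rightarrow> ('a set \<Rightarrow> real) \<Rightarrow> 'a measure" where
  "ref_measure M \<rho> F = measure_of (space M) (sets M)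
     (\<lambda>B. emeasure (variation M \<rho>) B + emeasure (variation M F) B)"

definition density_action :: "'a measure \<Rightarrow> ('a set \<Rightarrow> real) \<Rightarrow> ('a set \<Rightarrow> real) \<Rightarrow> ennreal" where
  "density_action \<theta> \<rho> F = (\<integral>\<^sup>+ z. A_fun (signed_deriv \<theta> \<rho> z) (signed_deriv \<theta> F z) \<partial>\<theta>)"

definition edge_action ::
  "('v, 'e::finite) network \<Rightarrow> ('e \<Rightarrow> (real \<times> real) set \<Rightarrow> real) \<Rightarrow>
   ('e \<Rightarrow> (real \<times> real) set \<Rightarrow> real) \<Rightarrow> ennreal" where
  "edge_action G \<rho> F =
     (\<Sum>j\<in>UNIV. density_action (ref_measure (borel_Q G j) (\<rho> j) (F j)) (\<rho> j) (F j))"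

definition vertex_action :: "(real \<Rightarrow> real) \<Rightarrow> (real set \<Rightarrow> real) \<Rightarrow> ennreal" where
  "vertex_action c f =
     (if \<exists>g. has_signed_density lborel_I f g
      then \<integral>\<^sup>+ t. A_fun (c t) (signed_deriv lborel_I f t) \<partial>lborel_I
      else \<infinity>)"

definition action :: "('v::finite, 'e::finite) network \<Rightarrow> real \<Rightarrow> ('v, 'e) curve \<Rightarrow> ennreal" where
  "action G \<kappa> \<mu> = edge_action G (rho \<mu>) (flux \<mu>)
     + ennreal (\<kappa>\<^sup>2) * (\<Sum>i\<in>UNIV. vertex_action (gam \<mu> i) (vflux \<mu> i))"

text \<open>Values in \<^typ>\<open>ennreal\<close>; the infimum over an empty set is \<open>\<infinity>\<close>.\<close>

definition W_sq ::
  "('v::finite, 'e::finite) network \<Rightarrow> real \<Rightarrow> ('e \<Rightarrow> real measure) \<Rightarrow> ('e \<Rightarrow> real measure) \<Rightarrow>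
   ('v \<Rightarrow> real) \<Rightarrow> ('v \<Rightarrow> real) \<Rightarrow> ennreal" where
  "W_sq G \<kappa> \<rho>0 \<rho>1 \<gamma>0 \<gamma>1 = (INF \<mu>\<in>CE G \<rho>0 \<rho>1 \<gamma>0 \<gamma>1. action G \<kappa> \<mu>)"

definition W_geodesic ::
  "('v::finite, 'e::finite) network \<Rightarrow> real \<Rightarrow> ('e \<Rightarrow> real measure) \<Rightarrow> ('e \<Rightarrow> real measure) \<Rightarrow>
   ('v \<Rightarrow> real) \<Rightarrow> ('v \<Rightarrow> real) \<Rightarrow> ('v, 'e) curve \<Rightarrow> bool" where
  "W_geodesic G \<kappa> \<rho>0 \<rho>1 \<gamma>0 \<gamma>1 \<mu> \<longleftrightarrow>
     is_arg_min (action G \<kappa>) (\<lambda>\<nu>. \<nu> \<in> CE G \<rho>0 \<rho>1 \<gamma>0 \<gamma>1) \<mu>"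

text \<open>
  The problem with Kirchhoff's law at the vertices, encoded by vanishing vertex sources in the
  weak edge equation.
\<close>

definition CE_edge ::
  "('v::finite, 'e::finite) network \<Rightarrow> ('e \<Rightarrow> real measure) \<Rightarrow> ('e \<Rightarrow> real measure) \<Rightarrow>
   (('e \<Rightarrow> (real \<times> real) set \<Rightarrow> real) \<times> ('e \<Rightarrow> (real \<times> real) set \<Rightarrow> real)) set" where
  "CE_edge G \<rho>0 \<rho>1 = {(\<rho>, F).
     (\<forall>j. signed_measure (borel_Q G j) (\<rho> j) \<and> signed_measure (borel_Q G j) (F j)) \<and>
     edge_equation G \<rho>0 \<rho>1 \<rho> F (\<lambda>i B. 0)}"

definition W_edge_sq ::
  "('v::finite, 'e::finite) network \<Rightarrow> ('e \<Rightarrow> real measure) \<Rightarrow> ('e \<Rightarrow> real measure) \<Rightarrow> ennreal" where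
  "W_edge_sq G \<rho>0 \<rho>1 = (INF (\<rho>, F)\<in>CE_edge G \<rho>0 \<rho>1. edge_action G \<rho> F)"

definition W_edge_geodesic ::
  "('v::finite, 'e::finite) network \<Rightarrow> ('e \<Rightarrow> real measure) \<Rightarrow> ('e \<Rightarrow> real measure) \<Rightarrow>
   ('e \<Rightarrow> (real \<times> real) set \<Rightarrow> real) \<Rightarrow> ('e \<Rightarrow> (real \<times> real) set \<Rightarrow> real) \<Rightarrow> bool" where
  "W_edge_geodesic G \<rho>0 \<rho>1 \<rho> F \<longleftrightarrow>
     is_arg_min (\<lambda>(\<rho>, F). edge_action G \<rho> F) (\<lambda>p. p \<in> CE_edge G \<rho>0 \<rho>1) (\<rho>, F)"

end

theory Submission
  imports Defs "HOL-Probability.Giry_Monad" "HOL-Probability.Helly_Selection"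
begin

text \<open>
  Testing the continuity equation with \<open>t\<close> shows that the total mass in space-time is \<open>1\<close>. Together
  with \<open>\<bar>f\<bar> \<le> A(\<gamma>, f) / \<epsilon> + \<epsilon> \<gamma> / 2\<close> this bounds \<open>\<rho>\<close> and \<open>F\<close>, and for \<open>\<epsilon> = 1 / \<kappa>\<close> it shows that the
  vertex fluxes of curves of bounded action are of order \<open>1 / \<kappa>\<close>. As \<open>\<gamma>1 - \<gamma>0\<close> is the total vertex
  flux, the cost blows up unless \<open>\<gamma>0 = \<gamma>1\<close>. Otherwise narrow limits of \<open>(\<rho>, F)\<close> satisfy Kirchhoff's
  law, and the edge action is narrowly lower semicontinuous, being the supremum of
  \<open>\<integral>a d\<rho> + \<integral>b dF\<close> over continuous \<open>a \<le> -b\<^sup>2 / 2\<close>. Narrow compactness on a rectangle is reduced to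
  Helly's theorem on the line by a space filling curve with a Borel section. If the masses of the
  edges agree, the limit problem has finite value, so that geodesics have bounded action.
\<close>

section \<open>Signed measures\<close>

text \<open>The continuity equation does not say that densities are nonnegative; finiteness of the
  action does. Only then does the identity for the total mass bound every edge and every vertex
  separately, uniformly in \<open>\<kappa>\<close>. Narrow limits and explicit competitors arise as
  differences of two finite measures that may overlap, so integrals have to be shown independent of
  the chosen decomposition. No limit of \<open>\<gamma>\<close> is taken: Kirchhoff's law sees the
  vertices only through \<open>f\<close>, whose total mass tends to 0. One compactness statement, in
  which the constant bounding the actions also bounds the edge action of the limit, serves both for
  the lower bound on the costs and for the minimality of limits of geodesics. The upper bound holds
  because a Kirchhoff curve with constant \<open>\<gamma>\<close> and \<open>f = 0\<close> is a
  competitor whose action is the same for every \<open>\<kappa>\<close>. Equal masses on each edge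
  provide a competitor that moves mass only inside the edges, so that the vertex sources vanish and
  the edges decouple.\<close>

lemma signed_measure_empty: "signed_measure M \<mu> \<Longrightarrow> \<mu> {} = 0"
  by (simp add: signed_measure_def)

lemma signed_measure_sums:
  assumes "signed_measure M \<mu>" "range A \<subseteq> sets M" "disjoint_family (A :: nat \<Rightarrow> _)"
  shows "(\<lambda>k. \<mu> (A k)) sums \<mu> (\<Union>k. A k)"
  using assms by (simp add: signed_measure_def)

lemma signed_measure_Un:
  assumes \<mu>: "signed_measure M \<mu>" and A: "A \<in> sets M" and B: "B \<in> sets M" and dj: "A \<inter> B = {}"
  shows "\<mu> (A \<union> B) = \<mu> A + \<mu> B"
proof -
  have "(\<lambda>k. \<mu> (binaryset A B k)) sums \<mu> (\<Union>k. binaryset A B k)"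
    using A B dj by (intro signed_measure_sums[OF \<mu>])
      (auto simp: range_binaryset_eq disjoint_family_on_def binaryset_def)
  moreover have "(\<lambda>k. \<mu> (binaryset A B k)) sums (\<mu> A + \<mu> B)"
    by (rule binaryset_sums) (rule signed_measure_empty[OF \<mu>])
  ultimately show ?thesis
    using sums_unique2 by (metis UN_binaryset_eq)
qed

lemma signed_measure_Diff:
  assumes "signed_measure M \<mu>" "A \<in> sets M" "B \<in> sets M" "B \<subseteq> A"
  shows "\<mu> (A - B) = \<mu> A - \<mu> B"
proof -
  have "\<mu> (B \<union> (A - B)) = \<mu> B + \<mu> (A - B)"
    using assms by (intro signed_measure_Un) auto
  moreover have "B \<union> (A - B) = A" using assms by auto
  ultimately show ?thesis by simp
qed

lemma signed_measure_uminus: "signed_measure M \<mu> \<Longrightarrow> signed_measure M (\<lambda>A. - \<mu> A)"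
  by (auto simp: signed_measure_def intro: sums_minus)

lemma signed_measure_measure:
  assumes "finite_measure a" "finite_measure b" "sets a = sets M" "sets b = sets M"
  shows "signed_measure M (\<lambda>A. measure a A - measure b A)"
  unfolding signed_measure_def using assms
  by (auto intro!: sums_diff finite_measure.finite_measure_UNION)

section \<open>Jordan decomposition of a signed measure\<close>

definition upper_variation :: "'a measure \<Rightarrow> ('a set \<Rightarrow> real) \<Rightarrow> 'a set \<Rightarrow> ennreal" where
  "upper_variation M \<mu> A = (SUP B\<in>{B \<in> sets M. B \<subseteq> A}. ennreal (\<mu> B))"

lemma upper_variation_upper: "B \<in> sets M \<Longrightarrow> B \<subseteq> A \<Longrightarrow> ennreal (\<mu> B) \<le> upper_variation M \<mu> A"
  unfolding upper_variation_def by (rule SUP_upper) auto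

lemma upper_variation_mono: "A \<subseteq> A' \<Longrightarrow> upper_variation M \<mu> A \<le> upper_variation M \<mu> A'"
  unfolding upper_variation_def by (rule SUP_subset_mono) auto

text \<open>Competitors for \<open>A\<close> and \<open>A'\<close> are disjoint, so their union
  competes for \<open>A \<union> A'\<close> with the sum of the values.\<close>

lemma upper_variation_superadd:
  assumes \<mu>: "signed_measure M \<mu>" and dj: "A \<inter> A' = {}"
  shows "upper_variation M \<mu> A + upper_variation M \<mu> A' \<le> upper_variation M \<mu> (A \<union> A')"
proof -
  let ?U = "upper_variation M \<mu> (A \<union> A')"
  have *: "ennreal (\<mu> B) + ennreal (\<mu> B') \<le> ?U"
    if B: "B \<in> {B \<in> sets M. B \<subseteq> A}" and B': "B' \<in> {B \<in> sets M. B \<subseteq> A'}" for B B'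
  proof -
    have le: "ennreal (\<mu> B) \<le> ?U" "ennreal (\<mu> B') \<le> ?U" "ennreal (\<mu> (B \<union> B')) \<le> ?U"
      using B B' by (auto intro!: upper_variation_upper)
    have eq: "\<mu> (B \<union> B') = \<mu> B + \<mu> B'"
      using B B' dj by (intro signed_measure_Un[OF \<mu>]) auto
    show ?thesis
    \<comment> \<open>\<open>ennreal\<close> cuts a negative value to 0; in that case the other set
      alone is the better competitor.\<close>
    proof (cases "0 \<le> \<mu> B \<and> 0 \<le> \<mu> B'")
      case True
      with le(3) eq show ?thesis by (simp add: ennreal_plus)
    next
      case False
      then have "ennreal (\<mu> B) = 0 \<or> ennreal (\<mu> B') = 0"
        by (auto simp: ennreal_neg)
      with le show ?thesis by auto
    qed
  qed
  have ne: "{B \<in> sets M. B \<subseteq> A} \<noteq> {}" "{B \<in> sets M. B \<subseteq> A'} \<noteq> {}"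
    by auto
  have "upper_variation M \<mu> A + upper_variation M \<mu> A' =
     (SUP B\<in>{B \<in> sets M. B \<subseteq> A}. ennreal (\<mu> B) + upper_variation M \<mu> A')"
    unfolding upper_variation_def[of M \<mu> A] by (rule ennreal_SUP_add_left[OF ne(1), symmetric])
  also have "\<dots> =
     (SUP B\<in>{B \<in> sets M. B \<subseteq> A}. SUP B'\<in>{B \<in> sets M. B \<subseteq> A'}. ennreal (\<mu> B) + ennreal (\<mu> B'))"
    unfolding upper_variation_def[of M \<mu> A'] by (simp only: ennreal_SUP_add_right[OF ne(2)])
  also have "\<dots> \<le> ?U"
    by (intro SUP_least *)
  finally show ?thesis .
qed

text \<open>\<open>measure_of\<close> returns the zero measure unless its set function is a measure,
  so everything about \<open>pos_part\<close> rests on this. One inequality is finite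
  superadditivity with monotonicity; for the other, a competitor is cut along the sets
  \<open>A k\<close>.\<close>

lemma countably_additive_upper_variation:
  assumes \<mu>: "signed_measure M \<mu>"
  shows "countably_additive (sets M) (upper_variation M \<mu>)"
proof (rule countably_additiveI)
  fix A :: "nat \<Rightarrow> 'a set"
  assume A: "range A \<subseteq> sets M" and dj: "disjoint_family A"
  show "(\<Sum>i. upper_variation M \<mu> (A i)) = upper_variation M \<mu> (\<Union>i. A i)"
  proof (rule antisym)
    have "(\<Sum>i<n. upper_variation M \<mu> (A i)) \<le> upper_variation M \<mu> (\<Union>i<n. A i)" for n
    proof (induction n)
      case (Suc n)
      have "(\<Sum>i<Suc n. upper_variation M \<mu> (A i))
          \<le> upper_variation M \<mu> (\<Union>i<n. A i) + upper_variation M \<mu> (A n)"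
        using Suc by (auto intro: add_right_mono)
      also have "\<dots> \<le> upper_variation M \<mu> ((\<Union>i<n. A i) \<union> A n)"
      proof (rule upper_variation_superadd[OF \<mu>])
        have "A i \<inter> A n = {}" if "i < n" for i
          using dj that by (auto simp: disjoint_family_on_def)
        then show "(\<Union>i<n. A i) \<inter> A n = {}" by blast
      qed
      also have "(\<Union>i<n. A i) \<union> A n = (\<Union>i<Suc n. A i)"
        by (auto simp: lessThan_Suc)
      finally show ?case .
    qed simp
    then have "(\<Sum>i<n. upper_variation M \<mu> (A i)) \<le> upper_variation M \<mu> (\<Union>i. A i)" for n
      by (rule order_trans) (auto intro!: upper_variation_mono)
    then show "(\<Sum>i. upper_variation M \<mu> (A i)) \<le> upper_variation M \<mu> (\<Union>i. A i)"
      by (intro suminf_le_const) auto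
  next
    show "upper_variation M \<mu> (\<Union>i. A i) \<le> (\<Sum>i. upper_variation M \<mu> (A i))"
      unfolding upper_variation_def[of M \<mu> "\<Union>i. A i"]
    proof (rule SUP_least)
      fix B assume B: "B \<in> {B \<in> sets M. B \<subseteq> (\<Union>i. A i)}"
      have "disjoint_family (\<lambda>k. B \<inter> A k)"
        using dj by (rule disjoint_family_on_bisimulation) auto
      then have "(\<lambda>k. \<mu> (B \<inter> A k)) sums \<mu> (\<Union>k. B \<inter> A k)"
        using A B by (intro signed_measure_sums[OF \<mu>]) auto
      moreover have "(\<Union>k. B \<inter> A k) = B" using B by auto
      ultimately have "(\<lambda>n. ennreal (\<Sum>k<n. \<mu> (B \<inter> A k))) \<longlonglongrightarrow> ennreal (\<mu> B)"
        by (auto simp: sums_def)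
      moreover have "ennreal (\<Sum>k<n. \<mu> (B \<inter> A k)) \<le> (\<Sum>i. upper_variation M \<mu> (A i))" for n
      proof -
        \<comment> \<open>The pieces of \<open>B\<close> may have negative measure, and
          \<open>ennreal\<close> is additive only on nonnegative numbers, hence the detour through
          positive parts.\<close>
        have max_ennreal: "ennreal (max 0 x) = ennreal x" for x
          by (simp add: max_def ennreal_neg)
        have "ennreal (\<Sum>k<n. \<mu> (B \<inter> A k)) \<le> ennreal (\<Sum>k<n. max 0 (\<mu> (B \<inter> A k)))"
          by (intro ennreal_leI sum_mono) auto
        also have "\<dots> = (\<Sum>k<n. ennreal (\<mu> (B \<inter> A k)))"
          using max_ennreal by (subst sum_ennreal[symmetric]) simp_all
        also have "\<dots> \<le> (\<Sum>k<n. upper_variation M \<mu> (A k))"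
          using A B by (intro sum_mono upper_variation_upper) auto
        also have "\<dots> \<le> (\<Sum>i. upper_variation M \<mu> (A i))"
          by (rule sum_le_suminf) auto
        finally show ?thesis .
      qed
      ultimately show "ennreal (\<mu> B) \<le> (\<Sum>i. upper_variation M \<mu> (A i))"
        by (intro LIMSEQ_le_const2) auto
    qed
  qed
qed

lemma space_pos_part[simp]: "space (pos_part M \<mu>) = space M"
  and sets_pos_part[simp, measurable_cong]: "sets (pos_part M \<mu>) = sets M"
  and space_neg_part[simp]: "space (neg_part M \<mu>) = space M"
  and sets_neg_part[simp, measurable_cong]: "sets (neg_part M \<mu>) = sets M"
  by (simp_all add: pos_part_def neg_part_def)

lemma emeasure_pos_part:
  assumes \<mu>: "signed_measure M \<mu>" and A: "A \<in> sets M"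
  shows "emeasure (pos_part M \<mu>) A = upper_variation M \<mu> A"
proof -
  have eq: "pos_part M \<mu> = measure_of (space M) (sets M) (upper_variation M \<mu>)"
    by (simp add: pos_part_def upper_variation_def[abs_def])
  show ?thesis
    unfolding eq
  proof (rule emeasure_measure_of_sigma[OF sets.sigma_algebra_axioms _ _ A])
    show "positive (sets M) (upper_variation M \<mu>)"
      by (auto simp: positive_def upper_variation_def signed_measure_empty[OF \<mu>]
            intro!: antisym SUP_least)
  qed (rule countably_additive_upper_variation[OF \<mu>])
qed

lemma upper_variation_split:
  assumes \<mu>: "signed_measure M \<mu>" and "A \<in> sets M" "B \<in> sets M" "B \<subseteq> A"
  shows "upper_variation M \<mu> A = upper_variation M \<mu> B + upper_variation M \<mu> (A - B)"
proof -
  have "emeasure (pos_part M \<mu>) (B \<union> (A - B)) = emeasure (pos_part M \<mu>) B + emeasure (pos_part M \<mu>) (A - B)"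
    using assms by (intro plus_emeasure[symmetric]) auto
  moreover have "B \<union> (A - B) = A" using assms by auto
  ultimately show ?thesis
    using assms by (simp add: emeasure_pos_part)
qed

text \<open>If the upper variation were infinite, one could split off infinitely many disjoint sets with
  \<open>\<bar>\<mu>\<bar> \<ge> 1\<close>, against countable additivity.\<close>

lemma upper_variation_finite:
  assumes \<mu>: "signed_measure M \<mu>"
  shows "upper_variation M \<mu> (space M) < \<infinity>"
proof (rule ccontr)
  assume "\<not> upper_variation M \<mu> (space M) < \<infinity>"
  then have inf: "upper_variation M \<mu> (space M) = \<infinity>" by (simp add: less_top[symmetric])
  have step: "\<exists>B. (B \<in> sets M \<and> upper_variation M \<mu> B = \<infinity>) \<and> (B \<subseteq> A \<and> 1 \<le> \<bar>\<mu> (A - B)\<bar>)"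
    if "A \<in> sets M \<and> upper_variation M \<mu> A = \<infinity>" for A
  proof -
    have A: "A \<in> sets M" "upper_variation M \<mu> A = \<infinity>" using that by auto
    \<comment> \<open>The margin makes both \<open>\<mu> B\<close> and \<open>\<mu> (A - B)\<close>
      at least 1 in modulus. Whichever of the two parts keeps infinite variation is continued with,
      and the other one is split off.\<close>
    have "ennreal (\<bar>\<mu> A\<bar> + 1) < upper_variation M \<mu> A"
      by (simp add: A(2))
    then obtain B where B: "B \<in> sets M" "B \<subseteq> A" "ennreal (\<bar>\<mu> A\<bar> + 1) < ennreal (\<mu> B)"
      unfolding upper_variation_def less_SUP_iff by auto
    then have \<mu>B: "\<bar>\<mu> A\<bar> + 1 \<le> \<mu> B"
      by (metis ennreal_leI linorder_not_less linear)
    have "upper_variation M \<mu> B = \<infinity> \<or> upper_variation M \<mu> (A - B) = \<infinity>"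
      using upper_variation_split[OF \<mu> A(1) B(1,2)] A(2)
      by (metis ennreal_add_eq_top infinity_ennreal_def)
    then show ?thesis
    proof
      assume "upper_variation M \<mu> B = \<infinity>"
      moreover have "1 \<le> \<bar>\<mu> (A - B)\<bar>"
        using signed_measure_Diff[OF \<mu> A(1) B(1,2)] \<mu>B by linarith
      ultimately show ?thesis using B by auto
    next
      assume "upper_variation M \<mu> (A - B) = \<infinity>"
      moreover have "A - (A - B) = B" using B by auto
      moreover have "1 \<le> \<bar>\<mu> B\<bar>" using \<mu>B by linarith
      ultimately show ?thesis using A B by (intro exI[of _ "A - B"]) auto
    qed
  qed
  obtain E where E: "\<And>n::nat. E n \<in> sets M \<and> upper_variation M \<mu> (E n) = \<infinity>"
    "\<And>n. E (Suc n) \<subseteq> E n \<and> 1 \<le> \<bar>\<mu> (E n - E (Suc n))\<bar>"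
    using dependent_nat_choice[of "\<lambda>_ A. A \<in> sets M \<and> upper_variation M \<mu> A = \<infinity>"
        "\<lambda>_ A B. B \<subseteq> A \<and> 1 \<le> \<bar>\<mu> (A - B)\<bar>"] inf step by blast
  have dec: "decseq E" using E(2) by (intro decseq_SucI) auto
  have dj: "disjoint_family (\<lambda>n. E n - E (Suc n))"
    unfolding disjoint_family_on_def
  proof (intro ballI impI)
    have *: "(E m - E (Suc m)) \<inter> (E n - E (Suc n)) = {}" if "m < n" for m n
      using decseqD[OF dec, of "Suc m" n] that by auto
    fix m n :: nat assume "m \<noteq> n"
    then show "(E m - E (Suc m)) \<inter> (E n - E (Suc n)) = {}"
      using *[of m n] *[of n m] by (cases m n rule: linorder_cases) auto
  qed
  have "(\<lambda>n. \<mu> (E n - E (Suc n))) sums \<mu> (\<Union>n. E n - E (Suc n))"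
    using E(1) dj by (intro signed_measure_sums[OF \<mu>]) auto
  then have "(\<lambda>n. \<mu> (E n - E (Suc n))) \<longlonglongrightarrow> 0"
    by (intro summable_LIMSEQ_zero sums_summable)
  then have "eventually (\<lambda>n. \<bar>\<mu> (E n - E (Suc n))\<bar> < 1) sequentially"
    by (auto dest!: tendstoD[where e=1])
  then obtain n where "\<bar>\<mu> (E n - E (Suc n))\<bar> < 1"
    by (auto simp: eventually_sequentially)
  with E(2)[of n] show False by auto
qed

lemma finite_measure_pos_part: "signed_measure M \<mu> \<Longrightarrow> finite_measure (pos_part M \<mu>)"
  using upper_variation_finite[of M \<mu>]
  by (intro finite_measureI) (simp add: emeasure_pos_part)

lemma finite_measure_neg_part: "signed_measure M \<mu> \<Longrightarrow> finite_measure (neg_part M \<mu>)"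
  unfolding neg_part_def by (intro finite_measure_pos_part signed_measure_uminus)

lemma signed_measure_le_pos_part:
  assumes \<mu>: "signed_measure M \<mu>" and "A \<in> sets M"
  shows "\<mu> A \<le> measure (pos_part M \<mu>) A"
proof -
  interpret finite_measure "pos_part M \<mu>" by (rule finite_measure_pos_part[OF \<mu>])
  have "ennreal (\<mu> A) \<le> ennreal (measure (pos_part M \<mu>) A)"
    using assms by (simp add: emeasure_eq_measure[symmetric] emeasure_pos_part upper_variation_upper)
  then show ?thesis by (simp add: ennreal_le_iff)
qed

lemma measure_pos_part_le:
  assumes \<mu>: "signed_measure M \<mu>" and A: "A \<in> sets M"
    and c: "0 \<le> c" "\<And>B. B \<in> sets M \<Longrightarrow> B \<subseteq> A \<Longrightarrow> \<mu> B \<le> c"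
  shows "measure (pos_part M \<mu>) A \<le> c"
proof -
  interpret finite_measure "pos_part M \<mu>" by (rule finite_measure_pos_part[OF \<mu>])
  have "ennreal (measure (pos_part M \<mu>) A) \<le> ennreal c"
    using A c by (auto simp: emeasure_eq_measure[symmetric] emeasure_pos_part[OF \<mu>] upper_variation_def
        intro!: SUP_least ennreal_leI)
  then show ?thesis using c by (simp add: ennreal_le_iff)
qed

text \<open>A competitor \<open>B\<close> in \<open>A\<close> satisfies
  \<open>\<mu> B = \<mu> A - \<mu> (A - B)\<close>, and \<open>- \<mu> (A - B)\<close> is at most
  the negative part. Used for both \<open>\<mu>\<close> and \<open>- \<mu>\<close>, this gives the
  Jordan formula directly from the suprema.\<close>

lemma measure_pos_part_le_neg_part:
  assumes \<mu>: "signed_measure M \<mu>" and A: "A \<in> sets M"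
  shows "measure (pos_part M \<mu>) A \<le> \<mu> A + measure (neg_part M \<mu>) A"
proof (rule measure_pos_part_le[OF \<mu> A])
  have neg: "- \<mu> B \<le> measure (neg_part M \<mu>) B" if "B \<in> sets M" for B
    unfolding neg_part_def by (rule signed_measure_le_pos_part[OF signed_measure_uminus[OF \<mu>] that])
  show "0 \<le> \<mu> A + measure (neg_part M \<mu>) A" using neg[OF A] by simp
  fix B assume B: "B \<in> sets M" "B \<subseteq> A"
  have "measure (neg_part M \<mu>) (A - B) \<le> measure (neg_part M \<mu>) A"
    using A B finite_measure_neg_part[OF \<mu>] by (intro finite_measure.finite_measure_mono) auto
  then show "\<mu> B \<le> \<mu> A + measure (neg_part M \<mu>) A"
    using neg[of "A - B"] signed_measure_Diff[OF \<mu> A B] A B by auto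
qed

lemma signed_measure_Jordan:
  assumes \<mu>: "signed_measure M \<mu>" and A: "A \<in> sets M"
  shows "\<mu> A = measure (pos_part M \<mu>) A - measure (neg_part M \<mu>) A"
  using measure_pos_part_le_neg_part[OF \<mu> A]
    measure_pos_part_le_neg_part[OF signed_measure_uminus[OF \<mu>] A]
  by (simp add: neg_part_def)

section \<open>Sums of measures, the form of the variation and of the reference measure\<close>

definition add_measure :: "'a measure \<Rightarrow> 'a measure \<Rightarrow> 'a measure" where
  "add_measure a b = measure_of (space a) (sets a) (\<lambda>A. emeasure a A + emeasure b A)"

lemma space_add_measure[simp]: "space (add_measure a b) = space a"
  and sets_add_measure[simp, measurable_cong]: "sets (add_measure a b) = sets a"
  by (simp_all add: add_measure_def)

lemma emeasure_add_measure:
  assumes "sets b = sets a"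
  shows "emeasure (add_measure a b) A = emeasure a A + emeasure b A"
proof (cases "A \<in> sets a")
  case True
  show ?thesis
    unfolding add_measure_def
  proof (rule emeasure_measure_of_sigma[OF sets.sigma_algebra_axioms _ _ True])
    show "positive (sets a) (\<lambda>A. emeasure a A + emeasure b A)"
      by (simp add: positive_def)
    show "countably_additive (sets a) (\<lambda>A. emeasure a A + emeasure b A)"
    proof (rule countably_additiveI)
      fix X :: "nat \<Rightarrow> 'a set" assume "range X \<subseteq> sets a" "disjoint_family X"
      then show "(\<Sum>i. emeasure a (X i) + emeasure b (X i)) = emeasure a (\<Union> (range X)) + emeasure b (\<Union> (range X))"
        using assms by (subst suminf_add[symmetric]) (auto simp: suminf_emeasure)
    qed
  qed
next
  case False
  then show ?thesis using assms by (simp add: emeasure_notin_sets)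
qed

lemma finite_measure_add_measure:
  assumes "sets b = sets a" "finite_measure a" "finite_measure b"
  shows "finite_measure (add_measure a b)"
  using assms sets_eq_imp_space_eq[OF assms(1)]
  by (intro finite_measureI)
    (auto simp: emeasure_add_measure finite_measure.emeasure_finite ennreal_add_eq_top)

lemma nn_integral_add_measure:
  assumes s: "sets b = sets a" and "f \<in> borel_measurable a"
  shows "(\<integral>\<^sup>+x. f x \<partial>add_measure a b) = (\<integral>\<^sup>+x. f x \<partial>a) + (\<integral>\<^sup>+x. f x \<partial>b)"
  using assms(2)
proof (induction rule: borel_measurable_induct)
  case (cong f g)
  then show ?case
    using sets_eq_imp_space_eq[OF s] by (simp cong: nn_integral_cong_simp)
next
  case (set A)
  then show ?case using s by (simp add: emeasure_add_measure)
next
  case (mult u c)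
  note [measurable_cong] = s
  note [measurable] = mult(2)
  show ?case using mult by (simp add: nn_integral_cmult distrib_left)
next
  case (add u v)
  note [measurable_cong] = s
  note [measurable] = add(1,3)
  show ?case using add by (simp add: nn_integral_add ac_simps)
next
  case (seq U)
  note [measurable_cong] = s
  note [measurable] = seq(1)
  have inc: "incseq (\<lambda>i. \<integral>\<^sup>+x. U i x \<partial>a)" "incseq (\<lambda>i. \<integral>\<^sup>+x. U i x \<partial>b)"
    using seq(3) by (auto simp: incseq_def le_fun_def intro!: nn_integral_mono)
  have S: "(SUP i. U i) = (\<lambda>x. SUP i. U i x)" by (auto simp: image_image)
  show ?case
    unfolding S using seq inc
    by (simp add: nn_integral_monotone_convergence_SUP ennreal_SUP_add)
qed

lemma integrable_add_measure:
  fixes f :: "'a \<Rightarrow> real"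
  assumes s: "sets b = sets a"
  shows "integrable (add_measure a b) f \<longleftrightarrow> integrable a f \<and> integrable b f"
proof -
  note [measurable_cong] = s
  have "f \<in> borel_measurable b \<longleftrightarrow> f \<in> borel_measurable a"
    "f \<in> borel_measurable (add_measure a b) \<longleftrightarrow> f \<in> borel_measurable a"
    using s by (auto cong: measurable_cong_sets)
  then show ?thesis
    using s by (auto simp: integrable_iff_bounded nn_integral_add_measure less_top ennreal_add_eq_top)
qed

lemma integral_add_measure:
  fixes f :: "'a \<Rightarrow> real"
  assumes s: "sets b = sets a" and f: "integrable a f" "integrable b f"
  shows "(\<integral>x. f x \<partial>add_measure a b) = (\<integral>x. f x \<partial>a) + (\<integral>x. f x \<partial>b)"
proof -
  have m: "f \<in> borel_measurable a" using f by auto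
  have fin: "(\<integral>\<^sup>+x. ennreal (f x) \<partial>a) \<noteq> \<infinity>" "(\<integral>\<^sup>+x. ennreal (- f x) \<partial>a) \<noteq> \<infinity>"
    "(\<integral>\<^sup>+x. ennreal (f x) \<partial>b) \<noteq> \<infinity>" "(\<integral>\<^sup>+x. ennreal (- f x) \<partial>b) \<noteq> \<infinity>"
    using f by (auto simp: real_integrable_def)
  have m': "(\<lambda>x. ennreal (f x)) \<in> borel_measurable a" "(\<lambda>x. ennreal (- f x)) \<in> borel_measurable a"
    using m by auto
  show ?thesis
    using f fin
    by (subst (1 2 3) real_lebesgue_integral_def)
      (auto simp: integrable_add_measure[OF s] nn_integral_add_measure[OF s m'(1)]
        nn_integral_add_measure[OF s m'(2)] enn2real_plus less_top)
qed

lemma variation_eq: "variation M \<mu> = add_measure (pos_part M \<mu>) (neg_part M \<mu>)"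
  by (simp add: variation_def add_measure_def)

lemma space_variation[simp]: "space (variation M \<mu>) = space M"
  and sets_variation[simp, measurable_cong]: "sets (variation M \<mu>) = sets M"
  by (simp_all add: variation_eq)

lemma ref_measure_eq: "ref_measure M \<rho> F = add_measure (variation M \<rho>) (variation M F)"
  by (simp add: ref_measure_def add_measure_def)

lemma space_ref_measure[simp]: "space (ref_measure M \<rho> F) = space M"
  and sets_ref_measure[simp, measurable_cong]: "sets (ref_measure M \<rho> F) = sets M"
  by (simp_all add: ref_measure_eq)

lemma finite_measure_variation: "signed_measure M \<mu> \<Longrightarrow> finite_measure (variation M \<mu>)"
  unfolding variation_eq
  by (intro finite_measure_add_measure finite_measure_pos_part finite_measure_neg_part) auto

lemma finite_measure_ref_measure:
  "signed_measure M \<rho> \<Longrightarrow> signed_measure M F \<Longrightarrow> finite_measure (ref_measure M \<rho> F)"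
  unfolding ref_measure_eq
  by (intro finite_measure_add_measure finite_measure_variation) auto

lemma total_mass_eq:
  assumes "signed_measure M \<mu>"
  shows "total_mass M \<mu> = measure (pos_part M \<mu>) (space M) + measure (neg_part M \<mu>) (space M)"
  using finite_measure.emeasure_finite[OF finite_measure_pos_part[OF assms]]
    finite_measure.emeasure_finite[OF finite_measure_neg_part[OF assms]]
  by (simp add: total_mass_def variation_eq measure_def emeasure_add_measure enn2real_plus
     less_top[symmetric])

section \<open>Integration against signed measures\<close>

lemma integrable_finite_bounded:
  fixes h :: "'a \<Rightarrow> real"
  assumes "finite_measure a" "sets a = sets M" "h \<in> borel_measurable M" "\<And>x. x \<in> space M \<Longrightarrow> \<bar>h x\<bar> \<le> c"
  shows "integrable a h"
proof -
  have "space a = space M" using assms by (auto dest: sets_eq_imp_space_eq)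
  then show ?thesis
    using assms by (intro finite_measure.integrable_const_bound[where B=c])
       (auto cong: measurable_cong_sets)
qed

text \<open>Without mutual singularity one still has \<open>\<mu>\<^sup>+ + b = \<mu>\<^sup>- + a\<close>, and both sides can be integrated.\<close>

lemma signed_integral_decomp:
  assumes \<mu>: "signed_measure M \<mu>" and a: "finite_measure a" "sets a = sets M"
    and b: "finite_measure b" "sets b = sets M"
    and eq: "\<And>A. A \<in> sets M \<Longrightarrow> \<mu> A = measure a A - measure b A"
    and h: "h \<in> borel_measurable M" "\<And>x. x \<in> space M \<Longrightarrow> \<bar>h x\<bar> \<le> c"
  shows "signed_integral M \<mu> h = integral\<^sup>L a h - integral\<^sup>L b h"
proof -
  let ?p = "pos_part M \<mu>" and ?n = "neg_part M \<mu>"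
  note fin = finite_measure_pos_part[OF \<mu>] finite_measure_neg_part[OF \<mu>]
  have int: "integrable ?p h" "integrable ?n h" "integrable a h" "integrable b h"
    using fin a b h by (auto intro!: integrable_finite_bounded[where M=M and c=c])
  have eqm: "add_measure ?p b = add_measure ?n a"
  proof (rule measure_eqI)
    fix A assume "A \<in> sets (add_measure ?p b)"
    then have A: "A \<in> sets M" by simp
    have "measure ?p A + measure b A = measure ?n A + measure a A"
      using signed_measure_Jordan[OF \<mu> A] eq[OF A] by simp
    then have "ennreal (measure ?p A + measure b A) = ennreal (measure ?n A + measure a A)" by simp
    then show "emeasure (add_measure ?p b) A = emeasure (add_measure ?n a) A"
      using a b fin by (simp add: emeasure_add_measure finite_measure.emeasure_eq_measure)
  qed simp
  have "(\<integral>x. h x \<partial>?p) + (\<integral>x. h x \<partial>b) = (\<integral>x. h x \<partial>?n) + (\<integral>x. h x \<partial>a)"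
    using arg_cong[OF eqm, of "\<lambda>m. \<integral>x. h x \<partial>m"] a b int by (simp add: integral_add_measure)
  then show ?thesis by (simp add: signed_integral_def)
qed

lemma abs_signed_integral_le:
  assumes \<mu>: "signed_measure M \<mu>"
    and h: "h \<in> borel_measurable M" "\<And>x. x \<in> space M \<Longrightarrow> \<bar>h x\<bar> \<le> c"
  shows "\<bar>signed_integral M \<mu> h\<bar> \<le> c * total_mass M \<mu>"
proof -
  have *: "\<bar>\<integral>x. h x \<partial>a\<bar> \<le> c * measure a (space M)"
    if a: "finite_measure a" "sets a = sets M" for a
  proof -
    have sp: "space a = space M" using a by (auto dest: sets_eq_imp_space_eq)
    have "\<bar>\<integral>x. h x \<partial>a\<bar> \<le> (\<integral>x. \<bar>h x\<bar> \<partial>a)" by (rule integral_abs_bound)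
    also have "\<dots> \<le> (\<integral>x. c \<partial>a)"
      using a h sp by (intro integral_mono integrable_abs integrable_finite_bounded[OF a h]
        finite_measure.integrable_const) auto
    finally show ?thesis by (simp add: sp ac_simps)
  qed
  show ?thesis
    using *[OF finite_measure_pos_part[OF \<mu>]] *[OF finite_measure_neg_part[OF \<mu>]]
    unfolding signed_integral_def total_mass_eq[OF \<mu>] by (simp add: distrib_left)
qed

lemma signed_integral_1:
  assumes \<mu>: "signed_measure M \<mu>"
  shows "signed_integral M \<mu> (\<lambda>_. 1) = \<mu> (space M)"
  using signed_measure_Jordan[OF \<mu> sets.top] by (simp add: signed_integral_def)

lemma signed_integral_zero_measure: "signed_integral M (\<lambda>_. 0) h = 0"
  by (simp add: signed_integral_def neg_part_def)

lemma signed_measure_zero: "signed_measure M (\<lambda>_. 0)"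
  by (simp add: signed_measure_def)

section \<open>Signed measures given by densities\<close>

lemma set_integrable_sets: "integrable \<theta> g \<Longrightarrow> A \<in> sets \<theta> \<Longrightarrow> set_integrable \<theta> A g"
  for g :: "'a \<Rightarrow> real"
  unfolding set_integrable_def by (rule integrable_mult_indicator)

lemma finite_measure_density_real:
  assumes "integrable \<theta> g"
  shows "finite_measure (density \<theta> (\<lambda>x. ennreal (g x)))"
proof (rule finite_measureI)
  have "(\<integral>\<^sup>+x. ennreal (g x) \<partial>\<theta>) < \<infinity>"
    using assms by (auto simp: real_integrable_def less_top)
  then show "emeasure (density \<theta> (\<lambda>x. ennreal (g x))) (space (density \<theta> (\<lambda>x. ennreal (g x)))) \<noteq> \<infinity>"
    using assms by (auto simp: emeasure_density nn_integral_set_ennreal[symmetric] cong: nn_integral_cong)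
qed

lemma measure_density_real:
  assumes "integrable \<theta> g" "A \<in> sets \<theta>" "\<And>x. 0 \<le> g x"
  shows "measure (density \<theta> (\<lambda>x. ennreal (g x))) A = (LINT x:A|\<theta>. g x)"
  using assms
  by (simp add: measure_def emeasure_density set_lebesgue_integral_def integral_eq_nn_integral
    nn_integral_set_ennreal mult.commute)

lemma signed_integral_density:
  assumes \<mu>: "signed_measure M \<mu>" and \<theta>: "sets \<theta> = sets M" and d: "has_signed_density \<theta> \<mu> g"
    and h: "h \<in> borel_measurable M" "\<And>x. x \<in> space M \<Longrightarrow> \<bar>h x\<bar> \<le> c"
  shows "integrable \<theta> (\<lambda>x. h x * g x)" "signed_integral M \<mu> h = (\<integral>x. h x * g x \<partial>\<theta>)"
proof -
  have g: "integrable \<theta> g" "\<And>B. B \<in> sets M \<Longrightarrow> \<mu> B = (LINT x:B|\<theta>. g x)"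
    using d \<theta> by (auto simp: has_signed_density_def)
  have sp: "space \<theta> = space M" using \<theta> by (auto dest: sets_eq_imp_space_eq)
  have hm: "h \<in> borel_measurable \<theta>" using h \<theta> by (auto cong: measurable_cong_sets)
  have hint: "integrable \<theta> (\<lambda>x. h x * g' x)" if "integrable \<theta> g'" for g'
  proof (rule Bochner_Integration.integrable_bound[where f="\<lambda>x. c * g' x"])
    show "AE x in \<theta>. norm (h x * g' x) \<le> norm (c * g' x)"
    proof (rule AE_I2)
      fix x assume "x \<in> space \<theta>"
      with h(2)[of x] sp have "\<bar>h x\<bar> \<le> \<bar>c\<bar>" by auto
      then show "norm (h x * g' x) \<le> norm (c * g' x)"
        by (simp add: abs_mult mult_right_mono)
    qed
  qed (use that hm in auto)
  show "integrable \<theta> (\<lambda>x. h x * g x)" by (rule hint[OF g(1)])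
  \<comment> \<open>\<open>gp\<close> and \<open>gn\<close> are only used as nonnegative densities
    with difference \<open>g\<close>; \<open>signed_integral_decomp\<close> does not ask whether
    they belong to the Jordan parts of \<open>\<mu>\<close>.\<close>
  define gp gn where "gp = (\<lambda>x. max 0 (g x))" and "gn = (\<lambda>x. max 0 (- g x))"
  have gpn: "integrable \<theta> gp" "integrable \<theta> gn" "\<And>x. gp x \<ge> 0" "\<And>x. gn x \<ge> 0"
    "\<And>x. g x = gp x - gn x"
    using g(1) by (auto simp: gp_def gn_def)
  let ?a = "density \<theta> (\<lambda>x. ennreal (gp x))" and ?b = "density \<theta> (\<lambda>x. ennreal (gn x))"
  have "signed_integral M \<mu> h = integral\<^sup>L ?a h - integral\<^sup>L ?b h"
  proof (rule signed_integral_decomp[OF \<mu> _ _ _ _ _ h])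
    fix A assume A: "A \<in> sets M"
    have "set_integrable \<theta> A gp" "set_integrable \<theta> A gn"
      using gpn A \<theta> by (auto intro!: set_integrable_sets)
    then show "\<mu> A = measure ?a A - measure ?b A"
      using gpn A \<theta> g(2)[OF A] by (simp add: measure_density_real set_integral_diff)
  qed (use gpn \<theta> in \<open>auto intro: finite_measure_density_real\<close>)
  also have "\<dots> = (\<integral>x. gp x * h x \<partial>\<theta>) - (\<integral>x. gn x * h x \<partial>\<theta>)"
    using gpn hm by (simp add: integral_density)
  also have "\<dots> = (\<integral>x. h x * gp x - h x * gn x \<partial>\<theta>)"
    using hint[OF gpn(1)] hint[OF gpn(2)] by (simp add: mult.commute)
  also have "\<dots> = (\<integral>x. h x * g x \<partial>\<theta>)"
    by (simp add: gpn(5) right_diff_distrib)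
  finally show "signed_integral M \<mu> h = (\<integral>x. h x * g x \<partial>\<theta>)" .
qed

text \<open>Each value \<open>\<mu> B\<close> is the integral of \<open>g\<close> over
  \<open>B\<close>, hence at most the integral of the positive part of \<open>g\<close>; likewise
  for \<open>- \<mu>\<close>. Action bounds on densities thus become mass bounds.\<close>

lemma total_mass_le_density:
  assumes \<mu>: "signed_measure M \<mu>" and \<theta>: "sets \<theta> = sets M" and d: "has_signed_density \<theta> \<mu> g"
  shows "total_mass M \<mu> \<le> (\<integral>x. \<bar>g x\<bar> \<partial>\<theta>)"
proof -
  have g: "integrable \<theta> g" "\<And>B. B \<in> sets M \<Longrightarrow> \<mu> B = (LINT x:B|\<theta>. g x)"
    using d \<theta> by (auto simp: has_signed_density_def)
  define gp gn where "gp = (\<lambda>x. max 0 (g x))" and "gn = (\<lambda>x. max 0 (- g x))"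
  have gpn: "integrable \<theta> gp" "integrable \<theta> gn"
    using g(1) by (auto simp: gp_def gn_def)
  have le: "(LINT x:B|\<theta>. g' x) \<le> (\<integral>x. max 0 (g' x) \<partial>\<theta>)"
    if "integrable \<theta> g'" "B \<in> sets M" for B and g' :: "'a \<Rightarrow> real"
    unfolding set_lebesgue_integral_def
    using that \<theta> set_integrable_sets[of \<theta> g' B]
    by (intro integral_mono) (auto simp: indicator_def set_integrable_def)
  have "measure (pos_part M \<mu>) (space M) \<le> (\<integral>x. gp x \<partial>\<theta>)"
    using le[OF g(1)] g(2)
    by (intro measure_pos_part_le[OF \<mu>]) (auto simp: gp_def intro!: integral_nonneg_AE)
  moreover have "measure (neg_part M \<mu>) (space M) \<le> (\<integral>x. gn x \<partial>\<theta>)"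
    unfolding neg_part_def
  proof (rule measure_pos_part_le[OF signed_measure_uminus[OF \<mu>]])
    fix B assume B: "B \<in> sets M"
    have "- \<mu> B = (LINT x:B|\<theta>. - g x)" using g(2)[OF B] by (simp add: set_lebesgue_integral_def)
    also have "\<dots> \<le> (\<integral>x. gn x \<partial>\<theta>)" unfolding gn_def using le[of "\<lambda>x. - g x" B] g(1) B by simp
    finally show "- \<mu> B \<le> (\<integral>x. gn x \<partial>\<theta>)" .
  qed (auto simp: gn_def intro!: integral_nonneg_AE)
  moreover have "(\<integral>x. gp x \<partial>\<theta>) + (\<integral>x. gn x \<partial>\<theta>) = (\<integral>x. \<bar>g x\<bar> \<partial>\<theta>)"
    unfolding Bochner_Integration.integral_add[OF gpn, symmetric]
    by (intro Bochner_Integration.integral_cong) (auto simp: gp_def gn_def)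
  ultimately show ?thesis by (simp add: total_mass_eq[OF \<mu>])
qed

text \<open>Radon-Nikodym applies to each Jordan part, as both are dominated by the variation. The
  parts are finite, so their extended-valued densities are finite almost everywhere and can be
  replaced by real functions.\<close>

lemma ex_signed_density:
  assumes \<mu>: "signed_measure M \<mu>" and \<theta>: "finite_measure \<theta>" "sets \<theta> = sets M"
    and ac: "absolutely_continuous \<theta> (variation M \<mu>)"
  shows "\<exists>g. has_signed_density \<theta> \<mu> g"
proof -
  have *: "\<exists>g. integrable \<theta> g \<and> (\<forall>A\<in>sets M. measure a A = (LINT x:A|\<theta>. g x))"
    if a: "finite_measure a" "sets a = sets M"
      and le: "\<And>A. emeasure a A \<le> emeasure (variation M \<mu>) A" for a
  proof -
    have "absolutely_continuous \<theta> a"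
      using ac le a \<theta> unfolding absolutely_continuous_def null_sets_def
      by (auto simp: subset_eq) (metis le_zero_eq)
    then obtain f where f: "f \<in> borel_measurable \<theta>" "density \<theta> f = a"
      using sigma_finite_measure.Radon_Nikodym[of \<theta> a] \<theta> a finite_measure.axioms(1) by auto
    have "(\<integral>\<^sup>+x. f x \<partial>\<theta>) = emeasure a (space \<theta>)"
      using f by (auto simp: f(2)[symmetric] emeasure_density intro!: nn_integral_cong)
    then have fin: "(\<integral>\<^sup>+x. f x \<partial>\<theta>) \<noteq> \<infinity>"
      using a by (simp add: finite_measure.emeasure_finite)
    have ae: "AE x in \<theta>. f x \<noteq> \<infinity>"
      using fin f(1) by (intro nn_integral_PInf_AE) auto
    define g where "g x = enn2real (f x)" for x
    have gf: "AE x in \<theta>. ennreal (g x) = f x"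
      using ae by eventually_elim (simp add: g_def ennreal_enn2real less_top)
    have gm: "g \<in> borel_measurable \<theta>" using f(1) unfolding g_def[abs_def] by measurable
    have "(\<integral>\<^sup>+x. ennreal (g x) \<partial>\<theta>) = (\<integral>\<^sup>+x. f x \<partial>\<theta>)"
      using gf by (rule nn_integral_cong_AE)
    then have gi: "integrable \<theta> g"
      using fin gm by (intro integrableI_nonneg) (auto simp: g_def less_top)
    have "density \<theta> (\<lambda>x. ennreal (g x)) = a"
      unfolding f(2)[symmetric] using gf gm f(1) by (intro density_cong) auto
    then show ?thesis
      using measure_density_real[OF gi] \<theta> by (intro exI[of _ g]) (auto simp: gi g_def)
  qed
  have le: "emeasure (pos_part M \<mu>) A \<le> emeasure (variation M \<mu>) A"
    "emeasure (neg_part M \<mu>) A \<le> emeasure (variation M \<mu>) A" for A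
    by (auto simp: variation_eq emeasure_add_measure)
  obtain gp where gp: "integrable \<theta> gp" "\<And>A. A\<in>sets M \<Longrightarrow> measure (pos_part M \<mu>) A = (LINT x:A|\<theta>. gp x)"
    using *[OF finite_measure_pos_part[OF \<mu>] _ le(1)] by auto
  obtain gn where gn: "integrable \<theta> gn" "\<And>A. A\<in>sets M \<Longrightarrow> measure (neg_part M \<mu>) A = (LINT x:A|\<theta>. gn x)"
    using *[OF finite_measure_neg_part[OF \<mu>] _ le(2)] by auto
  have "has_signed_density \<theta> \<mu> (\<lambda>x. gp x - gn x)"
    unfolding has_signed_density_def
  proof safe
    fix B assume B: "B \<in> sets \<theta>"
    then have "set_integrable \<theta> B gp" "set_integrable \<theta> B gn"
      using gp gn by (auto intro!: set_integrable_sets)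
    then show "\<mu> B = (LINT x:B|\<theta>. gp x - gn x)"
      using B \<theta> signed_measure_Jordan[OF \<mu>, of B] gp gn by (simp add: set_integral_diff)
  qed (use gp gn in auto)
  then show ?thesis by blast
qed

lemma signed_deriv_density: "\<exists>g. has_signed_density \<theta> \<mu> g \<Longrightarrow> has_signed_density \<theta> \<mu> (signed_deriv \<theta> \<mu>)"
  unfolding signed_deriv_def by (erule someI_ex[where P="has_signed_density \<theta> \<mu>"])

lemma has_density_ref_measure:
  assumes \<rho>: "signed_measure M \<rho>" and F: "signed_measure M F"
  shows "has_signed_density (ref_measure M \<rho> F) \<rho> (signed_deriv (ref_measure M \<rho> F) \<rho>)"
    and "has_signed_density (ref_measure M \<rho> F) F (signed_deriv (ref_measure M \<rho> F) F)"
proof -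
  note fin = finite_measure_ref_measure[OF \<rho> F]
  have "absolutely_continuous (ref_measure M \<rho> F) (variation M \<rho>)"
    "absolutely_continuous (ref_measure M \<rho> F) (variation M F)"
    by (auto simp: absolutely_continuous_def null_sets_def ref_measure_eq emeasure_add_measure)
  then show "has_signed_density (ref_measure M \<rho> F) \<rho> (signed_deriv (ref_measure M \<rho> F) \<rho>)"
    "has_signed_density (ref_measure M \<rho> F) F (signed_deriv (ref_measure M \<rho> F) F)"
    using ex_signed_density[OF \<rho> fin] ex_signed_density[OF F fin]
    by (simp_all add: signed_deriv_density)
qed


section \<open>Lower semicontinuity of the action\<close>

lemma integrable_approx_continuous:
  fixes \<theta> :: "'a::euclidean_space measure" and g :: "'a \<Rightarrow> real"
  assumes "finite_measure \<theta>" and \<theta>: "sets \<theta> = sets borel" and "integrable \<theta> g" and "e > 0"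
  shows "\<exists>h. continuous_on UNIV h \<and> integrable \<theta> h \<and> (\<integral>x. \<bar>g x - h x\<bar> \<partial>\<theta>) < e"
  using assms(3,4)
proof (induction arbitrary: e rule: integrable_induct)
  case (base A c)
  interpret finite_measure \<theta> by fact
  have sp: "space \<theta> = UNIV" using \<theta> by (auto dest: sets_eq_imp_space_eq)
  \<comment> \<open>Chosen so that \<open>(\<bar>c\<bar> + 1) * (2 * d) = e\<close>; the summand 1
    covers \<open>c = 0\<close>. A compact \<open>K\<close> and an open \<open>U\<close> around
    \<open>A\<close> each lose at most \<open>d\<close>, and a Urysohn function between them
    replaces the indicator.\<close>
  define d where "d = e / (2 * (\<bar>c\<bar> + 1))"
  have d: "d > 0" using base by (simp add: d_def)
  have A: "A \<in> sets borel" using base \<theta> by simp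
  have fin: "emeasure \<theta> (space \<theta>) \<noteq> \<infinity>" by simp
  have em: "emeasure \<theta> X + ennreal d = ennreal (measure \<theta> X + d)" for X
    using d by (simp add: emeasure_eq_measure)
  have "emeasure \<theta> A < (emeasure \<theta> A + ennreal d)"
    unfolding em using d by (simp add: emeasure_eq_measure ennreal_less_iff)
  then obtain U where U: "A \<subseteq> U" "open U" "emeasure \<theta> U < emeasure \<theta> A + ennreal d"
    using outer_regular[OF \<theta> fin A] by (auto simp: INF_less_iff)
  have "\<exists>K. K \<subseteq> A \<and> compact K \<and> emeasure \<theta> A < emeasure \<theta> K + ennreal d"
  proof (rule ccontr)
    assume "\<not> ?thesis"
    then have "emeasure \<theta> K + ennreal d \<le> emeasure \<theta> A" if "K \<subseteq> A" "compact K" for K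
      using that by (auto simp: not_less)
    then have le0: "measure \<theta> K + d \<le> measure \<theta> A" if "K \<subseteq> A" "compact K" for K
      using that d unfolding em unfolding emeasure_eq_measure by (simp add: ennreal_le_iff del: ennreal_plus)
    have le: "measure \<theta> K \<le> measure \<theta> A - d" if "K \<subseteq> A" "compact K" for K
      using le0[OF that] by linarith
    have "emeasure \<theta> K \<le> ennreal (measure \<theta> A - d)" if "K \<subseteq> A" "compact K" for K
      using le[OF that] unfolding emeasure_eq_measure by (rule ennreal_leI)
    then have "emeasure \<theta> A \<le> ennreal (measure \<theta> A - d)"
      unfolding inner_regular[OF \<theta> fin A] by (auto intro!: SUP_least)
    moreover have "d \<le> measure \<theta> A" using le[of "{}"] by simp
    ultimately show False
      using d by (simp add: emeasure_eq_measure ennreal_le_iff)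
  qed
  then obtain K where K: "K \<subseteq> A" "compact K" "emeasure \<theta> A < emeasure \<theta> K + ennreal d" by auto
  have [measurable]: "U \<in> sets \<theta>" "K \<in> sets \<theta>" "A \<in> sets \<theta>"
    using U K A \<theta> by (auto simp: compact_imp_closed)
  have UK: "measure \<theta> (U - K) < 2 * d"
  proof -
    have "measure \<theta> U < measure \<theta> A + d" "measure \<theta> A < measure \<theta> K + d"
      using U(3) K(3) unfolding em unfolding emeasure_eq_measure by (auto simp: ennreal_less_iff)
    moreover have "measure \<theta> (U - K) = measure \<theta> U - measure \<theta> K"
      using U K by (intro finite_measure_Diff) auto
    ultimately show ?thesis by simp
  qed
  obtain f :: "'a \<Rightarrow> real" where f: "continuous_on UNIV f" "\<And>x. f x \<in> closed_segment 1 0"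
    "\<And>x. x \<in> K \<Longrightarrow> f x = 1" "\<And>x. x \<in> - U \<Longrightarrow> f x = 0"
    using Urysohn[of K "- U" 1 "0::real"] U K by (auto simp: compact_imp_closed closed_Compl)
  have f01: "0 \<le> f x" "f x \<le> 1" for x
    using f(2)[of x] by (auto simp: closed_segment_eq_real_ivl)
  have [measurable]: "f \<in> borel_measurable \<theta>"
    using f(1) \<theta> by (auto cong: measurable_cong_sets intro: borel_measurable_continuous_onI)
  have fi: "integrable \<theta> f"
    using f01 by (intro integrable_const_bound[where B=1]) auto
  have "(\<integral>x. \<bar>indicator A x *\<^sub>R c - c * f x\<bar> \<partial>\<theta>) \<le> (\<integral>x. \<bar>c\<bar> * indicator (U - K) x \<partial>\<theta>)"
  proof (rule integral_mono)
    show "integrable \<theta> (\<lambda>x. \<bar>indicator A x *\<^sub>R c - c * f x\<bar>)"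
      using fi by (intro integrable_abs Bochner_Integration.integrable_diff) (auto simp: emeasure_eq_measure)
    show "integrable \<theta> (\<lambda>x. \<bar>c\<bar> * indicator (U - K) x)" by (auto simp: emeasure_eq_measure)
    fix x
    have "\<bar>indicator A x - f x\<bar> \<le> (indicator (U - K) x :: real)"
      using f(3)[of x] f(4)[of x] f01[of x] U(1) K(1) by (auto simp: indicator_def)
    then have "\<bar>c\<bar> * \<bar>indicator A x - f x\<bar> \<le> \<bar>c\<bar> * (indicator (U - K) x :: real)"
      by (rule mult_left_mono) simp
    then show "\<bar>indicator A x *\<^sub>R c - c * f x\<bar> \<le> \<bar>c\<bar> * indicator (U - K) x"
      by (simp add: abs_mult[symmetric] algebra_simps)
  qed
  also have "\<dots> = \<bar>c\<bar> * measure \<theta> (U - K)" by simp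
  also have "\<dots> \<le> (\<bar>c\<bar> + 1) * measure \<theta> (U - K)" by (intro mult_right_mono) auto
  also have "\<dots> < (\<bar>c\<bar> + 1) * (2 * d)" using UK by (intro mult_strict_left_mono) auto
  also have "\<dots> = e"
  proof -
    have "\<bar>c\<bar> + 1 \<noteq> 0" by linarith
    then show ?thesis by (simp add: d_def divide_simps)
  qed
  finally have "(\<integral>x. \<bar>indicator A x *\<^sub>R c - c * f x\<bar> \<partial>\<theta>) < e" .
  moreover have "continuous_on UNIV (\<lambda>x. c * f x)" "integrable \<theta> (\<lambda>x. c * f x)"
    using f(1) fi by (auto intro: continuous_intros)
  ultimately show ?case by blast
next
  case (add f g)
  obtain h where h: "continuous_on UNIV h" "integrable \<theta> h" "(\<integral>x. \<bar>f x - h x\<bar> \<partial>\<theta>) < e/2"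
    using add.IH(1)[of "e/2"] add.prems by auto
  obtain k where k: "continuous_on UNIV k" "integrable \<theta> k" "(\<integral>x. \<bar>g x - k x\<bar> \<partial>\<theta>) < e/2"
    using add.IH(2)[of "e/2"] add.prems by auto
  have "(\<integral>x. \<bar>f x + g x - (h x + k x)\<bar> \<partial>\<theta>) \<le> (\<integral>x. \<bar>f x - h x\<bar> + \<bar>g x - k x\<bar> \<partial>\<theta>)"
    using add h k by (intro integral_mono) auto
  also have "\<dots> = (\<integral>x. \<bar>f x - h x\<bar> \<partial>\<theta>) + (\<integral>x. \<bar>g x - k x\<bar> \<partial>\<theta>)"
    using add h k by (intro Bochner_Integration.integral_add) auto
  also have "\<dots> < e" using h k by simp
  finally show ?case using h k
    by (intro exI[of _ "\<lambda>x. h x + k x"]) (auto intro: continuous_intros)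
next
  case (lim f s)
  have bound: "norm (s i x) \<le> 2 * norm (f x)" if "x \<in> space \<theta>" for i x
    by (rule lim.hyps) (use that in simp)
  have "(\<lambda>i. \<integral>x. \<bar>f x - s i x\<bar> \<partial>\<theta>) \<longlonglongrightarrow> (\<integral>x. 0 \<partial>\<theta>)"
  proof (rule integral_dominated_convergence[where w="\<lambda>x. 3 * \<bar>f x\<bar>"])
    show "AE x in \<theta>. (\<lambda>i. \<bar>f x - s i x\<bar>) \<longlonglongrightarrow> 0"
    proof (rule AE_I2)
      fix x assume "x \<in> space \<theta>"
      then have "(\<lambda>i. \<bar>f x - s i x\<bar>) \<longlonglongrightarrow> \<bar>f x - f x\<bar>"
        using lim by (intro tendsto_intros)
      then show "(\<lambda>i. \<bar>f x - s i x\<bar>) \<longlonglongrightarrow> 0" by simp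
    qed
    \<comment> \<open>The factor 3 comes from
      \<open>norm (s i x) \<le> 2 * norm (f x)\<close>.\<close>
    show "AE x in \<theta>. norm \<bar>f x - s i x\<bar> \<le> 3 * \<bar>f x\<bar>" for i
      using bound[of _ i] by (intro AE_I2) (fastforce simp: abs_if split: if_splits)
  qed (use lim in auto)
  then have "eventually (\<lambda>i. (\<integral>x. \<bar>f x - s i x\<bar> \<partial>\<theta>) < e/2) sequentially"
    using lim.prems by (intro order_tendstoD(2)) auto
  then obtain i where i: "(\<integral>x. \<bar>f x - s i x\<bar> \<partial>\<theta>) < e/2"
    by (auto simp: eventually_sequentially)
  have "\<exists>h. continuous_on UNIV h \<and> integrable \<theta> h \<and> (\<integral>x. \<bar>s i x - h x\<bar> \<partial>\<theta>) < e/2"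
    by (rule lim.IH) (use lim.prems in simp)
  then obtain h where h: "continuous_on UNIV h" "integrable \<theta> h" "(\<integral>x. \<bar>s i x - h x\<bar> \<partial>\<theta>) < e/2"
    by blast
  have "(\<integral>x. \<bar>f x - h x\<bar> \<partial>\<theta>) \<le> (\<integral>x. \<bar>f x - s i x\<bar> + \<bar>s i x - h x\<bar> \<partial>\<theta>)"
    using lim h by (intro integral_mono) auto
  also have "\<dots> = (\<integral>x. \<bar>f x - s i x\<bar> \<partial>\<theta>) + (\<integral>x. \<bar>s i x - h x\<bar> \<partial>\<theta>)"
    using lim h by (intro Bochner_Integration.integral_add) auto
  also have "\<dots> < e" using h i by simp
  finally show ?case using h by auto
qed

text \<open>Pushing the measure forward to the whole space, with \<open>g\<close> extended by zero,
  makes the approximation in mean available; a subsequence converges almost everywhere. Clipping at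
  \<open>c\<close> preserves the limit and supplies the uniform bound for dominated
  convergence.\<close>

lemma bounded_approx_continuous_AE:
  fixes S :: "'a::euclidean_space set" and g :: "'a \<Rightarrow> real"
  assumes S: "S \<in> sets borel" and \<theta>: "finite_measure \<theta>" "sets \<theta> = sets (restrict_space borel S)"
    and g: "g \<in> borel_measurable (restrict_space borel S)" "\<And>x. x \<in> S \<Longrightarrow> \<bar>g x\<bar> \<le> c" and c: "0 \<le> c"
  shows "\<exists>h. (\<forall>n::nat. continuous_on UNIV (h n) \<and> (\<forall>x. \<bar>h n x\<bar> \<le> c)) \<and> (AE x in \<theta>. (\<lambda>n. h n x) \<longlonglongrightarrow> g x)"
proof -
  have sp: "space \<theta> = S" using sets_eq_imp_space_eq[OF \<theta>(2)] by (simp add: space_restrict_space)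
  have idm: "(\<lambda>x. x) \<in> measurable \<theta> borel"
    unfolding measurable_cong_sets[OF \<theta>(2) refl] by (rule measurable_restrict_space1) simp
  define \<theta>' where "\<theta>' = distr \<theta> borel (\<lambda>x. x)"
  have fin': "finite_measure \<theta>'" "sets \<theta>' = sets borel"
    using finite_measure.finite_measure_distr[OF \<theta>(1) idm] by (auto simp: \<theta>'_def)
  define g' where "g' x = indicator S x *\<^sub>R g x" for x
  have [measurable]: "g' \<in> borel_measurable borel"
    using g(1) S borel_measurable_restrict_space_iff[of S borel g] by (simp add: g'_def[abs_def])
  have g'c: "\<bar>g' x\<bar> \<le> c" for x
    using g(2)[of x] c by (auto simp: g'_def indicator_def)
  have g'i: "integrable \<theta>' g'"
    using fin' g'c by (intro finite_measure.integrable_const_bound[where B=c])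
      (auto cong: measurable_cong_sets)
  have "\<exists>h. continuous_on UNIV h \<and> integrable \<theta>' h \<and> (\<integral>x. \<bar>g' x - h x\<bar> \<partial>\<theta>') < 1 / Suc n" for n
    by (rule integrable_approx_continuous[OF fin' g'i]) simp
  then obtain h where h: "\<And>n. continuous_on UNIV (h n)" "\<And>n. integrable \<theta>' (h n)"
    "\<And>n. (\<integral>x. \<bar>g' x - h n x\<bar> \<partial>\<theta>') < 1 / Suc n" by metis
  have "(\<lambda>n. \<integral>x. norm (g' x - h n x) \<partial>\<theta>') \<longlonglongrightarrow> 0"
  proof (rule tendsto_sandwich[OF _ _ tendsto_const LIMSEQ_inverse_real_of_nat])
    show "\<forall>\<^sub>F n in sequentially. 0 \<le> (\<integral>x. norm (g' x - h n x) \<partial>\<theta>')" by simp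
    show "\<forall>\<^sub>F n in sequentially. (\<integral>x. norm (g' x - h n x) \<partial>\<theta>') \<le> inverse (real (Suc n))"
      using h(3) by (intro always_eventually allI) (auto simp: inverse_eq_divide intro: less_imp_le)
  qed
  then obtain k where k: "strict_mono k" "AE x in \<theta>'. (\<lambda>n. g' x - h (k n) x) \<longlonglongrightarrow> 0"
    using tendsto_L1_AE_subseq[of \<theta>' "\<lambda>n x. g' x - h n x"] g'i h(2) by auto
  have "AE x in \<theta>'. (\<lambda>n. h (k n) x) \<longlonglongrightarrow> g' x"
    using k(2)
  proof eventually_elim
    case (elim x)
    then have "(\<lambda>n. g' x - (g' x - h (k n) x)) \<longlonglongrightarrow> g' x - 0"
      by (intro tendsto_intros)
    then show ?case by simp
  qed
  then have "AE x in \<theta>. (\<lambda>n. h (k n) x) \<longlonglongrightarrow> g' x"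
    unfolding \<theta>'_def by (rule AE_distrD[OF idm])
  then have ae: "AE x in \<theta>. (\<lambda>n. max (- c) (min c (h (k n) x))) \<longlonglongrightarrow> g x"
    using AE_space
  proof eventually_elim
    case (elim x)
    have "(\<lambda>n. max (- c) (min c (h (k n) x))) \<longlonglongrightarrow> max (- c) (min c (g' x))"
      using elim by (intro tendsto_intros)
    also have "max (- c) (min c (g' x)) = g x"
      using elim sp g(2)[of x] by (auto simp: g'_def)
    finally show ?case .
  qed
  show ?thesis
    using ae h(1) c
    by (intro exI[of _ "\<lambda>n x. max (- c) (min c (h (k n) x))"]) (auto intro!: continuous_intros)
qed

section \<open>Convex duality for the action\<close>

lemma borel_measurable_A_fun[measurable]:
  assumes [measurable]: "r \<in> borel_measurable M" "s \<in> borel_measurable M"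
  shows "(\<lambda>z. A_fun (r z) (s z)) \<in> borel_measurable M"
  unfolding A_fun_def by measurable

text \<open>The easy half of Benamou-Brenier duality: \<open>A_fun\<close> is the support function
  of the region below the parabola \<open>a = - b\<^sup>2 / 2\<close>. The gap is the square
  \<open>(s - b * r)\<^sup>2 / (2 * r)\<close>.\<close>

lemma A_fun_young:
  assumes "a + b\<^sup>2 / 2 \<le> 0"
  shows "ennreal (a * r + b * s) \<le> A_fun r s"
proof (cases "r > 0")
  case True
  have "a * r \<le> - (b\<^sup>2 / 2) * r" using assms True by (intro mult_right_mono) auto
  moreover have "- (b\<^sup>2 / 2) * r + b * s \<le> s\<^sup>2 / (2 * r)"
  proof -
    have "0 \<le> (s - b * r)\<^sup>2 / (2 * r)" using True by simp
    also have "\<dots> = s\<^sup>2 / (2 * r) - (- (b\<^sup>2 / 2) * r + b * s)"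
      using True by (simp add: field_simps power2_eq_square)
    finally show ?thesis by simp
  qed
  ultimately show ?thesis using True by (auto simp: A_fun_def intro!: ennreal_leI)
qed (auto simp: A_fun_def)

text \<open>Expanding \<open>(\<bar>s\<bar> - \<epsilon> * r)\<^sup>2 \<ge> 0\<close> gives a linear
  bound on the flux with a free weight \<open>\<epsilon>\<close>. The weight will be 1 on the edges
  and of order \<open>1 / \<kappa>\<close> at the vertices.\<close>

lemma A_fun_abs_le:
  assumes "A_fun r s \<noteq> \<infinity>" "\<epsilon> > 0"
  shows "0 \<le> r" "\<bar>s\<bar> \<le> enn2real (A_fun r s) / \<epsilon> + \<epsilon> / 2 * r"
proof -
  show "0 \<le> r" using assms by (auto simp: A_fun_def split: if_splits)
  show "\<bar>s\<bar> \<le> enn2real (A_fun r s) / \<epsilon> + \<epsilon> / 2 * r"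
  proof (cases "r > 0")
    case True
    have "0 \<le> (\<bar>s\<bar> - \<epsilon> * r)\<^sup>2 / (2 * r * \<epsilon>)" using True assms by simp
    also have "\<dots> = s\<^sup>2 / (2 * r) / \<epsilon> + \<epsilon> / 2 * r - \<bar>s\<bar>"
      using True assms by (simp add: field_simps power2_eq_square)
    finally show ?thesis using True by (simp add: A_fun_def)
  next
    case False
    then show ?thesis using assms by (auto simp: A_fun_def split: if_splits)
  qed
qed

lemma integral_A_fun_bounds:
  assumes r: "integrable \<theta> r" and s: "integrable \<theta> s" and C: "0 \<le> C"
    and le: "(\<integral>\<^sup>+z. A_fun (r z) (s z) \<partial>\<theta>) \<le> ennreal C" and \<epsilon>: "\<epsilon> > 0"
  shows "AE z in \<theta>. 0 \<le> r z" "(\<integral>z. \<bar>s z\<bar> \<partial>\<theta>) \<le> C / \<epsilon> + \<epsilon> / 2 * (\<integral>z. r z \<partial>\<theta>)"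
proof -
  have [measurable]: "r \<in> borel_measurable \<theta>" "s \<in> borel_measurable \<theta>" using r s by auto
  have fin: "(\<integral>\<^sup>+z. A_fun (r z) (s z) \<partial>\<theta>) < \<infinity>" using le by (rule le_less_trans) simp
  then have ae: "AE z in \<theta>. A_fun (r z) (s z) \<noteq> \<infinity>" by (intro nn_integral_PInf_AE) auto
  then show "AE z in \<theta>. 0 \<le> r z" by eventually_elim (rule A_fun_abs_le(1)[OF _ \<epsilon>])
  define A where "A z = enn2real (A_fun (r z) (s z))" for z
  have [measurable]: "A \<in> borel_measurable \<theta>" unfolding A_def[abs_def] by measurable
  have "(\<integral>\<^sup>+z. ennreal (A z) \<partial>\<theta>) = (\<integral>\<^sup>+z. A_fun (r z) (s z) \<partial>\<theta>)"
    using ae by (intro nn_integral_cong_AE) (auto simp: A_def less_top)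
  then have Ale: "(\<integral>\<^sup>+z. ennreal (A z) \<partial>\<theta>) \<le> ennreal C" using le by simp
  have Ai: "integrable \<theta> A"
    by (rule integrableI_nonneg) (use le_less_trans[OF Ale] in \<open>auto simp: A_def\<close>)
  have "(\<integral>z. \<bar>s z\<bar> \<partial>\<theta>) \<le> (\<integral>z. A z / \<epsilon> + \<epsilon> / 2 * r z \<partial>\<theta>)"
  proof (rule integral_mono_AE)
    show "AE z in \<theta>. \<bar>s z\<bar> \<le> A z / \<epsilon> + \<epsilon> / 2 * r z"
      using ae unfolding A_def by eventually_elim (rule A_fun_abs_le(2)[OF _ \<epsilon>])
  qed (use r s Ai in auto)
  also have "\<dots> = (\<integral>z. A z \<partial>\<theta>) / \<epsilon> + \<epsilon> / 2 * (\<integral>z. r z \<partial>\<theta>)"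
    using r Ai by simp
  also have "\<dots> \<le> C / \<epsilon> + \<epsilon> / 2 * (\<integral>z. r z \<partial>\<theta>)"
    using integral_real_bounded[OF C Ale] \<epsilon> by (auto intro: divide_right_mono)
  finally show "(\<integral>z. \<bar>s z\<bar> \<partial>\<theta>) \<le> C / \<epsilon> + \<epsilon> / 2 * (\<integral>z. r z \<partial>\<theta>)" .
qed

lemma density_action_ge_dual:
  assumes \<rho>: "signed_measure M \<rho>" and F: "signed_measure M F"
    and a: "a \<in> borel_measurable M" "\<And>x. x \<in> space M \<Longrightarrow> \<bar>a x\<bar> \<le> c"
    and b: "b \<in> borel_measurable M" "\<And>x. x \<in> space M \<Longrightarrow> \<bar>b x\<bar> \<le> c"
    and ab: "\<And>x. x \<in> space M \<Longrightarrow> a x + (b x)\<^sup>2 / 2 \<le> 0"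
  shows "ennreal (signed_integral M \<rho> a + signed_integral M F b)
    \<le> density_action (ref_measure M \<rho> F) \<rho> F"
proof (cases "density_action (ref_measure M \<rho> F) \<rho> F")
  case (real C)
  let ?\<theta> = "ref_measure M \<rho> F"
  let ?r = "signed_deriv ?\<theta> \<rho>" and ?s = "signed_deriv ?\<theta> F"
  note d = has_density_ref_measure[OF \<rho> F]
  note ra = signed_integral_density[OF \<rho> sets_ref_measure d(1) a]
  note sb = signed_integral_density[OF F sets_ref_measure d(2) b]
  have "(\<integral>\<^sup>+z. ennreal (a z * ?r z + b z * ?s z) \<partial>?\<theta>) \<le> density_action ?\<theta> \<rho> F"
    unfolding density_action_def by (intro nn_integral_mono A_fun_young ab) simp
  then have "(\<integral>z. a z * ?r z + b z * ?s z \<partial>?\<theta>) \<le> C"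
    using real by (intro integral_real_bounded) auto
  moreover have "signed_integral M \<rho> a + signed_integral M F b = (\<integral>z. a z * ?r z + b z * ?s z \<partial>?\<theta>)"
    using ra sb by simp
  ultimately show ?thesis using real by (simp add: ennreal_leI)
qed simp

text \<open>Bounded nearly optimal dual pairs. For \<open>r > 0\<close> the optimal slope
  \<open>s / r\<close> is clipped at \<open>N\<close>. For \<open>r = 0\<close> the slope
  \<open>N * sgn s\<close> yields \<open>N * \<bar>s\<bar>\<close>, and for \<open>r < 0\<close> the
  choice \<open>a = - N\<close> yields \<open>- N * r\<close>, so the dual values blow up exactly
  where \<open>A_fun\<close> is infinite.\<close>

lemma A_fun_truncation:
  fixes r s :: real
  defines "b \<equiv> \<lambda>N::nat. if r > 0 then max (- real N) (min (real N) (s / r))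
      else if r = 0 then real N * sgn s else 0"
    and "a \<equiv> \<lambda>N::nat. - (if r > 0 then (max (- real N) (min (real N) (s / r)))\<^sup>2 / 2
      else if r = 0 then (real N * sgn s)\<^sup>2 / 2 else real N)"
  shows "(\<lambda>N. ennreal (a N * r + b N * s)) \<longlonglongrightarrow> A_fun r s"
proof -
  consider "r > 0" | "r = 0" "s = 0" | "r < 0 \<or> r = 0 \<and> s \<noteq> 0" by linarith
  then show ?thesis
  proof cases
    case 1
    obtain N0 :: nat where N0: "\<bar>s / r\<bar> \<le> real N0" using real_arch_simple by blast
    have "eventually (\<lambda>N. ennreal (a N * r + b N * s) = A_fun r s) sequentially"
      using eventually_ge_at_top[of N0]
    proof eventually_elim
      case (elim N)
      then have "\<bar>s / r\<bar> \<le> real N" using N0 by linarith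
      then have eq: "max (- real N) (min (real N) (s / r)) = s / r" by linarith
      have "a N * r + b N * s = s\<^sup>2 / (2 * r)"
        using 1 unfolding a_def b_def eq by (simp add: field_simps power2_eq_square)
      then show ?case using 1 by (simp add: A_fun_def)
    qed
    then show ?thesis by (rule tendsto_eventually)
  next
    case 2
    then show ?thesis by (simp add: a_def b_def A_fun_def)
  next
    case 3
    define k where "k = (if r < 0 then - r else \<bar>s\<bar>)"
    have k: "k > 0" using 3 by (auto simp: k_def)
    have "a N * r + b N * s = k * real N" for N
      using 3 by (auto simp: a_def b_def k_def sgn_if)
    moreover have "filterlim (\<lambda>N. k * real N) at_top sequentially"
      using k by (intro filterlim_tendsto_pos_mult_at_top[OF tendsto_const] filterlim_real_sequentially)
    ultimately have "(\<lambda>N. ennreal (a N * r + b N * s)) \<longlonglongrightarrow> \<infinity>"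
      by (simp add: ennreal_tendsto_top_eq_at_top)
    moreover have "A_fun r s = \<infinity>" using 3 by (auto simp: A_fun_def)
    ultimately show ?thesis by simp
  qed
qed

text \<open>The hard half of the duality, stated with an arbitrary bound \<open>D\<close> so that
  \<open>D\<close> may be a lower limit or an explicit number. Continuous dual pairs are extended to
  bounded measurable ones, and the truncated maximizers are then inserted.\<close>

lemma density_action_le_dual:
  fixes S :: "'a::euclidean_space set"
  defines "M \<equiv> restrict_space borel S"
  assumes S: "S \<in> sets borel" and \<rho>: "signed_measure M \<rho>" and F: "signed_measure M F"
    and dual: "\<And>a b c. continuous_on UNIV a \<Longrightarrow> continuous_on UNIV b \<Longrightarrow> (\<And>x. \<bar>a x\<bar> \<le> c) \<Longrightarrow>
      (\<And>x. \<bar>b x\<bar> \<le> c) \<Longrightarrow> (\<And>x. a x + (b x)\<^sup>2 / 2 \<le> 0) \<Longrightarrow>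
      ennreal (signed_integral M \<rho> a + signed_integral M F b) \<le> D"
  shows "density_action (ref_measure M \<rho> F) \<rho> F \<le> D"
proof -
  let ?\<theta> = "ref_measure M \<rho> F"
  let ?r = "signed_deriv ?\<theta> \<rho>" and ?s = "signed_deriv ?\<theta> F"
  have spM: "space M = S" by (simp add: M_def space_restrict_space)
  note fin = finite_measure_ref_measure[OF \<rho> F]
  note d = has_density_ref_measure[OF \<rho> F]
  have r: "integrable ?\<theta> ?r" and s: "integrable ?\<theta> ?s" using d by (auto simp: has_signed_density_def)
  have [measurable]: "?r \<in> borel_measurable M" "?s \<in> borel_measurable M"
    using r s by (auto dest!: borel_measurable_integrable cong: measurable_cong_sets)
  have claim: "ennreal (\<integral>z. a z * ?r z + b z * ?s z \<partial>?\<theta>) \<le> D"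
    if ab: "a \<in> borel_measurable M" "b \<in> borel_measurable M" "\<And>x. \<bar>a x\<bar> \<le> c" "\<And>x. \<bar>b x\<bar> \<le> c"
      "\<And>x. a x + (b x)\<^sup>2 / 2 \<le> 0" for a b c
  proof -
    have c0: "0 \<le> c" using ab(3)[of undefined] by linarith
    have approx: "\<exists>h. (\<forall>n::nat. continuous_on UNIV (h n) \<and> (\<forall>x. \<bar>h n x\<bar> \<le> c)) \<and> (AE x in ?\<theta>. (\<lambda>n. h n x) \<longlonglongrightarrow> g x)"
      if "g \<in> borel_measurable M" "\<And>x. \<bar>g x\<bar> \<le> c" for g
      by (rule bounded_approx_continuous_AE[OF S fin]) (use that c0 in \<open>auto simp: M_def\<close>)
    obtain h where h: "\<And>n. continuous_on UNIV (h n)" "\<And>n x. \<bar>h n x\<bar> \<le> c"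
      "AE x in ?\<theta>. (\<lambda>n. h n x) \<longlonglongrightarrow> a x"
      using approx[OF ab(1,3)] by blast
    obtain k where k: "\<And>n. continuous_on UNIV (k n)" "\<And>n x. \<bar>k n x\<bar> \<le> c"
      "AE x in ?\<theta>. (\<lambda>n. k n x) \<longlonglongrightarrow> b x"
      using approx[OF ab(2,4)] by blast
    \<comment> \<open>\<open>a\<close> and \<open>b\<close> are approximated separately, so the pair
      \<open>h\<close>, \<open>k\<close> may violate the constraint. The minimum restores it and
      does not change the limit, since \<open>a x \<le> - (b x)\<^sup>2 / 2\<close>.\<close>
    define h' where "h' n x = min (h n x) (- ((k n x)\<^sup>2 / 2))" for n x
    define K where "K = c + c\<^sup>2"
    have kK: "\<bar>k n x\<bar> \<le> K" for n x
      using k(2)[of n x] zero_le_power2[of c] unfolding K_def by linarith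
    have hK: "\<bar>h' n x\<bar> \<le> K" for n x
    proof -
      have "(k n x)\<^sup>2 \<le> c\<^sup>2" using k(2)[of n x] by (rule abs_le_square_iff[THEN iffD1, OF order_trans]) simp
      then show ?thesis using h(2)[of n x] c0 zero_le_power2[of "k n x"] zero_le_power2[of c]
        unfolding h'_def K_def by linarith
    qed
    have h'c: "continuous_on UNIV (h' n)" for n
      unfolding h'_def[abs_def] by (intro continuous_intros h(1) k(1)) auto
    have cm: "f \<in> borel_measurable M" if "continuous_on UNIV f" for f :: "'a \<Rightarrow> real"
      unfolding M_def using that by (intro measurable_restrict_space1 borel_measurable_continuous_onI)
    note h'm = cm[OF h'c] and km = cm[OF k(1)]
    note ih = signed_integral_density[OF \<rho> sets_ref_measure d(1) h'm hK]
    note ik = signed_integral_density[OF F sets_ref_measure d(2) km kK]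
    have "(\<lambda>n. \<integral>z. h' n z * ?r z + k n z * ?s z \<partial>?\<theta>) \<longlonglongrightarrow> (\<integral>z. a z * ?r z + b z * ?s z \<partial>?\<theta>)"
    proof (rule integral_dominated_convergence[where w="\<lambda>z. K * \<bar>?r z\<bar> + K * \<bar>?s z\<bar>"])
      show "AE z in ?\<theta>. (\<lambda>n. h' n z * ?r z + k n z * ?s z) \<longlonglongrightarrow> a z * ?r z + b z * ?s z"
        using h(3) k(3)
      proof eventually_elim
        case (elim z)
        have "(\<lambda>n. h' n z) \<longlonglongrightarrow> min (a z) (- ((b z)\<^sup>2 / 2))"
          unfolding h'_def by (intro tendsto_intros elim) auto
        also have "min (a z) (- ((b z)\<^sup>2 / 2)) = a z" using ab(5)[of z] by simp
        finally show ?case by (intro tendsto_intros elim)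
      qed
      show "AE z in ?\<theta>. norm (h' n z * ?r z + k n z * ?s z) \<le> K * \<bar>?r z\<bar> + K * \<bar>?s z\<bar>" for n
      proof (rule AE_I2)
        fix z
        have "\<bar>h' n z * ?r z + k n z * ?s z\<bar> \<le> \<bar>h' n z\<bar> * \<bar>?r z\<bar> + \<bar>k n z\<bar> * \<bar>?s z\<bar>"
          by (metis abs_mult abs_triangle_ineq)
        also have "\<dots> \<le> K * \<bar>?r z\<bar> + K * \<bar>?s z\<bar>"
          using hK[of n z] kK[of n z] by (intro add_mono mult_right_mono) auto
        finally show "norm (h' n z * ?r z + k n z * ?s z) \<le> K * \<bar>?r z\<bar> + K * \<bar>?s z\<bar>" by simp
      qed
    qed (use r s h'm km ab in \<open>auto cong: measurable_cong_sets\<close>)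
    then have "(\<lambda>n. ennreal (\<integral>z. h' n z * ?r z + k n z * ?s z \<partial>?\<theta>))
      \<longlonglongrightarrow> ennreal (\<integral>z. a z * ?r z + b z * ?s z \<partial>?\<theta>)" by (rule tendsto_ennrealI)
    moreover have "ennreal (\<integral>z. h' n z * ?r z + k n z * ?s z \<partial>?\<theta>) \<le> D" for n
    proof -
      have "ennreal (signed_integral M \<rho> (h' n) + signed_integral M F (k n)) \<le> D"
        by (rule dual[OF h'c k(1) hK kK]) (auto simp: h'_def min_def)
      then show ?thesis using ih ik by simp
    qed
    ultimately show ?thesis by (intro LIMSEQ_le_const2) auto
  qed
  define b where "b N x = (if ?r x > 0 then max (- real N) (min (real N) (?s x / ?r x))
      else if ?r x = 0 then real N * sgn (?s x) else 0)" for N x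
  define a where "a N x = - (if ?r x > 0 then (max (- real N) (min (real N) (?s x / ?r x)))\<^sup>2 / 2
      else if ?r x = 0 then (real N * sgn (?s x))\<^sup>2 / 2 else real N)" for N x
  have [measurable]: "a N \<in> borel_measurable M" "b N \<in> borel_measurable M" for N
    unfolding a_def[abs_def] b_def[abs_def] by measurable
  have bN: "\<bar>b N x\<bar> \<le> real N" for N x
    by (auto simp: b_def sgn_if)
  have aN: "\<bar>a N x\<bar> \<le> real N + (real N)\<^sup>2" for N x
  proof (cases "?r x < 0")
    case False
    then have eq: "\<bar>a N x\<bar> = (b N x)\<^sup>2 / 2" by (auto simp: a_def b_def)
    have "(b N x)\<^sup>2 \<le> (real N)\<^sup>2" using bN[of N x] by (metis abs_le_square_iff abs_of_nat)
    then show ?thesis unfolding eq using zero_le_power2[of "real N"] by linarith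
  qed (auto simp: a_def)
  have abN: "a N x + (b N x)\<^sup>2 / 2 \<le> 0" for N x
    by (auto simp: a_def b_def)
  \<comment> \<open>Nonnegative dual integrands allow Fatou's lemma in \<open>N\<close> and identify
    the integrals of \<open>ennreal\<close> values with the real integrals bounded by
    \<open>claim\<close>.\<close>
  have pos: "0 \<le> a N z * ?r z + b N z * ?s z" for N z
  proof -
    consider "?r z > 0" | "?r z = 0" | "?r z < 0" by linarith
    then show ?thesis
    proof cases
      case 1
      define q where "q = ?s z / ?r z"
      have sq: "?s z = q * ?r z" using 1 by (simp add: q_def)
      define \<beta> where "\<beta> = max (- real N) (min (real N) q)"
      \<comment> \<open>The clipped slope \<open>\<beta>\<close> lies between 0 and
        \<open>q\<close>, so \<open>\<beta>\<close> and \<open>q - \<beta> / 2\<close> have the same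
        sign.\<close>
      have "0 \<le> \<beta> * (q - \<beta> / 2)"
      proof (cases "q \<ge> 0")
        case True
        then have "0 \<le> \<beta>" "\<beta> \<le> q" by (auto simp: \<beta>_def)
        then show ?thesis by (intro mult_nonneg_nonneg) auto
      next
        case False
        then have "\<beta> \<le> 0" "q \<le> \<beta>" by (auto simp: \<beta>_def)
        then show ?thesis by (intro mult_nonpos_nonpos) auto
      qed
      then have "0 \<le> \<beta> * (q - \<beta> / 2) * ?r z" using 1 by simp
      also have "\<dots> = a N z * ?r z + b N z * ?s z"
        using 1 unfolding a_def b_def sq by (simp add: \<beta>_def[symmetric] power2_eq_square algebra_simps)
      finally show ?thesis .
    qed (auto simp: a_def b_def sgn_if mult_nonneg_nonpos)
  qed
  have int: "integrable ?\<theta> (\<lambda>z. a N z * ?r z + b N z * ?s z)" for N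
    by (intro Bochner_Integration.integrable_add signed_integral_density(1)[OF \<rho> sets_ref_measure d(1) _ aN]
      signed_integral_density(1)[OF F sets_ref_measure d(2) _ bN]) measurable
  have "density_action ?\<theta> \<rho> F = (\<integral>\<^sup>+z. liminf (\<lambda>N. ennreal (a N z * ?r z + b N z * ?s z)) \<partial>?\<theta>)"
    unfolding density_action_def a_def b_def
    by (intro nn_integral_cong lim_imp_Liminf[symmetric] A_fun_truncation) simp
  also have "\<dots> \<le> liminf (\<lambda>N. \<integral>\<^sup>+z. ennreal (a N z * ?r z + b N z * ?s z) \<partial>?\<theta>)"
    by (rule nn_integral_liminf) measurable
  also have "\<dots> = liminf (\<lambda>N. ennreal (\<integral>z. a N z * ?r z + b N z * ?s z \<partial>?\<theta>))"
    using pos int by (simp add: nn_integral_eq_integral)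
  also have "\<dots> \<le> liminf (\<lambda>N. D)"
  proof (intro Liminf_mono always_eventually allI)
    fix N
    show "ennreal (\<integral>z. a N z * ?r z + b N z * ?s z \<partial>?\<theta>) \<le> D"
      using aN[of N] bN[of N] abN
      by (intro claim[where c="real N + (real N)\<^sup>2"]) (auto intro: order_trans add_increasing2)
  qed
  also have "\<dots> = D" by (simp add: Liminf_const)
  finally show ?thesis .
qed

lemma density_action_lsc:
  fixes S :: "'a::euclidean_space set"
  defines "M \<equiv> restrict_space borel S"
  assumes S: "S \<in> sets borel"
    and \<rho>n: "\<And>n. signed_measure M (\<rho>n n)" and Fn: "\<And>n. signed_measure M (Fn n)"
    and \<rho>: "signed_measure M \<rho>" and F: "signed_measure M F"
    and lim: "narrowly_converges S \<rho>n \<rho>" "narrowly_converges S Fn F"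
  shows "density_action (ref_measure M \<rho> F) \<rho> F
    \<le> liminf (\<lambda>n. density_action (ref_measure M (\<rho>n n) (Fn n)) (\<rho>n n) (Fn n))"
  unfolding M_def
proof (rule density_action_le_dual[OF S \<rho>[unfolded M_def] F[unfolded M_def]], fold M_def)
  fix a b c
  assume ab: "continuous_on UNIV a" "continuous_on UNIV b" "\<And>x::'a. \<bar>a x\<bar> \<le> c" "\<And>x. \<bar>b x\<bar> \<le> c"
      "\<And>x. a x + (b x)\<^sup>2 / 2 \<le> (0::real)"
  have cm: "f \<in> borel_measurable M" if "continuous_on UNIV f" for f :: "'a \<Rightarrow> real"
    unfolding M_def using that by (intro measurable_restrict_space1 borel_measurable_continuous_onI)
  have bd: "bounded (a ` S)" "bounded (b ` S)"
    using ab(3,4) by (auto simp: bounded_iff)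
  have "(\<lambda>n. signed_integral M (\<rho>n n) a + signed_integral M (Fn n) b)
     \<longlonglongrightarrow> signed_integral M \<rho> a + signed_integral M F b"
    using lim ab(1,2) bd unfolding narrowly_converges_def M_def
    by (intro tendsto_add) (auto intro: continuous_on_subset)
  then have "ennreal (signed_integral M \<rho> a + signed_integral M F b) =
    liminf (\<lambda>n. ennreal (signed_integral M (\<rho>n n) a + signed_integral M (Fn n) b))"
    by (intro lim_imp_Liminf[symmetric] tendsto_ennrealI) simp_all
  also have "\<dots> \<le> liminf (\<lambda>n. density_action (ref_measure M (\<rho>n n) (Fn n)) (\<rho>n n) (Fn n))"
    using ab cm by (intro Liminf_mono always_eventually allI density_action_ge_dual[OF \<rho>n Fn, where c=c]) auto
  finally show "ennreal (signed_integral M \<rho> a + signed_integral M F b)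
    \<le> liminf (\<lambda>n. density_action (ref_measure M (\<rho>n n) (Fn n)) (\<rho>n n) (Fn n))" .
qed


section \<open>Narrow compactness\<close>

lemma binary_expansion:
  fixes x :: real
  assumes "0 \<le> x" "x \<le> 1"
  shows "\<exists>c :: nat \<Rightarrow> nat. (\<forall>k. c k \<in> {0, 1}) \<and> (\<lambda>k. real (c k) * (1/2) ^ Suc k) sums x"
proof -
  \<comment> \<open>Doubling map: \<open>y k\<close> is the rescaled remainder after
    \<open>k\<close> digits. Taking digit 1 from 1/2 on keeps it in [0, 1], also for
    \<open>x = 1\<close>, where all digits are 1.\<close>
  define y where "y = rec_nat x (\<lambda>_ z. if z \<ge> 1/2 then 2 * z - 1 else 2 * z)"
  define c :: "nat \<Rightarrow> nat" where "c k = (if y k \<ge> 1/2 then 1 else 0)" for k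
  have y: "y 0 = x" "y (Suc k) = 2 * y k - real (c k)" for k
    by (simp_all add: y_def c_def)
  have yb: "0 \<le> y k \<and> y k \<le> 1" for k
    by (induction k) (use assms in \<open>auto simp: y c_def\<close>)
  have part: "(\<Sum>k<n. real (c k) * (1/2) ^ Suc k) = x - y n * (1/2) ^ n" for n
  proof (induction n)
    case (Suc n)
    have *: "x - Y * w + d * (1/2 * w) = x - (2 * Y - d) * (1/2 * w)" for Y w d :: real
      by (simp add: field_simps)
    show ?case
      unfolding sum.lessThan_Suc Suc y(2) power_Suc[of _ n] by (rule *)
  qed (simp add: y)
  have "(\<lambda>n. y n * (1/2) ^ n) \<longlonglongrightarrow> 0"
  proof (rule tendsto_sandwich[OF _ _ tendsto_const])
    show "(\<lambda>n. (1/2::real) ^ n) \<longlonglongrightarrow> 0" by (rule LIMSEQ_realpow_zero) auto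
    show "\<forall>\<^sub>F n in sequentially. 0 \<le> y n * (1/2) ^ n" using yb by simp
    show "\<forall>\<^sub>F n in sequentially. y n * (1/2) ^ n \<le> (1/2) ^ n"
      using yb by (intro always_eventually allI mult_left_le_one_le) simp_all
  qed
  then have "(\<lambda>n. x - y n * (1/2) ^ n) \<longlonglongrightarrow> x - 0" by (intro tendsto_intros)
  then have "(\<lambda>k. real (c k) * (1/2) ^ Suc k) sums x" unfolding sums_def part by simp
  then show ?thesis by (intro exI[of _ c]) (auto simp: c_def)
qed

text \<open>Schoenberg's auxiliary function in a cosine version: 2-periodic, 0 on [0, 1/3] and 1 on
  [2/3, 1]. Clipping a cosine makes continuity and periodicity immediate.\<close>

definition bump :: "real \<Rightarrow> real" where
  "bump x = max 0 (min 1 (1/2 - cos (pi * x)))"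

lemma bump_bounds: "0 \<le> bump x" "bump x \<le> 1"
  by (auto simp: bump_def)

lemma continuous_on_bump[continuous_intros]:
  fixes f :: "'a::t2_space \<Rightarrow> real"
  shows "continuous_on A f \<Longrightarrow> continuous_on A (\<lambda>x. bump (f x))"
  unfolding bump_def by (intro continuous_intros)

lemma bump_plus_even: "bump (x + 2 * real n) = bump x"
  using cos.plus_of_nat[of "pi * x" n] by (simp add: bump_def algebra_simps)

lemma bump_0: "0 \<le> x \<Longrightarrow> x \<le> 1/3 \<Longrightarrow> bump x = 0"
  using cos_monotone_0_pi_le[of "pi * x" "pi / 3"] by (simp add: bump_def cos_60)

lemma bump_1: "2/3 \<le> x \<Longrightarrow> x \<le> 1 \<Longrightarrow> bump x = 1"
  using cos_monotone_0_pi_le[of "2 * pi / 3" "pi * x"] by (simp add: bump_def cos_120)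

text \<open>A digit sequence is read off a ternary expansion without the digit 1, as in
  Schoenberg's space filling curve.\<close>

lemma ternary_digits:
  fixes c :: "nat \<Rightarrow> nat"
  assumes c: "\<And>k. c k \<in> {0, 1}"
  shows "\<exists>t\<in>{0..1}. \<forall>k. bump (3 ^ k * t) = real (c k)"
proof -
  \<comment> \<open>\<open>T 0\<close> has the ternary digits \<open>2 * c k\<close>, and
    \<open>T k\<close> is its tail after \<open>k\<close> digits. It lies in [0, 1/3] or in [2/3, 1]
    according to \<open>c k\<close>.\<close>
  define T where "T k = (\<Sum>i. 2 * real (c (k + i)) * (1/3) ^ Suc i)" for k
  have geo: "(\<lambda>i. 2 * (1/3) ^ Suc i :: real) sums 1"
    using sums_mult[OF geometric_sums[of "1/3 :: real"], of "2/3"] by (simp add: mult.assoc)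
  have c1: "real (c k) \<le> 1" for k using c[of k] by auto
  have le: "2 * real (c (k + i)) * (1/3) ^ Suc i \<le> 2 * (1/3) ^ Suc i" for k i
    using c1[of "k+i"] by (intro mult_right_mono) auto
  have sm: "summable (\<lambda>i. 2 * real (c (k + i)) * (1/3) ^ Suc i)" for k
    by (rule summable_comparison_test'[OF sums_summable[OF geo], of 0]) (use le in auto)
  have T0: "0 \<le> T k" for k unfolding T_def by (intro suminf_nonneg sm) auto
  have T1: "T k \<le> 1" for k
    unfolding T_def using suminf_le[OF le sm sums_summable[OF geo]] sums_unique[OF geo] by simp
  have TS: "T k = 2 * real (c k) / 3 + T (Suc k) / 3" for k
  proof -
    have "T k = 2 * real (c (k + 0)) * (1/3) ^ Suc 0 + (\<Sum>i. 2 * real (c (k + Suc i)) * (1/3) ^ Suc (Suc i))"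
      unfolding T_def by (subst suminf_split_head[OF sm]) simp
    also have "(\<Sum>i. 2 * real (c (k + Suc i)) * (1/3) ^ Suc (Suc i)) = (1/3) * T (Suc k)"
      unfolding T_def by (subst suminf_mult[OF sm, symmetric]) (simp add: ac_simps)
    finally show ?thesis by simp
  qed
  \<comment> \<open>All digits being 0 or 2, the integer split off by multiplying with
    \<open>3 ^ k\<close> is even, and the period 2 of \<open>bump\<close> removes it.\<close>
  have "\<exists>N. 3 ^ k * T 0 = T k + 2 * real N" for k
  proof (induction k)
    case (Suc k)
    then obtain N where N: "3 ^ k * T 0 = T k + 2 * real N" by blast
    have "3 ^ Suc k * T 0 = 3 * (3 ^ k * T 0)" by simp
    also have "\<dots> = T (Suc k) + 2 * real (3 * N + c k)"
      unfolding N using TS[of k] by simp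
    finally show ?case by blast
  qed (auto intro: exI[of _ 0])
  then obtain N where N: "\<And>k. 3 ^ k * T 0 = T k + 2 * real (N k)" by metis
  have "bump (3 ^ k * T 0) = real (c k)" for k
  proof -
    have "bump (T k) = real (c k)"
      using c[of k] T0[of "Suc k"] T1[of "Suc k"] TS[of k] by (auto intro!: bump_0 bump_1)
    then show ?thesis by (simp add: N bump_plus_even)
  qed
  then show ?thesis using T0 T1 by (intro bexI[of _ "T 0"] allI) simp_all
qed

lemma sums_half: "(\<lambda>k. (1/2::real) ^ Suc k) sums 1"
  by (rule power_half_series)

lemma bump_series:
  fixes a :: "nat \<Rightarrow> real"
  shows "continuous_on UNIV (\<lambda>t. \<Sum>k. bump (a k * t) * (1/2) ^ Suc k)"
    and "(\<Sum>k. bump (a k * t) * (1/2) ^ Suc k) \<in> {0..1}"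
proof -
  have b: "0 \<le> bump (a k * t) * (1/2) ^ Suc k" "bump (a k * t) * (1/2) ^ Suc k \<le> (1/2) ^ Suc k" for k t
    using bump_bounds[of "a k * t"] by (auto intro!: mult_left_le_one_le)
  have sm: "summable (\<lambda>k. bump (a k * t) * (1/2) ^ Suc k)" for t
    by (rule summable_comparison_test'[OF sums_summable[OF sums_half], of 0]) (use b in auto)
  have "uniform_limit UNIV (\<lambda>n t. \<Sum>k<n. bump (a k * t) * (1/2) ^ Suc k) (\<lambda>t. \<Sum>k. bump (a k * t) * (1/2) ^ Suc k) sequentially"
    by (rule Weierstrass_m_test[OF _ sums_summable[OF sums_half]]) (use b in auto)
  then show "continuous_on UNIV (\<lambda>t. \<Sum>k. bump (a k * t) * (1/2) ^ Suc k)"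
    by (rule uniform_limit_theorem[rotated]) (auto intro!: always_eventually continuous_intros)
  show "(\<Sum>k. bump (a k * t) * (1/2) ^ Suc k) \<in> {0..1}"
    using suminf_nonneg[OF sm b(1)] suminf_le[OF b(2) sm sums_summable[OF sums_half]]
      sums_unique[OF sums_half] by auto
qed

text \<open>The binary digits of the two coordinates are interleaved: even positions feed the first,
  odd positions the second. The curve stays in the rectangle on the whole line, so a function on the
  rectangle pulls back to all of it, whatever the support of a limit measure on the line.\<close>

lemma space_filling_curve:
  fixes l :: real
  assumes l: "0 \<le> l"
  shows "\<exists>p :: real \<Rightarrow> real \<times> real. continuous_on UNIV p \<and> range p = {0..1} \<times> {0..l} \<and> p ` {0..1} = {0..1} \<times> {0..l}"
proof -
  define X Y :: "real \<Rightarrow> real" where "X t = (\<Sum>k. bump (3 ^ (2 * k) * t) * (1/2) ^ Suc k)"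
    and "Y t = (\<Sum>k. bump (3 ^ (2 * k + 1) * t) * (1/2) ^ Suc k)" for t
  have c: "continuous_on UNIV X" "continuous_on UNIV Y"
    unfolding X_def[abs_def] Y_def[abs_def] by (rule bump_series)+
  have r: "X t \<in> {0..1}" "Y t \<in> {0..1}" for t
    unfolding X_def Y_def by (rule bump_series)+
  define p where "p t = (X t, l * Y t)" for t
  have onto: "\<exists>t\<in>{0..1}. p t = z" if z: "z \<in> {0..1} \<times> {0..l}" for z
  proof -
    obtain x y where xy: "z = (x, y)" by (cases z)
    define y' where "y' = (if l = 0 then 0 else y / l)"
    have xb: "0 \<le> x" "x \<le> 1" and yb: "0 \<le> y'" "y' \<le> 1" and yl: "y = l * y'"
      using z xy l by (auto simp: y'_def divide_simps)
    obtain a where a: "\<And>k. a k \<in> {0, 1::nat}" "(\<lambda>k. real (a k) * (1/2) ^ Suc k) sums x"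
      using binary_expansion[OF xb] by blast
    obtain b where b: "\<And>k. b k \<in> {0, 1::nat}" "(\<lambda>k. real (b k) * (1/2) ^ Suc k) sums y'"
      using binary_expansion[OF yb] by blast
    define d where "d k = (if even k then a (k div 2) else b (k div 2))" for k
    have "d k \<in> {0, 1}" for k using a b by (auto simp: d_def)
    then obtain t where t: "t \<in> {0..1}" "\<And>k. bump (3 ^ k * t) = real (d k)"
      using ternary_digits[of d] by blast
    have "X t = x" unfolding X_def t(2) using sums_unique[OF a(2)] by (simp add: d_def)
    moreover have "Y t = y'" unfolding Y_def t(2) using sums_unique[OF b(2)] by (simp add: d_def)
    ultimately have "p t = z" by (simp add: p_def xy yl)
    with t(1) show ?thesis by blast
  qed
  have sub: "p t \<in> {0..1} \<times> {0..l}" for t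
    using r[of t] l by (auto simp: p_def intro: mult_left_le)
  have "continuous_on UNIV p"
    unfolding p_def[abs_def] by (intro continuous_intros c)
  moreover have "p ` {0..1} = {0..1} \<times> {0..l}"
    using sub onto unfolding set_eq_iff image_iff by metis
  moreover from this have "range p = {0..1} \<times> {0..l}"
    using sub by blast
  ultimately show ?thesis by blast
qed

text \<open>The section picks the leftmost preimage. Its sublevel set at \<open>a\<close> is then
  the compact image of the part of [0, 1] up to \<open>a\<close>, which makes it Borel.\<close>

lemma borel_section:
  fixes p :: "real \<Rightarrow> 'a::{second_countable_topology, t2_space}"
  assumes p: "continuous_on UNIV p" and Q: "p ` {0..1} = Q"
  shows "\<exists>\<sigma>. \<sigma> \<in> borel_measurable (restrict_space borel Q) \<and> (\<forall>y\<in>Q. \<sigma> y \<in> {0..1} \<and> p (\<sigma> y) = y)"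
proof -
  have "\<exists>t. (t \<in> {0..1} \<and> p t = y) \<and> (\<forall>t'\<in>{0..1}. p t' = y \<longrightarrow> t \<le> t')" if "y \<in> Q" for y
  proof -
    have "closed {t. p t = y}" using p by (intro closed_Collect_eq) auto
    then have "compact ({0..1} \<inter> {t. p t = y})" by (intro compact_Int_closed) auto
    moreover have "{0..1} \<inter> {t. p t = y} \<noteq> {}" using that Q by auto
    ultimately show ?thesis using compact_attains_inf[of "{0..1} \<inter> {t. p t = y}"] by auto
  qed
  then obtain \<sigma> where \<sigma>: "\<And>y. y \<in> Q \<Longrightarrow> \<sigma> y \<in> {0..1} \<and> p (\<sigma> y) = y"
    "\<And>y t. y \<in> Q \<Longrightarrow> t \<in> {0..1} \<Longrightarrow> p t = y \<Longrightarrow> \<sigma> y \<le> t" by metis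
  have "\<sigma> \<in> borel_measurable (restrict_space borel Q)"
  proof (rule borel_measurableI_le)
    fix a
    have "{y \<in> space (restrict_space borel Q). \<sigma> y \<le> a} = p ` ({0..1} \<inter> {..a})"
    proof (intro subset_antisym subsetI)
      fix y assume "y \<in> {y \<in> space (restrict_space borel Q). \<sigma> y \<le> a}"
      then have "y \<in> Q" "\<sigma> y \<le> a" by (auto simp: space_restrict_space)
      then show "y \<in> p ` ({0..1} \<inter> {..a})"
        using \<sigma>(1)[of y] by (intro image_eqI[of _ _ "\<sigma> y"]) simp_all
    next
      fix y assume "y \<in> p ` ({0..1} \<inter> {..a})"
      then obtain t where t: "t \<in> {0..1}" "t \<le> a" "y = p t" by blast
      then have "y \<in> Q" using Q by blast
      moreover have "\<sigma> y \<le> a" using \<sigma>(2)[OF \<open>y \<in> Q\<close> t(1) t(3)[symmetric]] t(2) by linarith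
      ultimately show "y \<in> {y \<in> space (restrict_space borel Q). \<sigma> y \<le> a}"
        by (simp add: space_restrict_space)
    qed
    moreover have "compact (p ` ({0..1} \<inter> {..a}))"
      by (intro compact_continuous_image continuous_on_subset[OF p] compact_Int_closed) auto
    moreover have "compact Q"
      unfolding Q[symmetric] by (intro compact_continuous_image continuous_on_subset[OF p]) auto
    ultimately show "{y \<in> space (restrict_space borel Q). \<sigma> y \<le> a} \<in> sets (restrict_space borel Q)"
      using Q by (subst sets_restrict_space_iff) (auto intro!: borel_closed compact_imp_closed)
  qed
  with \<sigma> show ?thesis by blast
qed

section \<open>Narrow compactness from Helly's theorem on the line\<close>

definition scale_by :: "real \<Rightarrow> 'a measure \<Rightarrow> 'a measure" where
  "scale_by c a = density a (\<lambda>_. ennreal c)"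

lemma space_scale_by[simp]: "space (scale_by c a) = space a"
  and sets_scale_by[simp, measurable_cong]: "sets (scale_by c a) = sets a"
  by (simp_all add: scale_by_def)

lemma emeasure_scale_by: "A \<in> sets a \<Longrightarrow> emeasure (scale_by c a) A = ennreal c * emeasure a A"
  by (simp add: scale_by_def emeasure_density_const)

lemma finite_measure_scale_by: "finite_measure a \<Longrightarrow> finite_measure (scale_by c a)"
  by (intro finite_measureI)
    (auto simp: emeasure_scale_by ennreal_mult_eq_top_iff finite_measure.emeasure_finite)

lemma integrable_scale_by:
  fixes f :: "'a \<Rightarrow> real"
  assumes "0 \<le> c" "integrable a f"
  shows "integrable (scale_by c a) f"
  unfolding scale_by_def using assms by (subst integrable_density) auto

lemma integral_scale_by:
  fixes f :: "'a \<Rightarrow> real"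
  assumes "0 \<le> c" "f \<in> borel_measurable a"
  shows "integral\<^sup>L (scale_by c a) f = c * integral\<^sup>L a f"
  unfolding scale_by_def using assms by (subst integral_density) auto

text \<open>Helly's theorem concerns probability measures on the line. The measures are pushed there
  by the section \<open>\<sigma>\<close>, divided by a common bound and completed to mass 1 by an
  atom at 0; the limit is brought back by \<open>p\<close>. The added atom must be subtracted
  afterwards, whence the limit has the form of a difference.\<close>

lemma finite_measures_convergent_subseq:
  fixes p :: "real \<Rightarrow> 'a::{second_countable_topology, t2_space}"
  assumes p: "continuous_on UNIV p" "p ` {0..1} = Q" "range p = Q"
    and m: "\<And>n::nat. finite_measure (m n)" "\<And>n. sets (m n) = sets (restrict_space borel Q)"
    and mC: "\<And>n. measure (m n) Q \<le> C"
  shows "\<exists>s a b. strict_mono (s :: nat \<Rightarrow> nat) \<and> finite_measure a \<and> finite_measure b \<and>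
     sets a = sets (restrict_space borel Q) \<and> sets b = sets (restrict_space borel Q) \<and>
     (\<forall>\<psi>::_ \<Rightarrow> real. continuous_on Q \<psi> \<longrightarrow> bounded (\<psi> ` Q) \<longrightarrow>
        (\<lambda>n. integral\<^sup>L (m (s n)) \<psi>) \<longlonglongrightarrow> integral\<^sup>L a \<psi> - integral\<^sup>L b \<psi>)"
proof -
  let ?M = "restrict_space borel Q"
  obtain \<sigma> where \<sigma>: "\<sigma> \<in> borel_measurable ?M" "\<And>y. y \<in> Q \<Longrightarrow> \<sigma> y \<in> {0..1}" "\<And>y. y \<in> Q \<Longrightarrow> p (\<sigma> y) = y"
    using borel_section[OF p(1,2)] by blast
  have spM: "space ?M = Q" by (simp add: space_restrict_space)
  have spm: "space (m n) = Q" for n using sets_eq_imp_space_eq[OF m(2)] spM by simp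
  \<comment> \<open>The maximum with 1 keeps the normalizing constant positive, since
    \<open>C\<close> may be 0.\<close>
  define C' where "C' = max 1 C"
  have C': "C' > 0" "\<And>n. measure (m n) Q \<le> C'" using mC by (auto simp: C'_def intro: le_max_iff_disj[THEN iffD2])
  define y where "y n = measure (m n) Q" for n
  have yb: "0 \<le> y n" "y n \<le> C'" for n using C' by (auto simp: y_def)
  have "bounded (range y)" using yb by (auto simp: bounded_iff intro!: exI[of _ C'])
  \<comment> \<open>A first extraction makes the masses converge, so that the weight of the
    artificial atom converges too.\<close>
  then obtain y0 s0 where s0: "strict_mono s0" "(y \<circ> s0) \<longlonglongrightarrow> y0"
    using bounded_imp_convergent_subsequence by blast
  have y0: "y0 \<le> C'" using s0(2) yb by (intro LIMSEQ_le_const2[OF s0(2)]) auto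
  have [measurable]: "\<sigma> \<in> borel_measurable (m n)" for n
    using \<sigma>(1) m(2) by (simp cong: measurable_cong_sets)
  define P where "P n = add_measure (scale_by (1 / C') (distr (m n) borel \<sigma>))
      (scale_by (1 - y n / C') (return borel 0))" for n
  have setsP: "sets (P n) = sets borel" "space (P n) = UNIV" for n by (simp_all add: P_def)
  have emP: "emeasure (P n) B = 1" if B: "B \<in> sets borel" "{0..1} \<subseteq> B" for n B
  proof -
    have "emeasure (distr (m n) borel \<sigma>) B = emeasure (m n) Q"
      using B(1) subsetD[OF B(2) \<sigma>(2)]
      by (subst emeasure_distr) (auto simp: spm intro!: arg_cong[where f="emeasure (m n)"])
    also have "\<dots> = ennreal (y n)"
      using m(1) by (simp add: y_def finite_measure.emeasure_eq_measure)
    finally have "emeasure (P n) B = ennreal (1 / C') * ennreal (y n) + ennreal (1 - y n / C')"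
      using B(1) subsetD[OF B(2), of 0] by (simp add: P_def emeasure_add_measure emeasure_scale_by)
    also have "\<dots> = ennreal (1 / C' * y n + (1 - y n / C'))"
      using yb[of n] C' by (subst ennreal_mult[symmetric], simp, simp, subst ennreal_plus[symmetric]) auto
    finally show ?thesis by simp
  qed
  have rd: "real_distribution (P n)" for n
    unfolding real_distribution_def real_distribution_axioms_def
    using setsP by (auto intro!: prob_spaceI emP)
  have tight: "tight P"
    unfolding tight_def
  proof (intro conjI allI impI rd)
    fix \<epsilon> :: real assume "\<epsilon> > 0"
    moreover have "measure (P n) {-1<..2} = 1" for n
      using emP[of "{-1<..2}" n] by (simp add: measure_def subset_eq)
    ultimately show "\<exists>a b. a < b \<and> (\<forall>n. 1 - \<epsilon> < measure (P n) {a<..b})"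
      by (intro exI[of _ "-1"] exI[of _ 2]) auto
  qed
  obtain s1 R where s1: "strict_mono s1" "real_distribution R" "weak_conv_m (P \<circ> s0 \<circ> s1) R"
    using tight_imp_convergent_subsubsequence[OF tight s0(1)] by blast
  define s where "s = s0 \<circ> s1"
  have s: "strict_mono s" unfolding s_def by (rule strict_mono_o[OF s0(1) s1(1)])
  have ys: "(\<lambda>n. y (s n)) \<longlonglongrightarrow> y0"
    using LIMSEQ_subseq_LIMSEQ[OF s0(2) s1(1)] by (simp add: s_def comp_def)
  interpret R: real_distribution R by fact
  have pm: "p \<in> measurable borel ?M"
    using p(3) by (intro measurable_restrict_space2 borel_measurable_continuous_onI p(1)) auto
  then have pmR: "p \<in> measurable R ?M" by (simp cong: measurable_cong_sets)
  have p0: "p 0 \<in> Q" using p(3) by auto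
  \<comment> \<open>\<open>a\<close> brings the Helly limit back to \<open>Q\<close>;
    \<open>b\<close> is the limit of the artificial atoms, located at \<open>p 0\<close>.\<close>
  define a where "a = scale_by C' (distr R ?M p)"
  define b where "b = scale_by (C' - y0) (return ?M (p 0))"
  have "(\<lambda>n. integral\<^sup>L (m (s n)) \<psi>) \<longlonglongrightarrow> integral\<^sup>L a \<psi> - integral\<^sup>L b \<psi>"
    if \<psi>: "continuous_on Q \<psi>" "bounded (\<psi> ` Q)" for \<psi> :: "'a \<Rightarrow> real"
  proof -
    obtain B where B: "\<And>x. x \<in> Q \<Longrightarrow> \<bar>\<psi> x\<bar> \<le> B" using \<psi>(2) by (auto simp: bounded_iff)
    have \<psi>m: "\<psi> \<in> borel_measurable ?M" using \<psi>(1) by (rule borel_measurable_continuous_on_restrict)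
    define g where "g = (\<lambda>t. \<psi> (p t))"
    have gc: "continuous_on UNIV g"
      unfolding g_def using p by (intro continuous_on_compose2[OF \<psi>(1)]) auto
    then have [measurable]: "g \<in> borel_measurable borel" by (rule borel_measurable_continuous_onI)
    have gB: "\<bar>g t\<bar> \<le> B" for t using B p(3) by (auto simp: g_def)
    have gi: "integrable N g" if "finite_measure N" "sets N = sets borel" for N
      using gB by (intro integrable_finite_bounded[OF that, of g B]) auto
    have intP: "integral\<^sup>L (P n) g = (1 / C') * integral\<^sup>L (m n) \<psi> + (1 - y n / C') * g 0" for n
    proof -
      have fd: "finite_measure (distr (m n) borel \<sigma>)" "finite_measure (return borel (0::real))"
        using m(1) prob_space.finite_measure[OF prob_space_return, of "0::real" borel]
        by (auto intro!: finite_measure.finite_measure_distr)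
      have "integral\<^sup>L (P n) g = (1 / C') * integral\<^sup>L (distr (m n) borel \<sigma>) g + (1 - y n / C') * integral\<^sup>L (return borel 0) g"
        unfolding P_def using C' yb[of n] fd
        by (subst integral_add_measure)
          (auto simp: integral_scale_by intro!: integrable_scale_by gi finite_measure_scale_by)
      also have "integral\<^sup>L (distr (m n) borel \<sigma>) g = (\<integral>z. \<psi> z \<partial>m n)"
      proof (subst integral_distr)
        show "(\<integral>z. g (\<sigma> z) \<partial>m n) = (\<integral>z. \<psi> z \<partial>m n)"
          by (intro Bochner_Integration.integral_cong) (simp_all add: g_def spm \<sigma>(3))
      qed simp_all
      finally show ?thesis by (simp add: integral_return)
    qed
    have "(\<lambda>n. integral\<^sup>L ((P \<circ> s0 \<circ> s1) n) g) \<longlonglongrightarrow> integral\<^sup>L R g"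
      by (rule weak_conv_imp_integral_bdd_continuous_conv[OF _ s1(2,3), where B=B])
        (use rd gc gB in \<open>auto simp: continuous_on_eq_continuous_at\<close>)
    then have "(\<lambda>n. integral\<^sup>L (P (s n)) g) \<longlonglongrightarrow> integral\<^sup>L R g" by (simp add: s_def)
    then have "(\<lambda>n. C' * (integral\<^sup>L (P (s n)) g - (1 - y (s n) / C') * g 0))
       \<longlonglongrightarrow> C' * (integral\<^sup>L R g - (1 - y0 / C') * g 0)"
      using C' by (intro tendsto_intros ys) auto
    moreover have "C' * (integral\<^sup>L (P (s n)) g - (1 - y (s n) / C') * g 0) = integral\<^sup>L (m (s n)) \<psi>" for n
      unfolding intP using C' by simp
    moreover have "integral\<^sup>L a \<psi> = C' * integral\<^sup>L R g"
      unfolding a_def using C' \<psi>m pmR by (simp add: integral_scale_by integral_distr g_def)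
    moreover have "integral\<^sup>L b \<psi> = (C' - y0) * g 0"
      unfolding b_def using y0 \<psi>m p0 spM by (simp add: integral_scale_by integral_return g_def)
    moreover have "C' * (integral\<^sup>L R g - (1 - y0 / C') * g 0) = C' * integral\<^sup>L R g - (C' - y0) * g 0"
      using C'(1) by (simp add: field_simps)
    ultimately show ?thesis by simp
  qed
  moreover have "finite_measure a" "finite_measure b"
    unfolding a_def b_def using R.finite_measure_distr[OF pmR]
      prob_space.finite_measure[OF prob_space_return, of "p 0" ?M] p0 spM
    by (simp_all add: finite_measure_scale_by)
  moreover have "sets a = sets ?M" "sets b = sets ?M" by (simp_all add: a_def b_def)
  ultimately show ?thesis using s by blast
qed

lemma narrowly_converges_subseq:
  "narrowly_converges S \<mu>s \<mu> \<Longrightarrow> strict_mono s \<Longrightarrow> narrowly_converges S (\<lambda>n. \<mu>s (s n)) \<mu>"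
  unfolding narrowly_converges_def using LIMSEQ_subseq_LIMSEQ by (fastforce simp: comp_def)

text \<open>The positive and the negative parts converge along successive subsequences. Mass may
  cancel in the limit, so the limits of the parts need not be the Jordan parts of
  \<open>\<nu>\<close>; \<open>signed_integral_decomp\<close> identifies the integral all the
  same.\<close>

lemma signed_measures_convergent_subseq:
  fixes l C :: real
  defines "Q \<equiv> {0..1::real} \<times> {0..l}"
  assumes l: "0 \<le> l"
    and \<mu>: "\<And>n::nat. signed_measure (restrict_space borel Q) (\<mu> n)"
    and C: "\<And>n. total_mass (restrict_space borel Q) (\<mu> n) \<le> C"
  shows "\<exists>s \<nu>. strict_mono (s :: nat \<Rightarrow> nat) \<and> signed_measure (restrict_space borel Q) \<nu> \<and>
     narrowly_converges Q (\<lambda>n. \<mu> (s n)) \<nu>"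
proof -
  let ?M = "restrict_space borel Q"
  have spM: "space ?M = Q" by (simp add: space_restrict_space)
  obtain p :: "real \<Rightarrow> real \<times> real"
    where "continuous_on UNIV p \<and> range p = Q \<and> p ` {0..1} = Q"
    using space_filling_curve[OF l, folded Q_def] by (rule exE)
  then have p: "continuous_on UNIV p" "p ` {0..1} = Q" "range p = Q" by simp_all
  have le: "measure (pos_part ?M (\<mu> n)) Q \<le> C" "measure (neg_part ?M (\<mu> n)) Q \<le> C" for n
    using C[of n] measure_nonneg[of "pos_part ?M (\<mu> n)" Q] measure_nonneg[of "neg_part ?M (\<mu> n)" Q]
    unfolding total_mass_eq[OF \<mu>] spM by linarith+
  obtain s1 a1 b1 where "strict_mono s1 \<and> finite_measure a1 \<and> finite_measure b1 \<and> sets a1 = sets ?M \<and>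
      sets b1 = sets ?M \<and> (\<forall>\<psi>::_ \<Rightarrow> real. continuous_on Q \<psi> \<longrightarrow> bounded (\<psi> ` Q) \<longrightarrow>
        (\<lambda>n. integral\<^sup>L (pos_part ?M (\<mu> (s1 n))) \<psi>) \<longlonglongrightarrow> integral\<^sup>L a1 \<psi> - integral\<^sup>L b1 \<psi>)"
    using finite_measures_convergent_subseq[OF p finite_measure_pos_part[OF \<mu>] sets_pos_part le(1), of "\<lambda>n. n"]
    by (elim exE) (rule that)
  then have 1: "strict_mono s1" "finite_measure a1" "finite_measure b1" "sets a1 = sets ?M" "sets b1 = sets ?M"
    "\<And>\<psi>::_ \<Rightarrow> real. continuous_on Q \<psi> \<Longrightarrow> bounded (\<psi> ` Q) \<Longrightarrow>
        (\<lambda>n. integral\<^sup>L (pos_part ?M (\<mu> (s1 n))) \<psi>) \<longlonglongrightarrow> integral\<^sup>L a1 \<psi> - integral\<^sup>L b1 \<psi>"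
    by simp_all
  obtain s2 a2 b2 where "strict_mono s2 \<and> finite_measure a2 \<and> finite_measure b2 \<and> sets a2 = sets ?M \<and>
      sets b2 = sets ?M \<and> (\<forall>\<psi>::_ \<Rightarrow> real. continuous_on Q \<psi> \<longrightarrow> bounded (\<psi> ` Q) \<longrightarrow>
        (\<lambda>n. integral\<^sup>L (neg_part ?M (\<mu> (s1 (s2 n)))) \<psi>) \<longlonglongrightarrow> integral\<^sup>L a2 \<psi> - integral\<^sup>L b2 \<psi>)"
    using finite_measures_convergent_subseq[OF p finite_measure_neg_part[OF \<mu>] sets_neg_part le(2), of "\<lambda>n. s1 n"]
    by (elim exE) (rule that)
  then have 2: "strict_mono s2" "finite_measure a2" "finite_measure b2" "sets a2 = sets ?M" "sets b2 = sets ?M"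
    "\<And>\<psi>::_ \<Rightarrow> real. continuous_on Q \<psi> \<Longrightarrow> bounded (\<psi> ` Q) \<Longrightarrow>
        (\<lambda>n. integral\<^sup>L (neg_part ?M (\<mu> (s1 (s2 n)))) \<psi>) \<longlonglongrightarrow> integral\<^sup>L a2 \<psi> - integral\<^sup>L b2 \<psi>"
    by simp_all
  define a b where "a = add_measure a1 b2" and "b = add_measure b1 a2"
  have ab: "finite_measure a" "finite_measure b" "sets a = sets ?M" "sets b = sets ?M"
    using 1 2 by (auto simp: a_def b_def intro!: finite_measure_add_measure)
  define \<nu> where "\<nu> A = measure a A - measure b A" for A
  have \<nu>: "signed_measure ?M \<nu>" unfolding \<nu>_def[abs_def] by (rule signed_measure_measure[OF ab])
  have "narrowly_converges Q (\<lambda>n. \<mu> (s1 (s2 n))) \<nu>"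
    unfolding narrowly_converges_def
  proof (intro allI impI)
    fix \<psi> :: "real \<times> real \<Rightarrow> real" assume \<psi>: "continuous_on Q \<psi>" "bounded (\<psi> ` Q)"
    then obtain B where B: "\<And>x. x \<in> Q \<Longrightarrow> \<bar>\<psi> x\<bar> \<le> B" by (auto simp: bounded_iff)
    have \<psi>m: "\<psi> \<in> borel_measurable ?M" using \<psi>(1) by (rule borel_measurable_continuous_on_restrict)
    have i: "integrable a1 \<psi>" "integrable b1 \<psi>" "integrable a2 \<psi>" "integrable b2 \<psi>"
      using 1 2 \<psi>m B spM by (auto intro!: integrable_finite_bounded[where M="?M" and c=B])
    have "(\<lambda>n. integral\<^sup>L (pos_part ?M (\<mu> (s1 (s2 n)))) \<psi> - integral\<^sup>L (neg_part ?M (\<mu> (s1 (s2 n)))) \<psi>)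
       \<longlonglongrightarrow> (integral\<^sup>L a1 \<psi> - integral\<^sup>L b1 \<psi>) - (integral\<^sup>L a2 \<psi> - integral\<^sup>L b2 \<psi>)"
      using LIMSEQ_subseq_LIMSEQ[OF 1(6)[OF \<psi>] 2(1)] 2(6)[OF \<psi>] by (intro tendsto_diff) (simp_all add: comp_def)
    also have "(integral\<^sup>L a1 \<psi> - integral\<^sup>L b1 \<psi>) - (integral\<^sup>L a2 \<psi> - integral\<^sup>L b2 \<psi>)
       = integral\<^sup>L a \<psi> - integral\<^sup>L b \<psi>"
      unfolding a_def b_def using 1 2 i by (simp add: integral_add_measure)
    also have "\<dots> = signed_integral ?M \<nu> \<psi>"
      using B spM by (intro signed_integral_decomp[OF \<nu> ab(1,3) ab(2,4) _ \<psi>m, symmetric, where c=B]) (auto simp: \<nu>_def)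
    finally show "(\<lambda>n. signed_integral ?M (\<mu> (s1 (s2 n))) \<psi>) \<longlonglongrightarrow> signed_integral ?M \<nu> \<psi>"
      unfolding signed_integral_def .
  qed
  then show ?thesis
    using strict_mono_o[OF 1(1) 2(1)] \<nu> by (intro exI[of _ "s1 \<circ> s2"] exI[of _ \<nu>]) auto
qed

lemma finite_family_convergent_subseq:
  fixes l C :: "'j \<Rightarrow> real" and \<mu> :: "nat \<Rightarrow> 'j \<Rightarrow> _"
  defines "Q \<equiv> \<lambda>j. {0..1::real} \<times> {0..l j}"
  assumes "finite J" and l: "\<And>j. 0 \<le> l j"
    and \<mu>: "\<And>n j. signed_measure (restrict_space borel (Q j)) (\<mu> n j)"
    and C: "\<And>n j. total_mass (restrict_space borel (Q j)) (\<mu> n j) \<le> C j"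
  shows "\<exists>s \<nu>. strict_mono (s :: nat \<Rightarrow> nat) \<and> (\<forall>j\<in>J. signed_measure (restrict_space borel (Q j)) (\<nu> j) \<and>
     narrowly_converges (Q j) (\<lambda>n. \<mu> (s n) j) (\<nu> j))"
  using assms(2)
proof (induction J)
  case empty
  show ?case by (intro exI[of _ id]) (auto simp: strict_mono_def)
next
  case (insert i J)
  then obtain s \<nu> where s: "strict_mono s" "\<And>j. j \<in> J \<Longrightarrow> signed_measure (restrict_space borel (Q j)) (\<nu> j)"
     "\<And>j. j \<in> J \<Longrightarrow> narrowly_converges (Q j) (\<lambda>n. \<mu> (s n) j) (\<nu> j)" by blast
  obtain s' \<nu>' where s': "strict_mono s'" "signed_measure (restrict_space borel (Q i)) \<nu>'"
     "narrowly_converges (Q i) (\<lambda>n. \<mu> (s (s' n)) i) \<nu>'"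
    using signed_measures_convergent_subseq[of "l i" "\<lambda>n. \<mu> (s n) i" "C i"] l \<mu> C unfolding Q_def by blast
  show ?case
  proof (intro exI[of _ "s \<circ> s'"] exI[of _ "\<nu>(i := \<nu>')"] conjI ballI)
    show "strict_mono (s \<circ> s')" by (rule strict_mono_o[OF s(1) s'(1)])
    fix j assume j: "j \<in> insert i J"
    show "signed_measure (restrict_space borel (Q j)) ((\<nu>(i := \<nu>')) j)"
      using j s s' by auto
    show "narrowly_converges (Q j) (\<lambda>n. \<mu> ((s \<circ> s') n) j) ((\<nu>(i := \<nu>')) j)"
      using j s' narrowly_converges_subseq[OF s(3) s'(1)] by auto
  qed
qed


section \<open>The coupled continuity equation\<close>

lemma signed_integral_cong:
  "(\<And>x. x \<in> space M \<Longrightarrow> f x = g x) \<Longrightarrow> signed_integral M \<mu> f = signed_integral M \<mu> g"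
  unfolding signed_integral_def
  by (intro arg_cong2[where f="(-)"] Bochner_Integration.integral_cong) auto

lemma has_signed_density_whole:
  assumes "has_signed_density \<theta> \<mu> g" "sets \<theta> = sets M"
  shows "\<mu> (space M) = integral\<^sup>L \<theta> g"
  using assms sets_eq_imp_space_eq[OF assms(2)]
  by (auto simp: has_signed_density_def set_integral_space[symmetric])

section \<open>A priori bounds from the action\<close>

lemma density_action_bounds:
  assumes \<rho>: "signed_measure M \<rho>" and F: "signed_measure M F" and C: "0 \<le> C"
    and le: "density_action (ref_measure M \<rho> F) \<rho> F \<le> ennreal C"
  shows "total_mass M \<rho> \<le> \<rho> (space M)" "total_mass M F \<le> C + \<rho> (space M) / 2" "0 \<le> \<rho> (space M)"
proof -
  let ?\<theta> = "ref_measure M \<rho> F"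
  let ?r = "signed_deriv ?\<theta> \<rho>" and ?s = "signed_deriv ?\<theta> F"
  note d = has_density_ref_measure[OF \<rho> F]
  have r: "integrable ?\<theta> ?r" and s: "integrable ?\<theta> ?s" using d by (auto simp: has_signed_density_def)
  note b = integral_A_fun_bounds[OF r s C le[unfolded density_action_def] zero_less_one]
  have eq: "\<rho> (space M) = integral\<^sup>L ?\<theta> ?r"
    by (rule has_signed_density_whole[OF d(1)]) simp
  \<comment> \<open>Finite action forces a nonnegative density, so the total mass of
    \<open>\<rho>\<close> is its value on the whole space.\<close>
  have "(\<integral>z. \<bar>?r z\<bar> \<partial>?\<theta>) = integral\<^sup>L ?\<theta> ?r"
    using b(1) r by (intro integral_cong_AE) auto
  then show "total_mass M \<rho> \<le> \<rho> (space M)" "0 \<le> \<rho> (space M)"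
    using total_mass_le_density[OF \<rho> sets_ref_measure d(1)] integral_nonneg_AE[OF b(1)] eq by simp_all
  show "total_mass M F \<le> C + \<rho> (space M) / 2"
    using total_mass_le_density[OF F sets_ref_measure d(2)] b(2) eq by simp
qed

lemma sets_lborel_I: "sets lborel_I = sets borel_I"
  by (rule sets_restrict_space_cong) simp

lemma space_borel_I: "space borel_I = {0..1}"
  by (simp add: space_restrict_space)

lemma finite_measure_lborel_I: "finite_measure lborel_I"
  by (rule finite_measureI) (simp add: space_restrict_space emeasure_restrict_space)

lemma vertex_action_bounds:
  assumes f: "signed_measure borel_I f" and c: "integrable lborel_I c" and C: "0 \<le> C" and \<epsilon>: "\<epsilon> > 0"
    and le: "vertex_action c f \<le> ennreal C"
  shows "0 \<le> integral\<^sup>L lborel_I c" "total_mass borel_I f \<le> C / \<epsilon> + \<epsilon> / 2 * integral\<^sup>L lborel_I c"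
proof -
  let ?s = "signed_deriv lborel_I f"
  have ex: "\<exists>g. has_signed_density lborel_I f g"
    using le by (auto simp: vertex_action_def top_unique split: if_splits)
  have d: "has_signed_density lborel_I f ?s" using ex by (rule signed_deriv_density)
  have le': "(\<integral>\<^sup>+t. A_fun (c t) (?s t) \<partial>lborel_I) \<le> ennreal C"
    using le ex by (simp add: vertex_action_def)
  have s: "integrable lborel_I ?s" using d by (simp add: has_signed_density_def)
  note b = integral_A_fun_bounds[OF c s C le' \<epsilon>]
  show "0 \<le> integral\<^sup>L lborel_I c" using b(1) by (rule integral_nonneg_AE)
  show "total_mass borel_I f \<le> C / \<epsilon> + \<epsilon> / 2 * integral\<^sup>L lborel_I c"
    using total_mass_le_density[OF f sets_lborel_I d] b(2) by simp
qed

lemma vector_derivative_unit: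
  assumes "(f has_vector_derivative f') (at t)" "t \<in> {0..1::real}"
  shows "vector_derivative f (at t within {0..1}) = f'"
  using vector_derivative_at_within_ivl[OF assms(1), of 0 1] assms(2) by auto

lemma C1_unit_const: "C1_unit (\<lambda>_. c)"
proof -
  have "vector_derivative (\<lambda>_. c) (at t within {0..1}) = 0" if "t \<in> {0..1}" for t :: real
    using that by (intro vector_derivative_unit) auto
  then show ?thesis unfolding C1_unit_def by (auto intro: continuous_on_eq[OF continuous_on_const])
qed

lemma C1_unit_ident: "C1_unit (\<lambda>t. t)"
proof -
  have "vector_derivative (\<lambda>t. t) (at t within {0..1}) = (1::real)" if "t \<in> {0..1}" for t :: real
    using that by (intro vector_derivative_unit) (auto intro: derivative_eq_intros)
  then show ?thesis unfolding C1_unit_def by (auto intro: continuous_on_eq[OF continuous_on_const])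
qed

lemma FTC_unit:
  assumes "C1_unit \<eta>"
  shows "(LINT t|lborel_I. vector_derivative \<eta> (at t within {0..1})) = \<eta> 1 - \<eta> 0"
proof -
  have "(LINT t|lborel_I. vector_derivative \<eta> (at t within {0..1}))
    = (\<integral>t. indicator {0..1} t *\<^sub>R vector_derivative \<eta> (at t within {0..1}) \<partial>lborel)"
    by (subst integral_restrict_space) auto
  also have "\<dots> = \<eta> 1 - \<eta> 0"
    using assms unfolding C1_unit_def
    by (intro integral_FTC_atLeastAtMost) (auto simp: vector_derivative_works[symmetric])
  finally show ?thesis .
qed

lemma planar_network_len: "planar_network G \<Longrightarrow> 0 < len G j"
  by (simp add: planar_network_def)

lemma space_borel_Q: "space (borel_Q G j) = Q_edge G j"
  by (simp add: space_restrict_space)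

lemma compact_Q_edge: "compact (Q_edge G j)"
  unfolding Q_edge_def by (intro compact_Times) auto

lemma dt_time: "z \<in> {0..1} \<times> X \<Longrightarrow> dt (\<lambda>(t, x). t) z = 1"
  unfolding dt_def
  by (auto simp: split_beta intro!: vector_derivative_unit derivative_eq_intros)

lemma dx_time: "0 < l \<Longrightarrow> z \<in> X \<times> {0..l} \<Longrightarrow> dx l (\<lambda>(t, x). t) z = 0"
  unfolding dx_def by (auto simp: split_beta intro!: vector_derivative_at_within_ivl)

lemma C1_network_time:
  assumes "planar_network G"
  shows "C1_network G (\<lambda>(t, x). t)"
proof -
  have "C1_rect (len G j) (\<lambda>(t, x). t)" for j
    unfolding C1_rect_def using planar_network_len[OF assms, of j]
    by (auto simp: dx_time dt_time intro!: derivative_intros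
      continuous_on_eq[OF continuous_on_const dt_time[symmetric]]
      continuous_on_eq[OF continuous_on_const dx_time[symmetric]])
  moreover have "on_edge G j (\<lambda>(t, x). t) = (\<lambda>(t, x). t)" for j
    by (simp add: on_edge_def)
  ultimately show ?thesis
    unfolding C1_network_def by (auto simp: split_beta intro!: continuous_intros)
qed

lemma
  assumes "sets r = sets (restrict_space borel (open_edge G j))"
  shows measurable_extend_zero: "(\<lambda>x. x) \<in> measurable r (restrict_space borel (closed_edge G j))"
    and space_extend_zero: "space r = open_edge G j"
proof -
  show sp: "space r = open_edge G j"
    using sets_eq_imp_space_eq[OF assms] by (simp add: space_restrict_space)
  show "(\<lambda>x. x) \<in> measurable r (restrict_space borel (closed_edge G j))"
    unfolding measurable_cong_sets[OF assms refl]
    by (intro measurable_restrict_space2 measurable_restrict_space1) (auto simp: space_restrict_space)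
qed

lemma integral_extend_zero:
  fixes h :: "real \<Rightarrow> real"
  assumes "sets r = sets (restrict_space borel (open_edge G j))"
    and "h \<in> borel_measurable (restrict_space borel (closed_edge G j))"
  shows "(LINT x|extend_zero G j r. h x) = (LINT x|r. h x)"
  unfolding extend_zero_def using assms(2) measurable_extend_zero[OF assms(1)]
  by (subst integral_distr) auto

text \<open>Testing with \<open>\<phi>(t, x) = \<eta>\<^sup>i(t) = t\<close>.\<close>

lemma CE_mass:
  assumes G: "planar_network G" and \<rho>1: "admissible G \<rho>1 \<gamma>1" and \<mu>: "\<mu> \<in> CE G \<rho>0 \<rho>1 \<gamma>0 \<gamma>1"
  shows "(\<Sum>j\<in>UNIV. rho \<mu> j (Q_edge G j)) + (\<Sum>i\<in>UNIV. LINT t|lborel_I. gam \<mu> i t) = 1"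
proof -
  have sm: "signed_measure (borel_Q G j) (rho \<mu> j)" for j using \<mu> by (simp add: CE_def)
  have ee: "edge_equation G \<rho>0 \<rho>1 (rho \<mu>) (flux \<mu>) (vflux \<mu>)"
    and ve: "vertex_equation \<gamma>0 \<gamma>1 (gam \<mu>) (vflux \<mu>)" using \<mu> by (simp_all add: CE_def)
  have oe: "on_edge G j (\<lambda>(t, x). t) = (\<lambda>(t, x). t)" for j
    by (simp add: on_edge_def)
  have 1: "signed_integral (borel_Q G j) (rho \<mu> j) (dt (\<lambda>(t, x). t)) = rho \<mu> j (Q_edge G j)" for j
  proof -
    have "signed_integral (borel_Q G j) (rho \<mu> j) (dt (\<lambda>(t, x). t)) = signed_integral (borel_Q G j) (rho \<mu> j) (\<lambda>_. 1)"
      by (rule signed_integral_cong, rule dt_time) (simp add: space_borel_Q, simp add: Q_edge_def)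
    then show ?thesis by (simp add: signed_integral_1[OF sm] space_borel_Q)
  qed
  have 2: "signed_integral (borel_Q G j) m (dx (len G j) (\<lambda>(t, x). t)) = 0" for j m
  proof -
    have "signed_integral (borel_Q G j) m (dx (len G j) (\<lambda>(t, x). t)) = signed_integral (borel_Q G j) m (\<lambda>_. 0)"
      by (rule signed_integral_cong, rule dx_time[OF planar_network_len[OF G]])
        (simp add: space_borel_Q, simp add: Q_edge_def)
    then show ?thesis by (simp add: signed_integral_def)
  qed
  have 3: "(LINT x|extend_zero G j (\<rho>1 j). (1::real)) = measure (\<rho>1 j) (open_edge G j)" for j
    using \<rho>1 integral_extend_zero[of "\<rho>1 j" G j "\<lambda>_. 1"] space_extend_zero[of "\<rho>1 j" G j]
    by (simp add: admissible_def)
  \<comment> \<open>The initial data drop out because \<open>t\<close> vanishes at 0. Adding this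
    identity and the one from the vertex equation cancels the vertex fluxes, leaving the final
    mass.\<close>
  have "(\<Sum>j\<in>UNIV. rho \<mu> j (Q_edge G j)) - (\<Sum>i\<in>UNIV. signed_integral borel_I (vflux \<mu> i) (\<lambda>t. t))
    = (\<Sum>j\<in>UNIV. measure (\<rho>1 j) (open_edge G j))"
    using ee[unfolded edge_equation_def, rule_format, OF C1_network_time[OF G]]
    unfolding oe by (simp add: 1 2 3[simplified])
  moreover have "(\<Sum>i\<in>UNIV. LINT t|lborel_I. gam \<mu> i t) =
     - (\<Sum>i\<in>UNIV. signed_integral borel_I (vflux \<mu> i) (\<lambda>t. t)) + (\<Sum>i\<in>UNIV. \<gamma>1 i)"
  proof -
    have "(LINT t|lborel_I. vector_derivative (\<lambda>t. t) (at t within {0..1}) * gam \<mu> i t) = (LINT t|lborel_I. gam \<mu> i t)" for i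
      by (intro Bochner_Integration.integral_cong refl)
        (auto simp: space_restrict_space vector_derivative_unit[OF has_vector_derivative_id[unfolded id_def]])
    then show ?thesis
      using ve[unfolded vertex_equation_def, rule_format, of "\<lambda>_ t. t"] C1_unit_ident by simp
  qed
  ultimately show ?thesis using \<rho>1 by (simp add: admissible_def)
qed

text \<open>Under finite action all edge and vertex masses are nonnegative, and by
  \<open>CE_mass\<close> they add up to 1, so each is at most 1. The factor
  \<open>\<kappa>\<^sup>2\<close> leaves only \<open>C / \<kappa>\<^sup>2\<close> for a vertex term,
  and the weight \<open>1 / \<kappa>\<close> in the Young inequality turns this into
  \<open>C / \<kappa>\<close> plus half of \<open>1 / \<kappa>\<close>.\<close>

lemma CE_action_bounds:
  fixes G :: "('v::finite, 'e::finite) network"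
  assumes G: "planar_network G" and \<rho>1: "admissible G \<rho>1 \<gamma>1" and \<mu>: "\<mu> \<in> CE G \<rho>0 \<rho>1 \<gamma>0 \<gamma>1"
    and \<kappa>: "\<kappa> > 0" and C: "0 \<le> C" and le: "action G \<kappa> \<mu> \<le> ennreal C"
  shows "total_mass (borel_Q G j) (rho \<mu> j) \<le> 1"
    and "total_mass (borel_Q G j) (flux \<mu> j) \<le> C + 1 / 2"
    and "total_mass borel_I (vflux \<mu> i) \<le> (C + 1 / 2) / \<kappa>"
proof -
  have sm: "signed_measure (borel_Q G j) (rho \<mu> j)" "signed_measure (borel_Q G j) (flux \<mu> j)" for j
    using \<mu> by (simp_all add: CE_def)
  have vm: "integrable lborel_I (gam \<mu> i)" "signed_measure borel_I (vflux \<mu> i)" for i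
    using \<mu> by (simp_all add: CE_def)
  have "density_action (ref_measure (borel_Q G j) (rho \<mu> j) (flux \<mu> j)) (rho \<mu> j) (flux \<mu> j) \<le> ennreal C" for j
  proof -
    have "density_action (ref_measure (borel_Q G j) (rho \<mu> j) (flux \<mu> j)) (rho \<mu> j) (flux \<mu> j)
      \<le> edge_action G (rho \<mu>) (flux \<mu>)"
      unfolding edge_action_def by (rule member_le_sum) auto
    also have "\<dots> \<le> action G \<kappa> \<mu>" by (simp add: action_def)
    finally show ?thesis using le by simp
  qed
  note eb = density_action_bounds[OF sm C this, unfolded space_borel_Q]
  have "vertex_action (gam \<mu> i) (vflux \<mu> i) \<le> ennreal (C / \<kappa>\<^sup>2)" for i
  proof -
    have "ennreal (\<kappa>\<^sup>2) * vertex_action (gam \<mu> i) (vflux \<mu> i)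
      \<le> ennreal (\<kappa>\<^sup>2) * (\<Sum>i\<in>UNIV. vertex_action (gam \<mu> i) (vflux \<mu> i))"
      by (intro mult_left_mono member_le_sum) auto
    also have "\<dots> \<le> action G \<kappa> \<mu>" by (simp add: action_def)
    finally have le': "ennreal (\<kappa>\<^sup>2) * vertex_action (gam \<mu> i) (vflux \<mu> i) \<le> ennreal C" using le by simp
    show ?thesis
    proof (cases "vertex_action (gam \<mu> i) (vflux \<mu> i)")
      case (real v)
      then have "\<kappa>\<^sup>2 * v \<le> C" using le' C by (simp add: ennreal_mult[symmetric])
      then show ?thesis using real \<kappa> by (auto simp: field_simps intro!: ennreal_leI)
    next
      case top
      then show ?thesis using le' \<kappa> by (simp add: ennreal_mult_top top_unique)
    qed
  qed
  note vb = vertex_action_bounds[OF vm(2,1) _ _ this]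
  have C2: "0 \<le> C / \<kappa>\<^sup>2" using C by simp
  have g0: "0 \<le> (LINT t|lborel_I. gam \<mu> i t)" for i using vb(1)[OF C2 zero_less_one] .
  have r1: "rho \<mu> j (Q_edge G j) \<le> 1" for j
  proof -
    have "rho \<mu> j (Q_edge G j) \<le> (\<Sum>j\<in>UNIV. rho \<mu> j (Q_edge G j))"
      by (rule member_le_sum) (use eb(3) in auto)
    also have "\<dots> \<le> 1" using CE_mass[OF G \<rho>1 \<mu>] sum_nonneg[of UNIV "\<lambda>i. LINT t|lborel_I. gam \<mu> i t"] g0 by simp
    finally show ?thesis .
  qed
  have g1: "(LINT t|lborel_I. gam \<mu> i t) \<le> 1" for i
  proof -
    have "(LINT t|lborel_I. gam \<mu> i t) \<le> (\<Sum>i\<in>UNIV. LINT t|lborel_I. gam \<mu> i t)"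
      by (rule member_le_sum) (use g0 in auto)
    also have "\<dots> \<le> 1" using CE_mass[OF G \<rho>1 \<mu>] sum_nonneg[of UNIV "\<lambda>j. rho \<mu> j (Q_edge G j)"] eb(3) by simp
    finally show ?thesis .
  qed
  show "total_mass (borel_Q G j) (rho \<mu> j) \<le> 1" using eb(1)[of j] r1[of j] by linarith
  show "total_mass (borel_Q G j) (flux \<mu> j) \<le> C + 1 / 2" using eb(2)[of j] r1[of j] by linarith
  have "total_mass borel_I (vflux \<mu> i) \<le> (C / \<kappa>\<^sup>2) / (1 / \<kappa>) + (1 / \<kappa>) / 2 * (LINT t|lborel_I. gam \<mu> i t)"
    using \<kappa> by (intro vb(2) C2) simp
  also have "\<dots> \<le> (C / \<kappa>\<^sup>2) / (1 / \<kappa>) + (1 / \<kappa>) / 2 * 1"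
    using \<kappa> g1[of i] by (intro add_left_mono mult_left_mono) auto
  also have "\<dots> = (C + 1 / 2) / \<kappa>" using \<kappa> by (simp add: field_simps power2_eq_square)
  finally show "total_mass borel_I (vflux \<mu> i) \<le> (C + 1 / 2) / \<kappa>" .
qed

text \<open>A test function that is constantly 1 at the vertex \<open>i\<close> and 0 at the others
  has no time derivative, which removes \<open>\<gamma>\<close> and leaves the mass balance of that
  vertex.\<close>

lemma vflux_total:
  fixes \<gamma>0 \<gamma>1 :: "'v::finite \<Rightarrow> real"
  assumes ve: "vertex_equation \<gamma>0 \<gamma>1 c f" and f: "signed_measure borel_I (f i)"
  shows "\<bar>\<gamma>1 i - \<gamma>0 i\<bar> \<le> total_mass borel_I (f i)"
proof -
  define \<eta> :: "'v \<Rightarrow> real \<Rightarrow> real" where "\<eta> k = (\<lambda>_. if k = i then 1 else 0)" for k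
  have "C1_unit (\<eta> k)" for k unfolding \<eta>_def by (rule C1_unit_const)
  then have "(\<Sum>k\<in>UNIV. LINT t|lborel_I. vector_derivative (\<eta> k) (at t within {0..1}) * c k t)
        = - (\<Sum>k\<in>UNIV. signed_integral borel_I (f k) (\<eta> k))
          + (\<Sum>k\<in>UNIV. \<eta> k 1 * \<gamma>1 k - \<eta> k 0 * \<gamma>0 k)"
    using ve unfolding vertex_equation_def by blast
  moreover have "(LINT t|lborel_I. vector_derivative (\<eta> k) (at t within {0..1}) * c k t) = 0" for k
  proof -
    have "(LINT t|lborel_I. vector_derivative (\<eta> k) (at t within {0..1}) * c k t) = (LINT t|lborel_I. 0)"
    proof (intro Bochner_Integration.integral_cong refl)
      fix t :: real assume "t \<in> space lborel_I"
      then have "vector_derivative (\<eta> k) (at t within {0..1}) = 0"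
        unfolding \<eta>_def by (intro vector_derivative_unit) (auto simp: space_restrict_space)
      then show "vector_derivative (\<eta> k) (at t within {0..1}) * c k t = 0" by simp
    qed
    then show ?thesis by simp
  qed
  moreover have "(\<Sum>k\<in>UNIV. \<eta> k 1 * \<gamma>1 k - \<eta> k 0 * \<gamma>0 k) = \<gamma>1 i - \<gamma>0 i"
  proof -
    have "(\<Sum>k\<in>UNIV. \<eta> k 1 * \<gamma>1 k - \<eta> k 0 * \<gamma>0 k) = (\<Sum>k\<in>UNIV. if k = i then \<gamma>1 i - \<gamma>0 i else 0)"
      by (intro sum.cong) (auto simp: \<eta>_def)
    then show ?thesis by simp
  qed
  moreover have "(\<Sum>k\<in>UNIV. signed_integral borel_I (f k) (\<eta> k)) = signed_integral borel_I (f i) (\<lambda>_. 1)"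
  proof -
    have "(\<Sum>k\<in>UNIV. signed_integral borel_I (f k) (\<eta> k))
       = (\<Sum>k\<in>UNIV. if k = i then signed_integral borel_I (f i) (\<lambda>_. 1) else 0)"
      by (intro sum.cong) (auto simp: \<eta>_def signed_integral_def)
    then show ?thesis by simp
  qed
  ultimately have "\<gamma>1 i - \<gamma>0 i = signed_integral borel_I (f i) (\<lambda>_. 1)" by simp
  then show ?thesis using abs_signed_integral_le[OF f, of "\<lambda>_. 1" 1] by simp
qed

section \<open>Compactness of curves of bounded action\<close>

lemma sum_liminf_le:
  fixes d :: "nat \<Rightarrow> 'j::finite \<Rightarrow> ennreal"
  shows "(\<Sum>j\<in>UNIV. liminf (\<lambda>n. d n j)) \<le> liminf (\<lambda>n. \<Sum>j\<in>UNIV. d n j)"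
  using nn_integral_liminf[of d "count_space UNIV"] by (simp add: nn_integral_count_space_finite)

text \<open>The bound \<open>C\<close> is inherited by the limit. With \<open>C\<close> below the
  limit cost this refutes a smaller lower limit of the costs; with \<open>C\<close> equal to it, the
  limit of the geodesics is a minimizer.\<close>

lemma CE_limit:
  fixes G :: "('v::finite, 'e::finite) network"
  assumes G: "planar_network G" and \<rho>1: "admissible G \<rho>1 \<gamma>1"
    and \<mu>: "\<And>n::nat. \<mu> n \<in> CE G \<rho>0 \<rho>1 \<gamma>0 \<gamma>1"
    and K: "\<And>n. K n > 0" "filterlim K at_top sequentially"
    and C: "0 \<le> C" and le: "\<And>n. action G (K n) (\<mu> n) \<le> ennreal C"
  shows "\<exists>s \<rho> F. strict_mono (s :: nat \<Rightarrow> nat) \<and> (\<rho>, F) \<in> CE_edge G \<rho>0 \<rho>1 \<and> edge_action G \<rho> F \<le> ennreal C \<and>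
     (\<forall>j. narrowly_converges (Q_edge G j) (\<lambda>n. rho (\<mu> (s n)) j) (\<rho> j) \<and>
          narrowly_converges (Q_edge G j) (\<lambda>n. flux (\<mu> (s n)) j) (F j))"
proof -
  note b = CE_action_bounds[OF G \<rho>1 \<mu> K(1) C le]
  have len: "0 \<le> len G j" for j using planar_network_len[OF G, of j] by simp
  have sm: "signed_measure (borel_Q G j) (rho (\<mu> n) j)" "signed_measure (borel_Q G j) (flux (\<mu> n) j)" for j n
    using \<mu>[of n] by (simp_all add: CE_def)
  obtain s1 \<rho> where s1: "strict_mono s1" and \<rho>0: "\<forall>j\<in>UNIV. signed_measure (borel_Q G j) (\<rho> j) \<and>
     narrowly_converges (Q_edge G j) (\<lambda>n. rho (\<mu> (s1 n)) j) (\<rho> j)"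
    using finite_family_convergent_subseq[of UNIV "len G" "\<lambda>n j. rho (\<mu> n) j" "\<lambda>_. 1"] sm b(1) len
    unfolding Q_edge_def by auto
  obtain s2 F where s2: "strict_mono s2" and F0: "\<forall>j\<in>UNIV. signed_measure (borel_Q G j) (F j) \<and>
     narrowly_converges (Q_edge G j) (\<lambda>n. flux (\<mu> (s1 (s2 n))) j) (F j)"
    using finite_family_convergent_subseq[of UNIV "len G" "\<lambda>n j. flux (\<mu> (s1 n)) j" "\<lambda>_. C + 1/2"] sm b(2) len
    unfolding Q_edge_def by auto
  define s where "s = s1 \<circ> s2"
  have s: "strict_mono s" unfolding s_def by (rule strict_mono_o[OF s1 s2])
  have \<rho>: "signed_measure (borel_Q G j) (\<rho> j)" "narrowly_converges (Q_edge G j) (\<lambda>n. rho (\<mu> (s n)) j) (\<rho> j)" for j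
    using \<rho>0 narrowly_converges_subseq[OF _ s2, of "Q_edge G j" "\<lambda>n. rho (\<mu> (s1 n)) j" "\<rho> j"] by (auto simp: s_def)
  have F: "signed_measure (borel_Q G j) (F j)" "narrowly_converges (Q_edge G j) (\<lambda>n. flux (\<mu> (s n)) j) (F j)" for j
    using F0 by (auto simp: s_def)
  have Ks: "filterlim (\<lambda>n. K (s n)) at_top sequentially"
    using filterlim_compose[OF K(2) filterlim_subseq[OF s]] .
  have "edge_equation G \<rho>0 \<rho>1 \<rho> F (\<lambda>i B. 0)"
    unfolding edge_equation_def
  proof (intro allI impI)
    fix \<phi> assume \<phi>: "C1_network G \<phi>"
    let ?dt = "\<lambda>j. dt (on_edge G j \<phi>)" and ?dx = "\<lambda>j. dx (len G j) (on_edge G j \<phi>)"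
    let ?R = "(\<Sum>j\<in>UNIV. (LINT x|extend_zero G j (\<rho>1 j). on_edge G j \<phi> (1, x))
                   - (LINT x|extend_zero G j (\<rho>0 j). on_edge G j \<phi> (0, x)))"
    have eq: "(\<Sum>j\<in>UNIV. signed_integral (borel_Q G j) (rho (\<mu> n) j) (?dt j) + signed_integral (borel_Q G j) (flux (\<mu> n) j) (?dx j))
        - (\<Sum>i\<in>UNIV. signed_integral borel_I (vflux (\<mu> n) i) (\<lambda>t. \<phi> (t, vtx G i))) = ?R" for n
      using \<mu>[of n] \<phi> by (simp add: CE_def edge_equation_def)
    have c: "continuous_on (Q_edge G j) (?dt j)" "continuous_on (Q_edge G j) (?dx j)" for j
      using \<phi> by (simp_all add: C1_network_def C1_rect_def Q_edge_def)
    have bd: "bounded (?dt j ` Q_edge G j)" "bounded (?dx j ` Q_edge G j)" for j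
      using c compact_Q_edge by (auto intro!: compact_imp_bounded compact_continuous_image)
    have 1: "(\<lambda>n. signed_integral (borel_Q G j) (rho (\<mu> (s n)) j) (?dt j)) \<longlonglongrightarrow> signed_integral (borel_Q G j) (\<rho> j) (?dt j)" for j
      using \<rho>(2)[of j] c(1) bd(1) unfolding narrowly_converges_def by blast
    have 2: "(\<lambda>n. signed_integral (borel_Q G j) (flux (\<mu> (s n)) j) (?dx j)) \<longlonglongrightarrow> signed_integral (borel_Q G j) (F j) (?dx j)" for j
      using F(2)[of j] c(2) bd(2) unfolding narrowly_converges_def by blast
    \<comment> \<open>The test function is bounded at the vertex and the flux has total mass of
      order \<open>1 / K (s n)\<close>: here the vertex sources disappear and Kirchhoff's law
      emerges.\<close>
    have 3: "(\<lambda>n. signed_integral borel_I (vflux (\<mu> (s n)) i) (\<lambda>t. \<phi> (t, vtx G i))) \<longlonglongrightarrow> 0" for i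
    proof -
      have "continuous_on ({0..1} \<times> Omega G) \<phi>" using \<phi> by (simp add: C1_network_def)
      then have hc: "continuous_on {0..1} (\<lambda>t. \<phi> (t, vtx G i))"
        by (rule continuous_on_compose2) (auto intro!: continuous_intros simp: Omega_def)
      then have "bounded ((\<lambda>t. \<phi> (t, vtx G i)) ` {0..1})"
        by (intro compact_imp_bounded compact_continuous_image) auto
      then obtain B where B: "\<And>t. t \<in> {0..1} \<Longrightarrow> \<bar>\<phi> (t, vtx G i)\<bar> \<le> B" "B > 0"
        unfolding bounded_pos by (metis imageI real_norm_def)
      have hm: "(\<lambda>t. \<phi> (t, vtx G i)) \<in> borel_measurable borel_I"
        using hc by (rule borel_measurable_continuous_on_restrict)
      have vm: "signed_measure borel_I (vflux (\<mu> n) i)" for n using \<mu>[of n] by (simp add: CE_def)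
      show ?thesis
      proof (rule Lim_null_comparison)
        show "\<forall>\<^sub>F n in sequentially. norm (signed_integral borel_I (vflux (\<mu> (s n)) i) (\<lambda>t. \<phi> (t, vtx G i)))
          \<le> B * ((C + 1/2) / K (s n))"
        proof (intro always_eventually allI)
          fix n
          have "\<bar>signed_integral borel_I (vflux (\<mu> (s n)) i) (\<lambda>t. \<phi> (t, vtx G i))\<bar> \<le> B * total_mass borel_I (vflux (\<mu> (s n)) i)"
            using B by (intro abs_signed_integral_le[OF vm hm]) (auto simp: space_borel_I)
          also have "\<dots> \<le> B * ((C + 1/2) / K (s n))" using B(2) by (intro mult_left_mono b(3)) simp
          finally show "norm (signed_integral borel_I (vflux (\<mu> (s n)) i) (\<lambda>t. \<phi> (t, vtx G i)))
            \<le> B * ((C + 1/2) / K (s n))" by simp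
        qed
        have "(\<lambda>n. B * ((C + 1/2) / K (s n))) \<longlonglongrightarrow> B * 0"
          by (intro tendsto_mult tendsto_const tendsto_divide_0[OF tendsto_const]
            filterlim_at_top_imp_at_infinity Ks)
        then show "(\<lambda>n. B * ((C + 1/2) / K (s n))) \<longlonglongrightarrow> 0" by simp
      qed
    qed
    have "(\<lambda>n. (\<Sum>j\<in>UNIV. signed_integral (borel_Q G j) (rho (\<mu> (s n)) j) (?dt j) + signed_integral (borel_Q G j) (flux (\<mu> (s n)) j) (?dx j))
        - (\<Sum>i\<in>UNIV. signed_integral borel_I (vflux (\<mu> (s n)) i) (\<lambda>t. \<phi> (t, vtx G i))))
     \<longlonglongrightarrow> (\<Sum>j\<in>UNIV. signed_integral (borel_Q G j) (\<rho> j) (?dt j) + signed_integral (borel_Q G j) (F j) (?dx j))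
        - (\<Sum>i\<in>(UNIV::'v set). 0)"
      by (intro tendsto_diff tendsto_sum tendsto_add 1 2 3)
    then have "(\<Sum>j\<in>UNIV. signed_integral (borel_Q G j) (\<rho> j) (?dt j) + signed_integral (borel_Q G j) (F j) (?dx j))
        - (\<Sum>i\<in>(UNIV::'v set). 0) = ?R"
      unfolding eq by (rule LIMSEQ_unique[OF _ tendsto_const, symmetric, THEN sym])
    then show "(\<Sum>j\<in>UNIV. signed_integral (borel_Q G j) (\<rho> j) (?dt j) + signed_integral (borel_Q G j) (F j) (?dx j))
        - (\<Sum>i\<in>UNIV. signed_integral borel_I (\<lambda>B. 0) (\<lambda>t. \<phi> (t, vtx G i))) = ?R"
      by (simp add: signed_integral_zero_measure)
  qed
  then have ce: "(\<rho>, F) \<in> CE_edge G \<rho>0 \<rho>1" using \<rho> F by (simp add: CE_edge_def)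
  have Qm: "Q_edge G j \<in> sets borel" for j by (intro borel_closed compact_imp_closed compact_Q_edge)
  have "edge_action G \<rho> F \<le> (\<Sum>j\<in>UNIV. liminf (\<lambda>n. density_action
     (ref_measure (borel_Q G j) (rho (\<mu> (s n)) j) (flux (\<mu> (s n)) j)) (rho (\<mu> (s n)) j) (flux (\<mu> (s n)) j)))"
    unfolding edge_action_def
    by (intro sum_mono density_action_lsc[OF Qm] sm \<rho> F)
  also have "\<dots> \<le> liminf (\<lambda>n. edge_action G (rho (\<mu> (s n))) (flux (\<mu> (s n))))"
    unfolding edge_action_def by (rule sum_liminf_le)
  also have "\<dots> \<le> liminf (\<lambda>n::nat. ennreal C)"
  proof (intro Liminf_mono always_eventually allI)
    fix n
    \<comment> \<open>The vertex part of the action is nonnegative and is dropped; only the edge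
      part is passed to the limit.\<close>
    have "edge_action G (rho (\<mu> (s n))) (flux (\<mu> (s n))) \<le> action G (K (s n)) (\<mu> (s n))" by (simp add: action_def)
    then show "edge_action G (rho (\<mu> (s n))) (flux (\<mu> (s n))) \<le> ennreal C" using le by (rule order_trans)
  qed
  also have "\<dots> = ennreal C" by (simp add: Liminf_const)
  finally show ?thesis using s ce \<rho>(2) F(2) by blast
qed

text \<open>Freezing the vertex masses costs nothing, whatever \<open>\<kappa>\<close> is, since
  \<open>A_fun\<close> vanishes at zero flux even where \<open>\<gamma> i = 0\<close>. This yields
  the upper bound for the costs.\<close>

lemma CE_edge_imp_CE:
  fixes G :: "('v::finite, 'e::finite) network"
  assumes p: "(\<rho>, F) \<in> CE_edge G \<rho>0 \<rho>1" and \<gamma>: "\<And>i. 0 \<le> \<gamma> i"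
  defines "\<mu> \<equiv> \<lparr>rho = \<rho>, flux = F, gam = (\<lambda>i t. \<gamma> i), vflux = (\<lambda>i B. 0)\<rparr>"
  shows "\<mu> \<in> CE G \<rho>0 \<rho>1 \<gamma> \<gamma>" "action G \<kappa> \<mu> = edge_action G \<rho> F"
proof -
  have "vertex_equation \<gamma> \<gamma> (\<lambda>i t. \<gamma> i) (\<lambda>i B. 0)"
    unfolding vertex_equation_def
    by (simp add: signed_integral_zero_measure FTC_unit left_diff_distrib)
  moreover have "integrable lborel_I (\<lambda>t. \<gamma> i)" for i
    by (rule finite_measure.integrable_const[OF finite_measure_lborel_I])
  ultimately show "\<mu> \<in> CE G \<rho>0 \<rho>1 \<gamma> \<gamma>"
    using p by (simp add: CE_def CE_edge_def \<mu>_def signed_measure_zero)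
  have ex: "\<exists>g. has_signed_density lborel_I (\<lambda>B. 0) g"
    by (rule exI[of _ "\<lambda>_. 0"]) (simp add: has_signed_density_def set_lebesgue_integral_def)
  have "vertex_action (\<lambda>t. \<gamma> i) (\<lambda>B. 0) = 0" for i
  proof -
    let ?s = "signed_deriv lborel_I (\<lambda>B. 0)"
    have d: "has_signed_density lborel_I (\<lambda>B. 0) ?s" using ex by (rule signed_deriv_density)
    then have s: "integrable lborel_I ?s" and z: "\<And>B. B \<in> sets lborel_I \<Longrightarrow> (LINT x:B|lborel_I. ?s x) = 0"
      by (auto simp: has_signed_density_def)
    \<comment> \<open>\<open>signed_deriv\<close> is an arbitrary choice of density, so it is known
      to vanish only almost everywhere.\<close>
    have "AE t in lborel_I. ?s t = 0"
    proof -
      have "AE t in lborel_I. ?s t = (\<lambda>_. 0) t"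
        by (rule density_unique_real[OF s]) (use z in \<open>simp_all add: set_lebesgue_integral_def\<close>)
      then show ?thesis by simp
    qed
    then have "(\<integral>\<^sup>+t. A_fun (\<gamma> i) (?s t) \<partial>lborel_I) = (\<integral>\<^sup>+t. 0 \<partial>lborel_I)"
      using \<gamma>[of i] by (intro nn_integral_cong_AE) (auto simp: A_fun_def)
    then show ?thesis using ex by (simp add: vertex_action_def)
  qed
  then show "action G \<kappa> \<mu> = edge_action G \<rho> F" by (simp add: action_def \<mu>_def)
qed

lemma W_sq_le_W_edge_sq:
  fixes G :: "('v::finite, 'e::finite) network"
  assumes "\<And>i. 0 \<le> \<gamma> i"
  shows "W_sq G \<kappa> \<rho>0 \<rho>1 \<gamma> \<gamma> \<le> W_edge_sq G \<rho>0 \<rho>1"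
  unfolding W_edge_sq_def
proof (rule INF_greatest, clarify)
  fix \<rho> F assume "(\<rho>, F) \<in> CE_edge G \<rho>0 \<rho>1"
  note ce = CE_edge_imp_CE[OF this assms]
  show "W_sq G \<kappa> \<rho>0 \<rho>1 \<gamma> \<gamma> \<le> edge_action G \<rho> F"
    using INF_lower[OF ce(1), of "action G \<kappa>"] ce(2) by (simp add: W_sq_def)
qed


section \<open>Transport inside the edges\<close>

text \<open>\<open>C1_rect\<close> speaks of partial derivatives only; their continuity gives the
  total derivative that the chain rule along a slanted segment requires.\<close>

lemma C1_rect_has_derivative:
  assumes g: "C1_rect l g" and t: "t \<in> {0..1}" and x: "x \<in> {0..l}"
  shows "(g has_derivative (\<lambda>(h, k). h * dt g (t, x) + k * dx l g (t, x))) (at (t, x) within {0..1} \<times> {0..l})"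
proof -
  have pt: "((\<lambda>s. g (s, y)) has_vector_derivative dt g (s, y)) (at s within {0..1})"
    and px: "((\<lambda>y. g (s, y)) has_vector_derivative dx l g (s, y)) (at y within {0..l})"
    if "s \<in> {0..1}" "y \<in> {0..l}" for s y
    using g that by (auto simp: C1_rect_def dt_def dx_def vector_derivative_works[symmetric])
  have "((\<lambda>(s, y). g (s, y)) has_derivative
     (\<lambda>(h, k). h *\<^sub>R dt g (t, x) + blinfun_apply (dx l g (t, x) *\<^sub>R id_blinfun) k)) (at (t, x) within {0..1} \<times> {0..l})"
  proof (rule has_derivative_partialsI)
    show "((\<lambda>s. g (s, x)) has_derivative (\<lambda>h. h *\<^sub>R dt g (t, x))) (at t within {0..1})"
      using pt[OF t x] by (simp add: has_vector_derivative_def)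
    show "((\<lambda>y. g (s, y)) has_derivative blinfun_apply (dx l g (s, y) *\<^sub>R id_blinfun)) (at y within {0..l})"
      if "s \<in> {0..1}" "y \<in> {0..l}" for s y
      using px[OF that] unfolding has_vector_derivative_def
      by (rule has_derivative_eq_rhs) (auto simp: scaleR_blinfun.rep_eq)
    have "continuous_on ({0..1} \<times> {0..l}) (\<lambda>z. dx l g z *\<^sub>R (id_blinfun :: real \<Rightarrow>\<^sub>L real))"
      using g by (intro continuous_intros) (simp add: C1_rect_def)
    then show "continuous (at (t, x) within {0..1} \<times> {0..l}) (\<lambda>(s, y). dx l g (s, y) *\<^sub>R (id_blinfun :: real \<Rightarrow>\<^sub>L real))"
      using t x unfolding continuous_on_eq_continuous_within split_beta prod.collapse by blast
  qed (use x in auto)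
  then show ?thesis
    by (simp add: split_beta scaleR_blinfun.rep_eq mult.commute)
qed

lemma C1_rect_continuous_on: "C1_rect l g \<Longrightarrow> continuous_on ({0..1} \<times> {0..l}) g"
  unfolding continuous_on_eq_continuous_within
proof
  fix z :: "real \<times> real" assume "C1_rect l g" "z \<in> {0..1} \<times> {0..l}"
  then show "continuous (at z within {0..1} \<times> {0..l}) g"
    using has_derivative_continuous[OF C1_rect_has_derivative[of l g "fst z" "snd z"]] by auto
qed

lemma segment_mem:
  fixes x y l t :: real
  assumes "t \<in> {0..1}" "x \<in> {0..l}" "y \<in> {0..l}"
  shows "(1 - t) * x + t * y \<in> {0..l}"
proof -
  have "(1 - t) *\<^sub>R x + t *\<^sub>R y \<in> {0..l}"
    using assms by (intro convexD_alt[OF convex_real_interval(5)]) auto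
  then show ?thesis by simp
qed

text \<open>The fundamental theorem of calculus along a path in space-time with velocity
  \<open>(1, y - x)\<close>: a single particle moving from \<open>x\<close> to \<open>y\<close>
  already satisfies the weak continuity equation.\<close>

lemma C1_rect_along_segment:
  assumes g: "C1_rect l g" and x: "x \<in> {0..l}" and y: "y \<in> {0..l}"
  shows "(LINT t|lborel_I. dt g (t, (1 - t) * x + t * y) + (y - x) * dx l g (t, (1 - t) * x + t * y))
    = g (1, y) - g (0, x)"
proof -
  let ?p = "\<lambda>t. (t, (1 - t) * x + t * y)"
  let ?u' = "\<lambda>t. dt g (?p t) + (y - x) * dx l g (?p t)"
  have sub: "?p ` {0..1} \<subseteq> {0..1} \<times> {0..l}" using segment_mem[OF _ x y] by auto
  have "((\<lambda>t. g (?p t)) has_vector_derivative ?u' t) (at t within {0..1})" if t: "t \<in> {0..1}" for t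
  proof -
    have p: "(?p has_derivative (\<lambda>h. (h, h * (y - x)))) (at t within {0..1})"
      by (auto intro!: derivative_eq_intros simp: algebra_simps)
    have "(g has_derivative (\<lambda>(h, k). h * dt g (?p t) + k * dx l g (?p t))) (at (?p t) within ?p ` {0..1})"
      by (rule has_derivative_subset[OF C1_rect_has_derivative[OF g t segment_mem[OF t x y]] sub])
    from has_derivative_in_compose[OF p this] show ?thesis
      by (simp add: has_vector_derivative_def algebra_simps)
  qed
  moreover have "continuous_on {0..1} ?u'"
  proof -
    have "continuous_on ({0..1} \<times> {0..l}) (dt g)" "continuous_on ({0..1} \<times> {0..l}) (dx l g)"
      using g by (simp_all add: C1_rect_def)
    then show ?thesis
      using sub by (intro continuous_on_add continuous_on_mult continuous_on_const
        continuous_on_compose2[of _ "dt g" _ ?p] continuous_on_compose2[of _ "dx l g" _ ?p])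
        (auto intro!: continuous_intros)
  qed
  ultimately have "(\<integral>t. indicator {0..1} t *\<^sub>R ?u' t \<partial>lborel) = g (?p 1) - g (?p 0)"
    by (intro integral_FTC_atLeastAtMost) auto
  moreover have "(LINT t|lborel_I. ?u' t) = (\<integral>t. indicator {0..1} t *\<^sub>R ?u' t \<partial>lborel)"
    by (subst integral_restrict_space) auto
  ultimately show ?thesis by simp
qed

text \<open>Two measures on an edge with the same mass are joined by moving mass along straight lines,
  according to the product coupling (the factor \<open>1 / measure r0 (space r0)\<close> normalizes it and is
  \<open>0\<close> for the zero measure).\<close>

lemma edge_transport:
  fixes r0 r1 :: "real measure" and l :: real
  defines "M \<equiv> restrict_space borel ({0..1::real} \<times> {0..l})"
  assumes l: "0 < l" and fin: "finite_measure r0" "finite_measure r1"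
    and sets0: "sets r0 = sets (restrict_space borel {0<..<l})" and sets1: "sets r1 = sets (restrict_space borel {0<..<l})"
    and mass: "measure r0 {0<..<l} = measure r1 {0<..<l}"
  shows "\<exists>\<rho> F. signed_measure M \<rho> \<and> signed_measure M F \<and> density_action (ref_measure M \<rho> F) \<rho> F < \<infinity> \<and>
    (\<forall>g. C1_rect l g \<longrightarrow> signed_integral M \<rho> (dt g) + signed_integral M F (dx l g) =
      (LINT x|r1. g (1, x)) - (LINT x|r0. g (0, x)))"
proof -
  let ?Q = "{0..1::real} \<times> {0..l}"
  interpret r0: finite_measure r0 by fact
  interpret r1: finite_measure r1 by fact
  interpret I: finite_measure lborel_I by (rule finite_measure_lborel_I)
  interpret r01: pair_sigma_finite r0 r1 ..
  interpret P: finite_measure "r0 \<Otimes>\<^sub>M r1" by (rule finite_measure_pair_measure[OF fin(2,1)])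
  interpret PI: pair_sigma_finite "r0 \<Otimes>\<^sub>M r1" lborel_I ..
  define N where "N = (r0 \<Otimes>\<^sub>M r1) \<Otimes>\<^sub>M lborel_I"
  interpret N: finite_measure N
    unfolding N_def by (rule finite_measure_pair_measure[OF I.finite_measure_axioms P.finite_measure_axioms])
  have sp: "space r0 = {0<..<l}" "space r1 = {0<..<l}" "space M = ?Q"
    using sets_eq_imp_space_eq[OF sets0] sets_eq_imp_space_eq[OF sets1] by (simp_all add: space_restrict_space M_def)
  have spN: "space N = ({0<..<l} \<times> {0<..<l}) \<times> {0..1}"
    by (simp add: N_def space_pair_measure sp space_restrict_space)
  define m w where "m = measure r0 {0<..<l}" and "w = 1 / m"
  have w0: "0 \<le> w" by (simp add: w_def m_def)
  have idm[measurable]: "(\<lambda>x. x) \<in> borel_measurable r0" "(\<lambda>x. x) \<in> borel_measurable r1" "(\<lambda>t. t) \<in> borel_measurable lborel_I"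
    unfolding measurable_cong_sets[OF sets0 refl] measurable_cong_sets[OF sets1 refl] measurable_cong_sets[OF sets_lborel_I refl]
    by (auto intro: measurable_restrict_space1)
  have X[measurable]: "(\<lambda>z. fst (fst z)) \<in> borel_measurable N" and Y[measurable]: "(\<lambda>z. snd (fst z)) \<in> borel_measurable N"
    and S[measurable]: "snd \<in> borel_measurable N"
    unfolding N_def
    by (rule measurable_compose[OF _ idm(1)] measurable_compose[OF _ idm(2)] measurable_compose[OF _ idm(3)]; measurable)+
  \<comment> \<open>A point \<open>z = ((x, y), t)\<close> stands for the particle going from
    \<open>x\<close> to \<open>y\<close>, observed at time \<open>t\<close>: \<open>T z\<close> is
    its place in space-time, \<open>D z\<close> its velocity. The density is the normalized image of
    \<open>N\<close> under \<open>T\<close>, and the flux is the image of \<open>D\<close> times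
    \<open>N\<close>, split by direction into \<open>a\<close> and \<open>b\<close>.\<close>
  define T where "T z = (snd z, (1 - snd z) * fst (fst z) + snd z * snd (fst z))" for z :: "(real \<times> real) \<times> real"
  define D where "D z = snd (fst z) - fst (fst z)" for z :: "(real \<times> real) \<times> real"
  have TQ: "T z \<in> ?Q" if "z \<in> space N" for z
    using that segment_mem[of "snd z" "fst (fst z)" l "snd (fst z)"] by (auto simp: T_def spN)
  have Dl: "\<bar>D z\<bar> \<le> l" if "z \<in> space N" for z
    using that by (auto simp: D_def spN)
  have Tm[measurable]: "T \<in> measurable N M"
    unfolding M_def T_def[abs_def]
    by (rule measurable_restrict_space2) (use TQ in \<open>auto simp: T_def borel_prod[symmetric] simp del: borel_prod\<close>)
  have Dm[measurable]: "D \<in> borel_measurable N" unfolding D_def[abs_def] by measurable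
  have intN: "integrable N h" if "h \<in> borel_measurable N" "\<And>z. z \<in> space N \<Longrightarrow> \<bar>h z\<bar> \<le> c" for h :: "_ \<Rightarrow> real" and c
    by (rule integrable_finite_bounded[OF N.finite_measure_axioms refl that])
  define Dp Dn where "Dp z = max 0 (D z)" and "Dn z = max 0 (- D z)" for z
  have [measurable]: "Dp \<in> borel_measurable N" "Dn \<in> borel_measurable N"
    unfolding Dp_def[abs_def] Dn_def[abs_def] by measurable
  have Dpn: "0 \<le> Dp z" "0 \<le> Dn z" "D z = Dp z - Dn z" for z by (auto simp: Dp_def Dn_def)
  have Dpi: "integrable N Dp" "integrable N Dn"
    using Dl l by (auto intro!: intN[where c=l] simp: Dp_def Dn_def abs_le_iff)
  \<comment> \<open>The null measure presents the nonnegative \<open>\<rho>\<close> as a difference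
    of two measures, as \<open>signed_integral_decomp\<close> expects.\<close>
  define n where "n = null_measure M"
  have n: "finite_measure n" "sets n = sets M" by (auto intro!: finite_measureI simp: n_def)
  define a0 a b where "a0 = scale_by w (distr N M T)"
    and "a = scale_by w (distr (density N (\<lambda>z. ennreal (Dp z))) M T)"
    and "b = scale_by w (distr (density N (\<lambda>z. ennreal (Dn z))) M T)"
  have T': "T \<in> measurable (density N (\<lambda>z. ennreal (Dp z))) M" "T \<in> measurable (density N (\<lambda>z. ennreal (Dn z))) M"
    by simp_all
  have ab: "finite_measure a0" "finite_measure a" "finite_measure b" "sets a0 = sets M" "sets a = sets M" "sets b = sets M"
    unfolding a0_def a_def b_def
    by (auto intro!: finite_measure_scale_by N.finite_measure_distr
      finite_measure.finite_measure_distr[OF finite_measure_density_real[OF Dpi(1)] T'(1)]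
      finite_measure.finite_measure_distr[OF finite_measure_density_real[OF Dpi(2)] T'(2)])
  define \<rho> where "\<rho> A = measure a0 A - measure n A" for A
  define F where "F A = measure a A - measure b A" for A
  have \<rho>: "signed_measure M \<rho>" unfolding \<rho>_def[abs_def] by (rule signed_measure_measure) (use ab n in auto)
  have F: "signed_measure M F" unfolding F_def[abs_def] by (rule signed_measure_measure) (use ab in auto)
  have int\<rho>: "signed_integral M \<rho> h = w * (\<integral>z. h (T z) \<partial>N)"
    if h: "h \<in> borel_measurable M" "\<And>x. x \<in> ?Q \<Longrightarrow> \<bar>h x\<bar> \<le> c" for h c
  proof -
    have "signed_integral M \<rho> h = integral\<^sup>L a0 h - integral\<^sup>L n h"
      by (rule signed_integral_decomp[OF \<rho> _ _ _ _ _ h(1), where c=c]) (use ab n h sp in \<open>auto simp: \<rho>_def\<close>)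
    also have "integral\<^sup>L n h = 0" unfolding n_def by (simp add: integral_null_measure)
    also have "integral\<^sup>L a0 h = w * (\<integral>z. h (T z) \<partial>N)"
      unfolding a0_def using w0 h(1) by (simp add: integral_scale_by integral_distr)
    finally show ?thesis by simp
  qed
  have intF: "signed_integral M F h = w * (\<integral>z. D z * h (T z) \<partial>N)"
    if h: "h \<in> borel_measurable M" "\<And>x. x \<in> ?Q \<Longrightarrow> \<bar>h x\<bar> \<le> c" for h c
  proof -
    have [measurable]: "h \<in> borel_measurable M" by fact
    have hT[measurable]: "(\<lambda>z. h (T z)) \<in> borel_measurable N" by measurable
    have i: "integrable N (\<lambda>z. k z * h (T z))" if k: "k \<in> borel_measurable N" "\<And>z. z \<in> space N \<Longrightarrow> \<bar>k z\<bar> \<le> l" for k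
    proof (rule intN)
      show "(\<lambda>z. k z * h (T z)) \<in> borel_measurable N" using k(1) by measurable
      fix z assume z: "z \<in> space N"
      show "\<bar>k z * h (T z)\<bar> \<le> l * c"
        unfolding abs_mult using k(2)[OF z] h(2)[OF TQ[OF z]] l by (intro mult_mono) auto
    qed
    have i1: "integrable N (\<lambda>z. Dp z * h (T z))" using Dl l by (intro i) (auto simp: Dp_def abs_le_iff)
    have i2: "integrable N (\<lambda>z. Dn z * h (T z))" using Dl l by (intro i) (auto simp: Dn_def abs_le_iff)
    have "signed_integral M F h = integral\<^sup>L a h - integral\<^sup>L b h"
      by (rule signed_integral_decomp[OF F _ _ _ _ _ h(1), where c=c]) (use ab h sp in \<open>auto simp: F_def\<close>)
    also have "integral\<^sup>L a h = w * (\<integral>z. Dp z * h (T z) \<partial>N)"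
      unfolding a_def using w0 h(1) Dpn(1) T'(1) by (simp add: integral_scale_by integral_distr integral_density)
    also have "integral\<^sup>L b h = w * (\<integral>z. Dn z * h (T z) \<partial>N)"
      unfolding b_def using w0 h(1) Dpn(2) T'(2) by (simp add: integral_scale_by integral_distr integral_density)
    also have "w * (\<integral>z. Dp z * h (T z) \<partial>N) - w * (\<integral>z. Dn z * h (T z) \<partial>N) = w * (\<integral>z. Dp z * h (T z) - Dn z * h (T z) \<partial>N)"
      using i1 i2 by (simp add: right_diff_distrib)
    also have "\<dots> = w * (\<integral>z. D z * h (T z) \<partial>N)" by (simp add: Dpn(3) left_diff_distrib)
    finally show ?thesis .
  qed
  have Qb: "?Q \<in> sets borel" by (intro borel_closed closed_Times) auto
  \<comment> \<open>Particles with different velocities may meet, so the density of \<open>F\<close>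
    with respect to \<open>\<rho>\<close> is not explicit. Through the dual bound it suffices to
    estimate on \<open>N\<close>, where \<open>p + D * q \<le> D\<^sup>2 / 2\<close> holds pointwise
    and velocities are at most \<open>l\<close>.\<close>
  have "density_action (ref_measure M \<rho> F) \<rho> F \<le> ennreal (w * (l\<^sup>2 / 2 * measure N (space N)))"
    unfolding M_def
  proof (rule density_action_le_dual[OF Qb \<rho>[unfolded M_def] F[unfolded M_def]], fold M_def)
    fix p q :: "real \<times> real \<Rightarrow> real" and c
    assume pq: "continuous_on UNIV p" "continuous_on UNIV q" "\<And>x. \<bar>p x\<bar> \<le> c" "\<And>x. \<bar>q x\<bar> \<le> c" "\<And>x. p x + (q x)\<^sup>2 / 2 \<le> 0"
    have [measurable]: "p \<in> borel_measurable M" "q \<in> borel_measurable M"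
      unfolding M_def using pq by (auto intro!: measurable_restrict_space1 borel_measurable_continuous_onI)
    have i1: "integrable N (\<lambda>z. p (T z))" using pq(3) by (intro intN[where c=c]) auto
    have i2: "integrable N (\<lambda>z. D z * q (T z))"
    proof (rule intN)
      fix z assume z: "z \<in> space N"
      show "\<bar>D z * q (T z)\<bar> \<le> l * c"
        unfolding abs_mult using Dl[OF z] pq(4) l by (intro mult_mono) auto
    qed measurable
    have "signed_integral M \<rho> p + signed_integral M F q = w * (\<integral>z. p (T z) + D z * q (T z) \<partial>N)"
      using int\<rho>[of p c] intF[of q c] pq(3,4) i1 i2 by (simp add: distrib_left)
    also have "\<dots> \<le> w * (\<integral>z. l\<^sup>2 / 2 \<partial>N)"
    proof (intro mult_left_mono integral_mono w0)
      fix z assume z: "z \<in> space N"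
      have "p (T z) + D z * q (T z) \<le> - (q (T z))\<^sup>2 / 2 + D z * q (T z)" using pq(5)[of "T z"] by simp
      also have "\<dots> = (D z)\<^sup>2 / 2 - (q (T z) - D z)\<^sup>2 / 2" by (simp add: power2_diff field_simps power2_eq_square)
      also have "\<dots> \<le> (D z)\<^sup>2 / 2" by simp
      also have "\<dots> \<le> l\<^sup>2 / 2" using power_mono[OF Dl[OF z], of 2] by simp
      finally show "p (T z) + D z * q (T z) \<le> l\<^sup>2 / 2" .
    qed (use i1 i2 in auto)
    finally show "ennreal (signed_integral M \<rho> p + signed_integral M F q) \<le> ennreal (w * (l\<^sup>2 / 2 * measure N (space N)))"
      by (intro ennreal_leI) (simp add: mult.commute)
  qed
  then have act: "density_action (ref_measure M \<rho> F) \<rho> F < \<infinity>" by (rule le_less_trans) simp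
  have "signed_integral M \<rho> (dt g) + signed_integral M F (dx l g) = (LINT x|r1. g (1, x)) - (LINT x|r0. g (0, x))"
    if g: "C1_rect l g" for g
  proof -
    have gc: "continuous_on ?Q (dt g)" "continuous_on ?Q (dx l g)" "continuous_on ?Q g"
      using g C1_rect_continuous_on[OF g] by (simp_all add: C1_rect_def)
    have cQ: "compact ?Q" by (intro compact_Times) auto
    have gm[measurable]: "dt g \<in> borel_measurable M" "dx l g \<in> borel_measurable M" "g \<in> borel_measurable M"
      unfolding M_def by (intro borel_measurable_continuous_on_restrict gc)+
    have "bounded (dt g ` ?Q)" "bounded (dx l g ` ?Q)" "bounded (g ` ?Q)"
      using gc cQ by (auto intro!: compact_imp_bounded compact_continuous_image)
    then obtain c1 c2 c3 where c: "\<And>z. z \<in> ?Q \<Longrightarrow> \<bar>dt g z\<bar> \<le> c1" "\<And>z. z \<in> ?Q \<Longrightarrow> \<bar>dx l g z\<bar> \<le> c2"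
       "\<And>z. z \<in> ?Q \<Longrightarrow> \<bar>g z\<bar> \<le> c3" unfolding bounded_iff by (metis imageI real_norm_def)
    have i1: "integrable N (\<lambda>z. dt g (T z))" using c(1) TQ by (intro intN[where c=c1]) auto
    have i2: "integrable N (\<lambda>z. D z * dx l g (T z))"
    proof (rule intN)
      fix z assume z: "z \<in> space N"
      show "\<bar>D z * dx l g (T z)\<bar> \<le> l * c2"
        unfolding abs_mult using Dl[OF z] c(2)[OF TQ[OF z]] l by (intro mult_mono) auto
    qed measurable
    have slice: "(\<lambda>x. g (t, x)) \<in> borel_measurable (restrict_space borel {0<..<l})" if "t \<in> {0..1}" for t
    proof (rule borel_measurable_continuous_on_restrict)
      show "continuous_on {0<..<l} (\<lambda>x. g (t, x))"
        using that by (intro continuous_on_compose2[OF gc(3)] continuous_intros) auto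
    qed
    have gi0: "integrable r0 (\<lambda>x. g (0, x))"
      using c(3) by (intro integrable_finite_bounded[OF fin(1) sets0, of _ c3] slice) (auto simp: space_restrict_space)
    have gi1: "integrable r1 (\<lambda>x. g (1, x))"
      using c(3) by (intro integrable_finite_bounded[OF fin(2) sets1, of _ c3] slice) (auto simp: space_restrict_space)
    have "signed_integral M \<rho> (dt g) + signed_integral M F (dx l g) = w * (\<integral>z. dt g (T z) + D z * dx l g (T z) \<partial>N)"
      using int\<rho>[OF gm(1) c(1)] intF[OF gm(2) c(2)] i1 i2 by (simp add: distrib_left)
    \<comment> \<open>By Fubini the time integral comes first, and it telescopes along each particle
      path.\<close>
    also have "(\<integral>z. dt g (T z) + D z * dx l g (T z) \<partial>N) =
      (\<integral>u. (LINT t|lborel_I. dt g (T (u, t)) + D (u, t) * dx l g (T (u, t))) \<partial>(r0 \<Otimes>\<^sub>M r1))"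
      using i1 i2 unfolding N_def by (subst PI.integral_fst') auto
    also have "\<dots> = (\<integral>u. g (1, snd u) - g (0, fst u) \<partial>(r0 \<Otimes>\<^sub>M r1))"
    proof (rule Bochner_Integration.integral_cong[OF refl])
      fix u assume "u \<in> space (r0 \<Otimes>\<^sub>M r1)"
      then have "fst u \<in> {0..l}" "snd u \<in> {0..l}" by (auto simp: space_pair_measure sp)
      from C1_rect_along_segment[OF g this]
      show "(LINT t|lborel_I. dt g (T (u, t)) + D (u, t) * dx l g (T (u, t))) = g (1, snd u) - g (0, fst u)"
        by (simp add: T_def D_def)
    qed
    also have "\<dots> = (\<integral>x. (\<integral>y. g (1, y) - g (0, x) \<partial>r1) \<partial>r0)"
    proof (subst r01.integral_fst'[symmetric])
      have "integrable (r0 \<Otimes>\<^sub>M r1) (\<lambda>u. g (1, snd u))" "integrable (r0 \<Otimes>\<^sub>M r1) (\<lambda>u. g (0, fst u))"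
      proof -
        have [measurable]: "(\<lambda>u. g (1, snd u)) \<in> borel_measurable (r0 \<Otimes>\<^sub>M r1)" "(\<lambda>u. g (0, fst u)) \<in> borel_measurable (r0 \<Otimes>\<^sub>M r1)"
          using measurable_compose[OF measurable_snd borel_measurable_integrable[OF gi1]]
            measurable_compose[OF measurable_fst borel_measurable_integrable[OF gi0]] by auto
        show "integrable (r0 \<Otimes>\<^sub>M r1) (\<lambda>u. g (1, snd u))" "integrable (r0 \<Otimes>\<^sub>M r1) (\<lambda>u. g (0, fst u))"
          using c(3) by (auto intro!: integrable_finite_bounded[OF P.finite_measure_axioms refl, where c=c3] simp: space_pair_measure sp)
      qed
      then show "integrable (r0 \<Otimes>\<^sub>M r1) (\<lambda>u. g (1, snd u) - g (0, fst u))" by simp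
    qed simp
    \<comment> \<open>Each term depends on one endpoint only; integrating out the other endpoint
      produces the common mass \<open>m\<close>, which \<open>w\<close> cancels.\<close>
    also have "\<dots> = m * ((LINT x|r1. g (1, x)) - (LINT x|r0. g (0, x)))"
      using gi0 gi1 mass by (simp add: sp m_def right_diff_distrib mult.commute)
    also have "w * \<dots> = (LINT x|r1. g (1, x)) - (LINT x|r0. g (0, x))"
    proof (cases "m = 0")
      case True
      then have "emeasure r0 (space r0) = 0" "emeasure r1 (space r1) = 0"
        using mass by (simp_all add: m_def sp r0.emeasure_eq_measure r1.emeasure_eq_measure)
      then have "AE x in r0. g (0, x) = 0" "AE x in r1. g (1, x) = 0"
        by (auto intro!: AE_I[where N="space _"])
      then show ?thesis using True by (simp add: integral_eq_zero_AE)
    qed (simp add: w_def)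
    finally show ?thesis .
  qed
  with \<rho> F act show ?thesis by blast
qed

text \<open>Moving mass inside the edges creates no vertex sources, so the weak equation on the
  network is the sum of the identities on the single edges, and the action is a finite sum of finite
  terms.\<close>

lemma W_edge_sq_finite:
  fixes G :: "('v::finite, 'e::finite) network"
  assumes G: "planar_network G" and a0: "admissible G \<rho>0 \<gamma>0" and a1: "admissible G \<rho>1 \<gamma>1"
    and mass: "\<And>j. measure (\<rho>0 j) (open_edge G j) = measure (\<rho>1 j) (open_edge G j)"
  shows "W_edge_sq G \<rho>0 \<rho>1 < \<infinity>"
proof -
  have s0: "finite_measure (\<rho>0 j)" "sets (\<rho>0 j) = sets (restrict_space borel (open_edge G j))"
    and s1: "finite_measure (\<rho>1 j)" "sets (\<rho>1 j) = sets (restrict_space borel (open_edge G j))" for j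
    using a0 a1 by (auto simp: admissible_def)
  have "\<forall>j. \<exists>\<rho> F. signed_measure (borel_Q G j) \<rho> \<and> signed_measure (borel_Q G j) F \<and>
    density_action (ref_measure (borel_Q G j) \<rho> F) \<rho> F < \<infinity> \<and>
    (\<forall>g. C1_rect (len G j) g \<longrightarrow> signed_integral (borel_Q G j) \<rho> (dt g) + signed_integral (borel_Q G j) F (dx (len G j) g) =
      (LINT x|\<rho>1 j. g (1, x)) - (LINT x|\<rho>0 j. g (0, x)))"
    unfolding Q_edge_def
    using edge_transport[OF planar_network_len[OF G] s0(1) s1(1) s0(2) s1(2) mass] by blast
  then obtain \<rho> F where H: "\<And>j. signed_measure (borel_Q G j) (\<rho> j)" "\<And>j. signed_measure (borel_Q G j) (F j)"
    "\<And>j. density_action (ref_measure (borel_Q G j) (\<rho> j) (F j)) (\<rho> j) (F j) < \<infinity>"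
    "\<And>j g. C1_rect (len G j) g \<Longrightarrow> signed_integral (borel_Q G j) (\<rho> j) (dt g) + signed_integral (borel_Q G j) (F j) (dx (len G j) g) =
      (LINT x|\<rho>1 j. g (1, x)) - (LINT x|\<rho>0 j. g (0, x))"
    by metis
  have "edge_equation G \<rho>0 \<rho>1 \<rho> F (\<lambda>i B. 0)"
    unfolding edge_equation_def signed_integral_zero_measure
  proof (intro allI impI)
    fix \<phi> assume "C1_network G \<phi>"
    then have g: "C1_rect (len G j) (on_edge G j \<phi>)" for j by (simp add: C1_network_def)
    have m: "(\<lambda>x. on_edge G j \<phi> (t, x)) \<in> borel_measurable (restrict_space borel (closed_edge G j))" if "t \<in> {0..1}" for t j
    proof (rule borel_measurable_continuous_on_restrict)
      show "continuous_on (closed_edge G j) (\<lambda>x. on_edge G j \<phi> (t, x))"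
        using that by (intro continuous_on_compose2[OF C1_rect_continuous_on[OF g]] continuous_intros) auto
    qed
    show "(\<Sum>j\<in>UNIV. signed_integral (borel_Q G j) (\<rho> j) (dt (on_edge G j \<phi>))
                 + signed_integral (borel_Q G j) (F j) (dx (len G j) (on_edge G j \<phi>)))
        - (\<Sum>i\<in>(UNIV::'v set). 0)
        = (\<Sum>j\<in>UNIV. (LINT x|extend_zero G j (\<rho>1 j). on_edge G j \<phi> (1, x))
                   - (LINT x|extend_zero G j (\<rho>0 j). on_edge G j \<phi> (0, x)))"
      by (simp add: H(4)[OF g] integral_extend_zero[OF s0(2) m] integral_extend_zero[OF s1(2) m])
  qed
  then have "(\<rho>, F) \<in> CE_edge G \<rho>0 \<rho>1" using H by (simp add: CE_edge_def)
  then have "W_edge_sq G \<rho>0 \<rho>1 \<le> edge_action G \<rho> F" unfolding W_edge_sq_def by (rule INF_lower2) simp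
  also have "\<dots> < \<infinity>" unfolding edge_action_def using H(3) by (simp add: less_top ennreal_sum_less_top)
  finally show ?thesis .
qed


section \<open>The limit of large vertex cost\<close>

lemma W_sq_less_obtain:
  assumes "W_sq G \<kappa> \<rho>0 \<rho>1 \<gamma>0 \<gamma>1 < b"
  obtains \<mu> where "\<mu> \<in> CE G \<rho>0 \<rho>1 \<gamma>0 \<gamma>1" "action G \<kappa> \<mu> < b"
  using assms unfolding W_sq_def by (auto simp: INF_less_iff)

text \<open>The costs lie below the limit cost for every \<open>\<kappa>\<close>. Were they not
  eventually above a smaller \<open>a\<close>, almost minimizing curves along some diverging
  \<open>K\<close> would have a limit with too small an edge action.\<close>

lemma W_sq_tendsto:
  fixes G :: "('v::finite, 'e::finite) network"
  assumes G: "planar_network G" and \<rho>1: "admissible G \<rho>1 \<gamma>" and \<gamma>: "\<And>i. 0 \<le> \<gamma> i"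
  shows "((\<lambda>\<kappa>. W_sq G \<kappa> \<rho>0 \<rho>1 \<gamma> \<gamma>) \<longlongrightarrow> W_edge_sq G \<rho>0 \<rho>1) at_top"
proof (rule order_tendstoI)
  fix a assume a: "a < W_edge_sq G \<rho>0 \<rho>1"
  show "\<forall>\<^sub>F \<kappa> in at_top. a < W_sq G \<kappa> \<rho>0 \<rho>1 \<gamma> \<gamma>"
  proof (rule ccontr)
    assume "\<not> (\<forall>\<^sub>F \<kappa> in at_top. a < W_sq G \<kappa> \<rho>0 \<rho>1 \<gamma> \<gamma>)"
    then have "\<exists>\<kappa>\<ge>real n + 1. W_sq G \<kappa> \<rho>0 \<rho>1 \<gamma> \<gamma> \<le> a" for n
      unfolding eventually_at_top_linorder by (metis linorder_not_less)
    then obtain K where K: "\<And>n. K n \<ge> real n + 1" "\<And>n. W_sq G (K n) \<rho>0 \<rho>1 \<gamma> \<gamma> \<le> a" by metis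
    \<comment> \<open>The room between \<open>a\<close> and \<open>b\<close> provides curves of
      action below \<open>b\<close> although infima need not be attained, and \<open>b\<close> is
      finite even if the limit cost is infinite.\<close>
    obtain b where b: "a < b" "b < W_edge_sq G \<rho>0 \<rho>1" using dense[OF a] by blast
    obtain C where C: "0 \<le> C" "b = ennreal C"
      using b(2) by (cases b) auto
    have "\<exists>\<mu>. \<mu> \<in> CE G \<rho>0 \<rho>1 \<gamma> \<gamma> \<and> action G (K n) \<mu> \<le> ennreal C" for n
      using le_less_trans[OF K(2) b(1), of n] unfolding C(2) by (elim W_sq_less_obtain) auto
    then obtain \<mu> where \<mu>: "\<And>n. \<mu> n \<in> CE G \<rho>0 \<rho>1 \<gamma> \<gamma>" "\<And>n. action G (K n) (\<mu> n) \<le> ennreal C" by metis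
    have K0: "K n > 0" for n using K(1)[of n] by linarith
    have "filterlim K at_top sequentially"
      by (rule filterlim_at_top_mono[OF filterlim_real_sequentially])
        (use K(1) in \<open>auto intro!: always_eventually order_trans[OF _ K(1)]\<close>)
    from CE_limit[OF G \<rho>1 \<mu>(1) K0 this C(1) \<mu>(2)] obtain \<rho> F
      where "(\<rho>, F) \<in> CE_edge G \<rho>0 \<rho>1" and le: "edge_action G \<rho> F \<le> ennreal C" by blast
    then have "W_edge_sq G \<rho>0 \<rho>1 \<le> edge_action G \<rho> F" unfolding W_edge_sq_def by (intro INF_lower2) auto
    with le b(2) C(2) show False by auto
  qed
next
  fix a assume "W_edge_sq G \<rho>0 \<rho>1 < a"
  then show "\<forall>\<^sub>F \<kappa> in at_top. W_sq G \<kappa> \<rho>0 \<rho>1 \<gamma> \<gamma> < a"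
    using W_sq_le_W_edge_sq[of \<gamma> G _ \<rho>0 \<rho>1] \<gamma> by (intro always_eventually allI) (auto intro: le_less_trans)
qed

lemma W_sq_tendsto_infinity:
  fixes G :: "('v::finite, 'e::finite) network"
  assumes G: "planar_network G" and \<rho>1: "admissible G \<rho>1 \<gamma>1" and "\<gamma>0 \<noteq> \<gamma>1"
  shows "((\<lambda>\<kappa>. W_sq G \<kappa> \<rho>0 \<rho>1 \<gamma>0 \<gamma>1) \<longlongrightarrow> \<infinity>) at_top"
proof (rule order_tendstoI)
  fix a :: ennreal assume "a < \<infinity>"
  then obtain C where C: "0 \<le> C" "a = ennreal C" by (cases a) auto
  obtain i where i: "\<gamma>0 i \<noteq> \<gamma>1 i" using \<open>\<gamma>0 \<noteq> \<gamma>1\<close> by blast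
  define \<delta> where "\<delta> = \<bar>\<gamma>1 i - \<gamma>0 i\<bar>"
  have \<delta>: "\<delta> > 0" using i by (simp add: \<delta>_def)
  show "\<forall>\<^sub>F \<kappa> in at_top. a < W_sq G \<kappa> \<rho>0 \<rho>1 \<gamma>0 \<gamma>1"
    \<comment> \<open>Beyond this threshold the flux bound for action \<open>C + 1\<close> drops
      below the change \<open>\<delta>\<close> of the vertex mass. The extra 1 is the room for
      choosing an almost minimizing curve.\<close>
    using eventually_gt_at_top[of "(C + 1 + 1 / 2) / \<delta>"]
  proof eventually_elim
    case (elim \<kappa>)
    have "0 < (C + 1 + 1 / 2) / \<delta>" using C \<delta> by simp
    then have \<kappa>: "\<kappa> > 0" using elim by linarith
    show ?case
    proof (rule ccontr)
      assume "\<not> a < W_sq G \<kappa> \<rho>0 \<rho>1 \<gamma>0 \<gamma>1"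
      moreover have "a < ennreal (C + 1)" using C by (auto simp: ennreal_less_iff)
      ultimately have "W_sq G \<kappa> \<rho>0 \<rho>1 \<gamma>0 \<gamma>1 < ennreal (C + 1)" by auto
      then obtain \<mu> where \<mu>: "\<mu> \<in> CE G \<rho>0 \<rho>1 \<gamma>0 \<gamma>1" "action G \<kappa> \<mu> < ennreal (C + 1)"
        by (rule W_sq_less_obtain)
      have "\<delta> \<le> total_mass borel_I (vflux \<mu> i)"
        unfolding \<delta>_def using \<mu>(1) by (intro vflux_total[of _ _ "gam \<mu>"]) (auto simp: CE_def)
      also have "\<dots> \<le> (C + 1 + 1 / 2) / \<kappa>"
        by (rule CE_action_bounds(3)[OF G \<rho>1 \<mu>(1) \<kappa>]) (use C \<mu>(2) in auto)
      also have "\<dots> < \<delta>" using elim \<delta> \<kappa> by (simp add: field_simps)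
      finally show False by simp
    qed
  qed
qed simp

lemma W_geodesic_le_W_edge_sq:
  fixes G :: "('v::finite, 'e::finite) network"
  assumes "W_geodesic G \<kappa> \<rho>0 \<rho>1 \<gamma> \<gamma> \<mu>" and \<gamma>: "\<And>i. 0 \<le> \<gamma> i"
  shows "\<mu> \<in> CE G \<rho>0 \<rho>1 \<gamma> \<gamma>" "action G \<kappa> \<mu> \<le> W_edge_sq G \<rho>0 \<rho>1"
proof -
  show "\<mu> \<in> CE G \<rho>0 \<rho>1 \<gamma> \<gamma>"
    using assms(1) by (simp add: W_geodesic_def is_arg_min_def)
  have "action G \<kappa> \<mu> \<le> W_sq G \<kappa> \<rho>0 \<rho>1 \<gamma> \<gamma>"
    unfolding W_sq_def using assms(1)
    by (intro INF_greatest) (auto simp: W_geodesic_def is_arg_min_def not_less)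
  then show "action G \<kappa> \<mu> \<le> W_edge_sq G \<rho>0 \<rho>1"
    using W_sq_le_W_edge_sq[OF \<gamma>] by (rule order_trans)
qed

lemma total_mass_nonneg: "0 \<le> total_mass M \<mu>"
  by (simp add: total_mass_def)

theorem proposition4p6:
  fixes G :: "('v::finite, 'e::finite) network"
    and \<rho>0 \<rho>1 :: "'e \<Rightarrow> real measure"
    and \<gamma>0 \<gamma>1 :: "'v \<Rightarrow> real"
  assumes "planar_network G"
    and "admissible G \<rho>0 \<gamma>0"
    and "admissible G \<rho>1 \<gamma>1"
  shows "((\<lambda>\<kappa>::real. W_sq G \<kappa> \<rho>0 \<rho>1 \<gamma>0 \<gamma>1)
            \<longlongrightarrow> (if \<gamma>0 = \<gamma>1 then W_edge_sq G \<rho>0 \<rho>1 else \<infinity>)) at_top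
    \<and> (\<forall>\<mu> :: real \<Rightarrow> ('v, 'e) curve.
          (\<forall>\<kappa>>0. W_geodesic G \<kappa> \<rho>0 \<rho>1 \<gamma>0 \<gamma>1 (\<mu> \<kappa>)) \<longrightarrow>
          \<gamma>0 = \<gamma>1 \<longrightarrow>
          (\<forall>j. measure (\<rho>0 j) (open_edge G j) = measure (\<rho>1 j) (open_edge G j)) \<longrightarrow>
          (\<forall>K :: nat \<Rightarrow> real. (\<forall>n. K n > 0) \<longrightarrow> filterlim K at_top sequentially \<longrightarrow>
             (\<exists>s \<rho> F. strict_mono (s :: nat \<Rightarrow> nat) \<and>
                W_edge_geodesic G \<rho>0 \<rho>1 \<rho> F \<and>
                (\<forall>j. narrowly_converges (Q_edge G j) (\<lambda>n. rho (\<mu> (K (s n))) j) (\<rho> j) \<and>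
                     narrowly_converges (Q_edge G j) (\<lambda>n. flux (\<mu> (K (s n))) j) (F j)))) \<and>
          (\<forall>i. ((\<lambda>\<kappa>. total_mass borel_I (vflux (\<mu> \<kappa>) i)) \<longlongrightarrow> 0) at_top))"
proof (intro conjI allI impI)
  have \<gamma>_nonneg: "0 \<le> \<gamma>0 i" for i using assms(2) by (simp add: admissible_def)
  show "((\<lambda>\<kappa>::real. W_sq G \<kappa> \<rho>0 \<rho>1 \<gamma>0 \<gamma>1)
            \<longlongrightarrow> (if \<gamma>0 = \<gamma>1 then W_edge_sq G \<rho>0 \<rho>1 else \<infinity>)) at_top"
  proof (cases "\<gamma>0 = \<gamma>1")
    case True
    then show ?thesis using W_sq_tendsto[OF assms(1,3)] \<gamma>_nonneg by simp
  next
    case False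
    then show ?thesis using W_sq_tendsto_infinity[OF assms(1,3) False] by simp
  qed
  fix \<mu> :: "real \<Rightarrow> ('v, 'e) curve"
  assume geo: "\<forall>\<kappa>>0. W_geodesic G \<kappa> \<rho>0 \<rho>1 \<gamma>0 \<gamma>1 (\<mu> \<kappa>)" and eq: "\<gamma>0 = \<gamma>1"
    and mass: "\<forall>j. measure (\<rho>0 j) (open_edge G j) = measure (\<rho>1 j) (open_edge G j)"
  have "W_edge_sq G \<rho>0 \<rho>1 < \<infinity>"
    using mass by (intro W_edge_sq_finite[OF assms]) simp
  then obtain C where C: "0 \<le> C" "W_edge_sq G \<rho>0 \<rho>1 = ennreal C"
    by (cases "W_edge_sq G \<rho>0 \<rho>1") auto
  \<comment> \<open>The limit cost is finite and bounds the action of the geodesics for all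
    \<open>\<kappa>\<close> at once.\<close>
  have ce: "\<mu> \<kappa> \<in> CE G \<rho>0 \<rho>1 \<gamma>0 \<gamma>1" and le: "action G \<kappa> (\<mu> \<kappa>) \<le> ennreal C" if "\<kappa> > 0" for \<kappa>
    using W_geodesic_le_W_edge_sq[of G \<kappa> \<rho>0 \<rho>1 \<gamma>0 "\<mu> \<kappa>"] geo that \<gamma>_nonneg eq C(2) by auto
  {
    fix K :: "nat \<Rightarrow> real" assume K: "\<forall>n. K n > 0" "filterlim K at_top sequentially"
    have K0: "K n > 0" for n using K(1) by simp
    obtain s \<rho> F where s: "strict_mono (s :: nat \<Rightarrow> nat)" and \<rho>F: "(\<rho>, F) \<in> CE_edge G \<rho>0 \<rho>1"
      and act: "edge_action G \<rho> F \<le> ennreal C"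
      and lim: "\<forall>j. narrowly_converges (Q_edge G j) (\<lambda>n. rho (\<mu> (K (s n))) j) (\<rho> j) \<and>
          narrowly_converges (Q_edge G j) (\<lambda>n. flux (\<mu> (K (s n))) j) (F j)"
      using CE_limit[OF assms(1,3) ce[OF K0] K0 K(2) C(1) le[OF K0]] by blast
    \<comment> \<open>The action of the limit curve is at most \<open>C\<close>, which is the
      infimum itself.\<close>
    have "\<not> edge_action G \<rho>' F' < edge_action G \<rho> F" if "(\<rho>', F') \<in> CE_edge G \<rho>0 \<rho>1" for \<rho>' F'
    proof -
      have "edge_action G \<rho> F \<le> W_edge_sq G \<rho>0 \<rho>1" using act C(2) by simp
      also have "\<dots> \<le> edge_action G \<rho>' F'"
        unfolding W_edge_sq_def using that by (intro INF_lower2) auto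
      finally show ?thesis by simp
    qed
    then have "W_edge_geodesic G \<rho>0 \<rho>1 \<rho> F"
      using \<rho>F unfolding W_edge_geodesic_def is_arg_min_def by auto
    with s lim show "\<exists>s \<rho> F. strict_mono (s :: nat \<Rightarrow> nat) \<and>
                W_edge_geodesic G \<rho>0 \<rho>1 \<rho> F \<and>
                (\<forall>j. narrowly_converges (Q_edge G j) (\<lambda>n. rho (\<mu> (K (s n))) j) (\<rho> j) \<and>
                     narrowly_converges (Q_edge G j) (\<lambda>n. flux (\<mu> (K (s n))) j) (F j))"
      by blast
  }
  fix i
  show "((\<lambda>\<kappa>. total_mass borel_I (vflux (\<mu> \<kappa>) i)) \<longlongrightarrow> 0) at_top"
  \<comment> \<open>The flux bound is explicit in \<open>\<kappa>\<close>, so the vertex fluxes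
    vanish along the whole family, without extraction.\<close>
  proof (rule tendsto_sandwich[OF _ _ tendsto_const])
    show "\<forall>\<^sub>F \<kappa> in at_top. 0 \<le> total_mass borel_I (vflux (\<mu> \<kappa>) i)"
      by (simp add: total_mass_nonneg)
    show "\<forall>\<^sub>F \<kappa> in at_top. total_mass borel_I (vflux (\<mu> \<kappa>) i) \<le> (C + 1 / 2) / \<kappa>"
      using eventually_gt_at_top[of 0]
      by eventually_elim (rule CE_action_bounds(3)[OF assms(1,3) ce _ C(1) le])
    show "((\<lambda>\<kappa>::real. (C + 1 / 2) / \<kappa>) \<longlongrightarrow> 0) at_top"
      by (intro tendsto_divide_0[OF tendsto_const] filterlim_at_top_imp_at_infinity filterlim_ident)
  qed
qed

end
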